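(* Let $\mathcal{X}$ be a connected complete Kobayashi hyperbolic complex manifold, and let $\Omega\subsetneq\mathcal{Y}$ be a Kobayashi hyperbolic domain in a complex manifold $\mathcal{Y}$ that satisfies the visibility property (with respect to all $(\lambda,\kappa)$-almost-geodesics, $\lambda\ge 1$, $\kappa>0$). Then any continuous quasi-isometric embedding $F:(\mathcal{X},\mathsf{k}_{\mathcal{X}})\to(\Omega,\mathsf{k}_\Omega)$ extends to a continuous map from $\overline{\mathcal{X}}^{\mathsf{k}}$ to $\overline{\Omega}^{\mathrm{End}}$; i.e. there is a continuous map $\widetilde F:\overline{\mathcal{X}}^{\mathsf{k}}\to\overline{\Omega}^{\mathrm{End}}$ with $\widetilde F\circ i_{\mathsf{k}}=F$ on $\mathcal{X}$.
   Context: $\mathsf{k}_M$ denotes the Kobayashi distance of a Kobayashi hyperbolic connected complex manifold $M$; $M$ is complete Kobayashi hyperbolic if $(M,\mathsf{k}_M)$ is a complete metric space. Normalization: $\mathsf{k}_{\mathbb{D}}(0,\zeta)=\frac12\log\frac{1+|\zeta|}{1-|\zeta|}$ on the unit disc. A domain is a nonempty connected open set. Quasi-isometric embedding: a map $F$ between metric spaces $(X,d_X)\to(Y,d_Y)$ for which there are $\lambda\ge1$, $\kappa\ge0$ with $\lambda^{-1}d_X(x,x')-\kappa\le d_Y(F(x),F(x'))\le\lambda d_X(x,x')+\kappa$ for all $x,x'\in X$. Metric compactification of $(X,d)$: let $C(X)$ be the real-valued continuous functions on $X$ with the topology of local uniform convergence, $C_*(X)$ its quotient by the constant functions with the quotient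 topology, and $i_d:X\to C_*(X)$, $i_d(x)=[d(x,\cdot)]$. Then $\overline{X}^d$ is the closure of $i_d(X)$ in $C_*(X)$. For $(\mathcal{X},\mathsf{k}_{\mathcal{X}})$ we write $\overline{\mathcal{X}}^{\mathsf{k}}$ and $i_{\mathsf{k}}$. End compactification of $\Omega\subsetneq\mathcal{Y}$: let $\overline\Omega$ be the closure of $\Omega$ in $\mathcal{Y}$ and $(K_j)_{j\ge1}$ an exhaustion of $\overline\Omega$ by compact sets with $K_j\subset\mathrm{int}(K_{j+1})$. An end is a sequence $(F_j)_{j\ge1}$ where $F_j$ is a connected component of $\overline\Omega\setminus K_j$ and $F_{j+1}\subset F_j$. With $\mathcal{E}$ the set of ends, $\overline\Omega^{\mathrm{End}}=\overline\Omega\sqcup\mathcal{E}$. A neighbourhood basis at $x\in\overline\Omega$ is given by the sets $U\cap\overline\Omega$, $U$ a neighbourhood of $x$ in $\mathcal{Y}$; a neighbourhood basis at an end $e=(F_j)_{j\ge1}$ is given by $\widehat F_j=F_j\sqcup\{(G_\nu)_{\nu\ge1}\in\mathcal{E}: G_\nu=F_\nu,\ \nu=1,\dots,j\}$, $j\ge1$. This is a first-countable Hausdorff topology independent of the exhaustion. Standing assumption: $\overline\Omega^{\mathrm{End}}$ is sequentially compact. Almost-geodesics and visibility: let $\kappa_\Omega(z;v)$ be the Kobayashi (pseudo)metric of $\Omega$ (infinitesimal form, normalized by $|v|/(1-|z|^2)$ on the unit disc). For $\lambda\ge1$, $\kappa>0$ and an interval $I$, a curve $\sigma:I\to\Omega$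 is a $(\lambda,\kappa)$-almost-geodesic if (i) $\lambda^{-1}|s-t|-\kappa\le\mathsf{k}_\Omega(\sigma(s),\sigma(t))\le\lambda|s-t|+\kappa$ for all $s,t\in I$; and (ii) $\sigma$ is absolutely continuous (so $\sigma'(t)$ exists for a.e. $t$) and $\kappa_\Omega(\sigma(t);\sigma'(t))\le\lambda$ for a.e. $t\in I$. $\Omega$ satisfies the visibility property if for every pair of distinct points $p,q\in\partial\Omega=\overline\Omega\setminus\Omega$ there are neighbourhoods $U_p$ of $p$ and $U_q$ of $q$ in $\mathcal{Y}$ with $\overline{U_p}\cap\overline{U_q}=\emptyset$ such that for each $\lambda\ge1$, $\kappa>0$ there is a compact set $K\subset\Omega$ such that every $(\lambda,\kappa)$-almost-geodesic $\sigma:[0,T]\to\Omega$ with $\sigma(0)\in U_p$, $\sigma(T)\in U_q$ has image meeting $K$. *)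

theory Defs
  imports "HOL-Analysis.Analysis"
begin

section \<open>Complex manifolds\<close>

text \<open>
  A chart is a pair of its domain and its coordinate map; only the values of the coordinate map on
  the domain matter.  The dimension of the manifold is the cardinality of the index type.
\<close>

type_synonym ('a, 'n) chart = "'a set \<times> ('a \<Rightarrow> complex ^ 'n)"

definition holomorphic_map_on ::
    "(complex ^ 'n::finite \<Rightarrow> complex ^ 'm::finite) \<Rightarrow> (complex ^ 'n) set \<Rightarrow> bool" where
  "holomorphic_map_on f S \<longleftrightarrow>
     open S \<and> (\<forall>z\<in>S. \<exists>D. (f has_derivative D) (at z) \<and> (\<forall>c v. D (c *s v) = c *s D v))"

definition complex_atlas :: "'a topology \<Rightarrow> ('a, 'n::finite) chart set \<Rightarrow> bool" where
  "complex_atlas X A \<longleftrightarrow>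
     (\<forall>(U, \<phi>)\<in>A. openin X U \<and> open (\<phi> ` U) \<and>
        homeomorphic_map (subtopology X U) (top_of_set (\<phi> ` U)) \<phi>) \<and>
     (\<Union>(U, \<phi>)\<in>A. U) = topspace X \<and>
     (\<forall>(U, \<phi>)\<in>A. \<forall>(V, \<psi>)\<in>A. holomorphic_map_on (\<psi> \<circ> inv_into U \<phi>) (\<phi> ` (U \<inter> V)))"

definition complex_manifold :: "'a topology \<Rightarrow> ('a, 'n::finite) chart set \<Rightarrow> bool" where
  "complex_manifold X A \<longleftrightarrow> Hausdorff_space X \<and> second_countable X \<and> complex_atlas X A"

text \<open>An open subset \<open>W\<close> of a complex manifold is a complex manifold with the following atlas.\<close>

definition restrict_atlas :: "'a set \<Rightarrow> ('a, 'n) chart set \<Rightarrow> ('a, 'n) chart set" where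
  "restrict_atlas W A = (\<lambda>(U, \<phi>). (U \<inter> W, \<phi>)) ` A"

definition holomorphic_disc ::
    "'a topology \<Rightarrow> ('a, 'n::finite) chart set \<Rightarrow> (complex \<Rightarrow> 'a) \<Rightarrow> bool" where
  "holomorphic_disc X A f \<longleftrightarrow>
     continuous_map (top_of_set (ball 0 1)) X f \<and>
     (\<forall>(U, \<phi>)\<in>A. \<forall>i. (\<lambda>\<zeta>. \<phi> (f \<zeta>) $ i) holomorphic_on {\<zeta> \<in> ball 0 1. f \<zeta> \<in> U})"

section \<open>Kobayashi distance and Kobayashi metric\<close>

definition poincare_dist :: "complex \<Rightarrow> complex \<Rightarrow> real" where
  "poincare_dist z w =
     (let r = cmod ((z - w) / (1 - cnj w * z)) in 1 / 2 * ln ((1 + r) / (1 - r)))"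

definition disc_chain_lengths ::
    "'a topology \<Rightarrow> ('a, 'n::finite) chart set \<Rightarrow> 'a \<Rightarrow> 'a \<Rightarrow> real set" where
  "disc_chain_lengths X A x y =
     {\<Sum>j<m. poincare_dist (\<zeta> j) (\<omega> j) |(m::nat) \<zeta> \<omega>.
        \<exists>p f. p 0 = x \<and> p m = y \<and>
          (\<forall>j<m. holomorphic_disc X A (f j) \<and> \<zeta> j \<in> ball 0 1 \<and> \<omega> j \<in> ball 0 1 \<and>
             f j (\<zeta> j) = p j \<and> f j (\<omega> j) = p (Suc j))}"

text \<open>
  On a connected manifold any two points are joined by a chain of discs, so that the infimum is
  taken over a nonempty set.  The value off the manifold is 0 because the library's locale
  \<open>Metric_space\<close> asks for nonnegativity and symmetry on the whole type.
\<close>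

definition kobayashi_dist ::
    "'a topology \<Rightarrow> ('a, 'n::finite) chart set \<Rightarrow> 'a \<Rightarrow> 'a \<Rightarrow> real" where
  "kobayashi_dist X A x y =
     (if x \<in> topspace X \<and> y \<in> topspace X then Inf (disc_chain_lengths X A x y) else 0)"

definition kobayashi_hyperbolic :: "'a topology \<Rightarrow> ('a, 'n::finite) chart set \<Rightarrow> bool" where
  "kobayashi_hyperbolic X A \<longleftrightarrow> Metric_space (topspace X) (kobayashi_dist X A)"

definition complete_kobayashi_hyperbolic ::
    "'a topology \<Rightarrow> ('a, 'n::finite) chart set \<Rightarrow> bool" where
  "complete_kobayashi_hyperbolic X A \<longleftrightarrow>
     kobayashi_hyperbolic X A \<and> Metric_space.mcomplete (topspace X) (kobayashi_dist X A)"

text \<open>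
  A tangent vector at a point \<open>x\<close> is represented by the family of its coordinate vectors in
  the charts around \<open>x\<close>; for a genuine tangent vector these are related by the derivatives of the
  transition maps.  The Kobayashi metric at \<open>(x, v)\<close> is the infimum of all \<open>\<bar>\<xi>\<bar>\<close> for which
  some holomorphic disc \<open>f\<close> with \<open>f 0 = x\<close> has a differential at 0 that maps \<open>\<xi>\<close> to \<open>v\<close>.
\<close>

type_synonym ('a, 'n) tangent = "('a, 'n) chart \<Rightarrow> complex ^ 'n"

definition kobayashi_metric ::
    "'a topology \<Rightarrow> ('a, 'n::finite) chart set \<Rightarrow> 'a \<Rightarrow> ('a, 'n) tangent \<Rightarrow> real" where
  "kobayashi_metric X A x v =
     Inf {cmod \<xi> |\<xi>. \<exists>f. holomorphic_disc X A f \<and> f 0 = x \<and>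
            (\<forall>(U, \<phi>)\<in>A. x \<in> U \<longrightarrow>
               (\<forall>i. \<xi> * deriv (\<lambda>\<zeta>. \<phi> (f \<zeta>) $ i) 0 = v (U, \<phi>) $ i))}"

definition velocity :: "real set \<Rightarrow> (real \<Rightarrow> 'a) \<Rightarrow> real \<Rightarrow> ('a, 'n::finite) tangent" where
  "velocity I \<sigma> t = (\<lambda>(U, \<phi>). vector_derivative (\<phi> \<circ> \<sigma>) (at t within I))"

section \<open>Almost-geodesics and visibility\<close>

definition absolutely_continuous_map_on ::
    "real set \<Rightarrow> (real \<Rightarrow> 'b::real_normed_vector) \<Rightarrow> bool" where
  "absolutely_continuous_map_on S f \<longleftrightarrow>
     (\<forall>\<epsilon>>0. \<exists>\<delta>>0. \<forall>D. finite D \<and> (\<forall>(a, b)\<in>D. a \<le> b \<and> {a..b} \<subseteq> S) \<and>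
        pairwise (\<lambda>(a, b) (c, d). disjnt {a<..<b} {c<..<d}) D \<and>
        (\<Sum>(a, b)\<in>D. b - a) < \<delta> \<longrightarrow>
        (\<Sum>(a, b)\<in>D. norm (f b - f a)) < \<epsilon>)"

text \<open>A curve in a manifold is absolutely continuous if it is so in local coordinates.\<close>

definition absolutely_continuous_curve ::
    "'a topology \<Rightarrow> ('a, 'n::finite) chart set \<Rightarrow> real set \<Rightarrow> (real \<Rightarrow> 'a) \<Rightarrow> bool" where
  "absolutely_continuous_curve X A I \<sigma> \<longleftrightarrow>
     continuous_map (top_of_set I) X \<sigma> \<and>
     (\<forall>(U, \<phi>)\<in>A. \<forall>a b. a \<le> b \<and> {a..b} \<subseteq> I \<and> \<sigma> ` {a..b} \<subseteq> U \<longrightarrow>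
        absolutely_continuous_map_on {a..b} (\<phi> \<circ> \<sigma>))"

definition almost_geodesic ::
    "'a topology \<Rightarrow> ('a, 'n::finite) chart set \<Rightarrow> real \<Rightarrow> real \<Rightarrow> real set \<Rightarrow> (real \<Rightarrow> 'a) \<Rightarrow> bool" where
  "almost_geodesic X A l \<kappa> I \<sigma> \<longleftrightarrow>
     is_interval I \<and> \<sigma> ` I \<subseteq> topspace X \<and>
     (\<forall>s\<in>I. \<forall>t\<in>I. inverse l * \<bar>s - t\<bar> - \<kappa> \<le> kobayashi_dist X A (\<sigma> s) (\<sigma> t) \<and>
                   kobayashi_dist X A (\<sigma> s) (\<sigma> t) \<le> l * \<bar>s - t\<bar> + \<kappa>) \<and>
     absolutely_continuous_curve X A I \<sigma> \<and>
     (AE t in lebesgue. t \<in> I \<longrightarrow> kobayashi_metric X A (\<sigma> t) (velocity I \<sigma> t) \<le> l)"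

definition visibility_property ::
    "'a topology \<Rightarrow> ('a, 'n::finite) chart set \<Rightarrow> 'a set \<Rightarrow> bool" where
  "visibility_property Y A \<Omega> \<longleftrightarrow>
     (\<forall>p \<in> Y closure_of \<Omega> - \<Omega>. \<forall>q \<in> Y closure_of \<Omega> - \<Omega>. p \<noteq> q \<longrightarrow>
        (\<exists>Up Uq. p \<in> Y interior_of Up \<and> q \<in> Y interior_of Uq \<and>
           Y closure_of Up \<inter> Y closure_of Uq = {} \<and>
           (\<forall>l\<ge>1. \<forall>\<kappa>>0. \<exists>K. compactin Y K \<and> K \<subseteq> \<Omega> \<and>
              (\<forall>\<sigma> T. 0 \<le> T \<and>
                 almost_geodesic (subtopology Y \<Omega>) (restrict_atlas \<Omega> A) l \<kappa> {0..T} \<sigma> \<and>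
                 \<sigma> 0 \<in> Up \<and> \<sigma> T \<in> Uq \<longrightarrow> \<sigma> ` {0..T} \<inter> K \<noteq> {}))))"

section \<open>Quasi-isometric embeddings\<close>

definition quasi_isometric_embedding ::
    "'a set \<Rightarrow> ('a \<Rightarrow> 'a \<Rightarrow> real) \<Rightarrow> 'b set \<Rightarrow> ('b \<Rightarrow> 'b \<Rightarrow> real) \<Rightarrow> ('a \<Rightarrow> 'b) \<Rightarrow> bool" where
  "quasi_isometric_embedding M d N d' F \<longleftrightarrow>
     F ` M \<subseteq> N \<and>
     (\<exists>l\<ge>1. \<exists>\<kappa>\<ge>0. \<forall>x\<in>M. \<forall>x'\<in>M.
        inverse l * d x x' - \<kappa> \<le> d' (F x) (F x') \<and> d' (F x) (F x') \<le> l * d x x' + \<kappa>)"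

section \<open>The metric compactification\<close>

text \<open>
  Continuous functions on a space \<open>X\<close> are made to have the value \<open>undefined\<close> off \<open>X\<close>, so that
  functions that agree on \<open>X\<close> are equal.  On locally compact spaces, such as Kobayashi
  hyperbolic manifolds, locally uniform convergence is uniform convergence on compact sets, and
  the topology below is that of uniform convergence on compact sets.
\<close>

definition continuous_functions :: "'a topology \<Rightarrow> ('a \<Rightarrow> real) set" where
  "continuous_functions X =
     {f \<in> extensional (topspace X). continuous_map X euclideanreal f}"

definition locally_uniform_topology :: "'a topology \<Rightarrow> ('a \<Rightarrow> real) topology" where
  "locally_uniform_topology X =
     topology (\<lambda>V. V \<subseteq> continuous_functions X \<and>
       (\<forall>f\<in>V. \<exists>K \<epsilon>. compactin X K \<and> \<epsilon> > 0 \<and>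
          {g \<in> continuous_functions X. \<forall>x\<in>K. \<bar>g x - f x\<bar> < \<epsilon>} \<subseteq> V))"

lemma openin_locally_uniform_topology:
  "openin (locally_uniform_topology X) V \<longleftrightarrow> V \<subseteq> continuous_functions X \<and>
     (\<forall>f\<in>V. \<exists>K \<epsilon>. compactin X K \<and> \<epsilon> > 0 \<and>
        {g \<in> continuous_functions X. \<forall>x\<in>K. \<bar>g x - f x\<bar> < \<epsilon>} \<subseteq> V)"
proof -
  let ?B = "\<lambda>f K \<epsilon>. {g \<in> continuous_functions X. \<forall>x\<in>K. \<bar>g x - f x\<bar> < (\<epsilon>::real)}"
  let ?E = "\<lambda>V f. \<exists>K \<epsilon>. compactin X K \<and> \<epsilon> > 0 \<and> ?B f K \<epsilon> \<subseteq> V"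
  let ?O = "\<lambda>V. V \<subseteq> continuous_functions X \<and> (\<forall>f\<in>V. ?E V f)"
  have "istopology ?O"
    unfolding istopology_def
  proof (intro conjI allI impI ballI)
    fix S T assume S: "?O S" and T: "?O T"
    show "S \<inter> T \<subseteq> continuous_functions X" using S by blast
    fix f assume f: "f \<in> S \<inter> T"
    have "?E S f" using conjunct2[OF S] f by (elim IntE bspec)
    then obtain K \<epsilon> where K: "compactin X K" "\<epsilon> > 0" "?B f K \<epsilon> \<subseteq> S" by (elim exE conjE)
    have "?E T f" using conjunct2[OF T] f by (elim IntE bspec)
    then obtain L \<delta> where L: "compactin X L" "\<delta> > 0" "?B f L \<delta> \<subseteq> T" by (elim exE conjE)
    have "?B f (K \<union> L) (min \<epsilon> \<delta>) \<subseteq> ?B f K \<epsilon> \<inter> ?B f L \<delta>" by auto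
    also have "\<dots> \<subseteq> S \<inter> T" using K(3) L(3) by (rule Int_mono)
    finally show "?E (S \<inter> T) f"
      using K(1,2) L(1,2) compactin_Un[of X K L]
      by (intro exI[of _ "K \<union> L"] exI[of _ "min \<epsilon> \<delta>"] conjI) simp_all
  next
    fix \<K> assume \<K>: "\<forall>S\<in>\<K>. ?O S"
    show "\<Union>\<K> \<subseteq> continuous_functions X" using \<K> by blast
    fix f assume "f \<in> \<Union>\<K>"
    then obtain S where S: "S \<in> \<K>" "f \<in> S" by blast
    have "?E S f" using conjunct2[OF bspec[OF \<K> S(1)]] S(2) by (rule bspec)
    then obtain K \<epsilon> where "compactin X K" "\<epsilon> > 0" "?B f K \<epsilon> \<subseteq> S" by (elim exE conjE)
    moreover have "S \<subseteq> \<Union>\<K>" using S(1) by blast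
    ultimately show "?E (\<Union>\<K>) f"
      by (intro exI[of _ K] exI[of _ \<epsilon>] conjI) (assumption | rule subset_trans)+
  qed
  then show ?thesis by (simp add: locally_uniform_topology_def)
qed

lemma topspace_locally_uniform_topology [simp]:
  "topspace (locally_uniform_topology X) = continuous_functions X"
proof
  have "openin (locally_uniform_topology X) (continuous_functions X)"
    unfolding openin_locally_uniform_topology
  proof (intro conjI ballI subset_refl)
    fix f assume "f \<in> continuous_functions X"
    show "\<exists>K \<epsilon>. compactin X K \<and> \<epsilon> > 0 \<and>
        {g \<in> continuous_functions X. \<forall>x\<in>K. \<bar>g x - f x\<bar> < \<epsilon>} \<subseteq> continuous_functions X"
      by (rule exI[of _ "{}"], rule exI[of _ 1]) auto
  qed
  then show "continuous_functions X \<subseteq> topspace (locally_uniform_topology X)"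
    by (rule openin_subset)
  show "topspace (locally_uniform_topology X) \<subseteq> continuous_functions X"
    by (rule conjunct1[OF iffD1[OF openin_locally_uniform_topology openin_topspace]])
qed

definition const_class :: "'a topology \<Rightarrow> ('a \<Rightarrow> real) \<Rightarrow> ('a \<Rightarrow> real) set" where
  "const_class X f = {g \<in> continuous_functions X. \<exists>c. \<forall>x\<in>topspace X. g x = f x + c}"

definition functions_mod_constants :: "'a topology \<Rightarrow> ('a \<Rightarrow> real) set topology" where
  "functions_mod_constants X =
     topology (\<lambda>V. V \<subseteq> const_class X ` continuous_functions X \<and>
       openin (locally_uniform_topology X) {f \<in> continuous_functions X. const_class X f \<in> V})"

lemma openin_functions_mod_constants:
  "openin (functions_mod_constants X) V \<longleftrightarrow> V \<subseteq> const_class X ` continuous_functions X \<and>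
     openin (locally_uniform_topology X) {f \<in> continuous_functions X. const_class X f \<in> V}"
proof -
  let ?P = "\<lambda>V. {f \<in> continuous_functions X. const_class X f \<in> V}"
  have "istopology (\<lambda>V. V \<subseteq> const_class X ` continuous_functions X \<and>
          openin (locally_uniform_topology X) (?P V))"
    unfolding istopology_def
  proof (intro conjI allI impI)
    fix S T
    assume *: "S \<subseteq> const_class X ` continuous_functions X \<and>
                 openin (locally_uniform_topology X) (?P S)"
              "T \<subseteq> const_class X ` continuous_functions X \<and>
                 openin (locally_uniform_topology X) (?P T)"
    show "S \<inter> T \<subseteq> const_class X ` continuous_functions X" using * by blast
    have "?P (S \<inter> T) = ?P S \<inter> ?P T" by auto
    then show "openin (locally_uniform_topology X) (?P (S \<inter> T))" using * by (simp add: openin_Int)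
  next
    fix \<K>
    assume *: "\<forall>S\<in>\<K>. S \<subseteq> const_class X ` continuous_functions X \<and>
                 openin (locally_uniform_topology X) (?P S)"
    show "\<Union>\<K> \<subseteq> const_class X ` continuous_functions X" using * by blast
    have "?P (\<Union>\<K>) = \<Union>(?P ` \<K>)" by auto
    then show "openin (locally_uniform_topology X) (?P (\<Union>\<K>))" using * by auto
  qed
  then show ?thesis by (simp add: functions_mod_constants_def)
qed

lemma quotient_map_const_class:
  "quotient_map (locally_uniform_topology X) (functions_mod_constants X) (const_class X)"
proof -
  let ?Q = "const_class X ` continuous_functions X"
  have "{f \<in> continuous_functions X. const_class X f \<in> ?Q} = continuous_functions X" by auto
  then have "openin (functions_mod_constants X) ?Q"
    unfolding openin_functions_mod_constants
    by (metis openin_topspace order_refl topspace_locally_uniform_topology)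
  then have "topspace (functions_mod_constants X) = ?Q"
    by (metis openin_functions_mod_constants openin_subset openin_topspace subset_antisym)
  then show ?thesis
    unfolding quotient_map_def by (auto simp: openin_functions_mod_constants)
qed

definition metric_embedding ::
    "'a set \<Rightarrow> ('a \<Rightarrow> 'a \<Rightarrow> real) \<Rightarrow> 'a \<Rightarrow> ('a \<Rightarrow> real) set" where
  "metric_embedding M d x = const_class (Metric_space.mtopology M d) (restrict (d x) M)"

definition metric_compactification ::
    "'a set \<Rightarrow> ('a \<Rightarrow> 'a \<Rightarrow> real) \<Rightarrow> ('a \<Rightarrow> real) set topology" where
  "metric_compactification M d =
     (let C = functions_mod_constants (Metric_space.mtopology M d)
      in subtopology C (C closure_of (metric_embedding M d ` M)))"

section \<open>The end compactification\<close>

definition compact_exhaustion :: "'a topology \<Rightarrow> (nat \<Rightarrow> 'a set) \<Rightarrow> bool" where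
  "compact_exhaustion Z K \<longleftrightarrow>
     (\<forall>j. compactin Z (K j) \<and> K j \<subseteq> Z interior_of K (Suc j)) \<and> (\<Union>j. K j) = topspace Z"

definition ends :: "'a topology \<Rightarrow> 'a set \<Rightarrow> (nat \<Rightarrow> 'a set) \<Rightarrow> (nat \<Rightarrow> 'a set) set" where
  "ends Y \<Omega> K =
     {F. \<forall>j. F j \<in> connected_components_of (subtopology Y (Y closure_of \<Omega> - K j)) \<and>
             F (Suc j) \<subseteq> F j}"

definition end_compactification_points ::
    "'a topology \<Rightarrow> 'a set \<Rightarrow> (nat \<Rightarrow> 'a set) \<Rightarrow> ('a + (nat \<Rightarrow> 'a set)) set" where
  "end_compactification_points Y \<Omega> K = (Y closure_of \<Omega>) <+> ends Y \<Omega> K"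

definition end_neighbourhood ::
    "'a topology \<Rightarrow> 'a set \<Rightarrow> (nat \<Rightarrow> 'a set) \<Rightarrow> (nat \<Rightarrow> 'a set) \<Rightarrow> nat \<Rightarrow>
       ('a + (nat \<Rightarrow> 'a set)) set" where
  "end_neighbourhood Y \<Omega> K F j = F j <+> {G \<in> ends Y \<Omega> K. \<forall>\<nu>\<le>j. G \<nu> = F \<nu>}"

text \<open>
  A set is open if it contains a basic neighbourhood of each of its points.  The component \<open>F j\<close>
  itself need not be open, because the closure of \<open>\<Omega>\<close> need not be locally connected.
\<close>

definition end_compactification ::
    "'a topology \<Rightarrow> 'a set \<Rightarrow> (nat \<Rightarrow> 'a set) \<Rightarrow> ('a + (nat \<Rightarrow> 'a set)) topology" where
  "end_compactification Y \<Omega> K =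
     topology (\<lambda>V. V \<subseteq> end_compactification_points Y \<Omega> K \<and>
       (\<forall>x. Inl x \<in> V \<longrightarrow>
          (\<exists>U. openin Y U \<and> x \<in> U \<and> Inl ` (U \<inter> Y closure_of \<Omega>) \<subseteq> V)) \<and>
       (\<forall>F. Inr F \<in> V \<longrightarrow> (\<exists>j. end_neighbourhood Y \<Omega> K F j \<subseteq> V)))"

lemma end_neighbourhood_antimono:
  assumes "F \<in> ends Y \<Omega> K" "i \<le> j"
  shows "end_neighbourhood Y \<Omega> K F j \<subseteq> end_neighbourhood Y \<Omega> K F i"
proof -
  have "F j \<subseteq> F i"
    by (rule lift_Suc_antimono_le[OF _ assms(2)]) (use assms(1) in \<open>simp add: ends_def\<close>)
  then show ?thesis using assms(2) unfolding end_neighbourhood_def by auto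
qed

lemma openin_end_compactification:
  "openin (end_compactification Y \<Omega> K) V \<longleftrightarrow> V \<subseteq> end_compactification_points Y \<Omega> K \<and>
     (\<forall>x. Inl x \<in> V \<longrightarrow> (\<exists>U. openin Y U \<and> x \<in> U \<and> Inl ` (U \<inter> Y closure_of \<Omega>) \<subseteq> V)) \<and>
     (\<forall>F. Inr F \<in> V \<longrightarrow> (\<exists>j. end_neighbourhood Y \<Omega> K F j \<subseteq> V))"
proof -
  let ?L = "\<lambda>V x. \<exists>U. openin Y U \<and> x \<in> U \<and> Inl ` (U \<inter> Y closure_of \<Omega>) \<subseteq> V"
  let ?R = "\<lambda>V F. \<exists>j. end_neighbourhood Y \<Omega> K F j \<subseteq> V"
  let ?O = "\<lambda>V. V \<subseteq> end_compactification_points Y \<Omega> K \<and>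
     (\<forall>x. Inl x \<in> V \<longrightarrow> ?L V x) \<and> (\<forall>F. Inr F \<in> V \<longrightarrow> ?R V F)"
  have "istopology ?O"
    unfolding istopology_def
  proof (rule conjI; intro allI impI)
    fix S T assume S: "?O S" and T: "?O T"
    have "?L (S \<inter> T) x" if "Inl x \<in> S \<inter> T" for x
    proof -
      have "?L S x" "?L T x" using S T that by blast+
      then obtain U V where "openin Y U" "x \<in> U" "Inl ` (U \<inter> Y closure_of \<Omega>) \<subseteq> S"
        "openin Y V" "x \<in> V" "Inl ` (V \<inter> Y closure_of \<Omega>) \<subseteq> T"
        by blast
      then show ?thesis by (intro exI[of _ "U \<inter> V"]) auto
    qed
    moreover have "?R (S \<inter> T) F" if "Inr F \<in> S \<inter> T" for F
    proof -
      have "?R S F" "?R T F" using S T that by blast+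
      then obtain i j where "end_neighbourhood Y \<Omega> K F i \<subseteq> S" "end_neighbourhood Y \<Omega> K F j \<subseteq> T"
        by blast
      moreover have "F \<in> ends Y \<Omega> K"
        using S that unfolding end_compactification_points_def by auto
      then have "end_neighbourhood Y \<Omega> K F (max i j)
          \<subseteq> end_neighbourhood Y \<Omega> K F i \<inter> end_neighbourhood Y \<Omega> K F j"
        by (simp add: end_neighbourhood_antimono)
      ultimately show ?thesis by blast
    qed
    moreover have "S \<inter> T \<subseteq> end_compactification_points Y \<Omega> K"
      using conjunct1[OF S] by (rule le_infI1)
    ultimately show "?O (S \<inter> T)" by (intro conjI allI impI)
  next
    fix \<K> assume \<K>: "\<forall>S\<in>\<K>. ?O S"
    have "?L (\<Union>\<K>) x" if in_Un: "Inl x \<in> \<Union>\<K>" for x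
    proof -
      obtain S where "S \<in> \<K>" "Inl x \<in> S" using in_Un by blast
      moreover from this have "?L S x" using \<K> by blast
      ultimately show ?thesis by blast
    qed
    moreover have "?R (\<Union>\<K>) F" if in_Un: "Inr F \<in> \<Union>\<K>" for F
    proof -
      obtain S where "S \<in> \<K>" "Inr F \<in> S" using in_Un by blast
      moreover from this have "?R S F" using \<K> by blast
      ultimately show ?thesis by blast
    qed
    moreover have "\<Union>\<K> \<subseteq> end_compactification_points Y \<Omega> K"
      using conjunct1[OF bspec[OF \<K>]] by (rule Union_least)
    ultimately show "?O (\<Union>\<K>)" by (intro conjI allI impI)
  qed
  then show ?thesis by (simp add: end_compactification_def)
qed

lemma topspace_end_compactification [simp]:
  "topspace (end_compactification Y \<Omega> K) = end_compactification_points Y \<Omega> K"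
proof
  have "F j \<subseteq> Y closure_of \<Omega>" if "F \<in> ends Y \<Omega> K" for F j
  proof -
    have "F j \<in> connected_components_of (subtopology Y (Y closure_of \<Omega> - K j))"
      using that by (simp add: ends_def)
    from connected_components_of_subset[OF this] show ?thesis by auto
  qed
  then have "end_neighbourhood Y \<Omega> K F 0 \<subseteq> end_compactification_points Y \<Omega> K"
    if "F \<in> ends Y \<Omega> K" for F
    using that unfolding end_neighbourhood_def end_compactification_points_def by blast
  moreover have "\<exists>U. openin Y U \<and> x \<in> U \<and>
      Inl ` (U \<inter> Y closure_of \<Omega>) \<subseteq> end_compactification_points Y \<Omega> K"
    if "x \<in> Y closure_of \<Omega>" for x
  proof (intro exI conjI)
    show "openin Y (topspace Y)" by simp
    show "x \<in> topspace Y" using that closure_of_subset_topspace by (rule subsetD[rotated])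
    show "Inl ` (topspace Y \<inter> Y closure_of \<Omega>) \<subseteq> end_compactification_points Y \<Omega> K"
      unfolding end_compactification_points_def by blast
  qed
  ultimately have "openin (end_compactification Y \<Omega> K) (end_compactification_points Y \<Omega> K)"
    unfolding openin_end_compactification by (auto simp: end_compactification_points_def)
  then show "end_compactification_points Y \<Omega> K \<subseteq> topspace (end_compactification Y \<Omega> K)"
    by (rule openin_subset)
  show "topspace (end_compactification Y \<Omega> K) \<subseteq> end_compactification_points Y \<Omega> K"
    by (rule conjunct1[OF iffD1[OF openin_end_compactification openin_topspace]])
qed

definition sequentially_compact_space :: "'a topology \<Rightarrow> bool" where
  "sequentially_compact_space X \<longleftrightarrow>
     (\<forall>s :: nat \<Rightarrow> 'a. range s \<subseteq> topspace X \<longrightarrow>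
        (\<exists>l r. strict_mono r \<and> limitin X (s \<circ> r) l sequentially))"

end

theory Submission
  imports Defs "HOL-Complex_Analysis.Riemann_Mapping"
begin

text \<open>Let \<open>d\<close> be the Kobayashi distance of \<open>X\<close>, let \<open>p\<close> be a base point, and let \<open>Z\<close> be the end compactification
of \<open>\<Omega>\<close>.  A point of the metric compactification of \<open>X\<close> is represented by a function \<open>f\<close> such that
\<open>d (x n) - d (x n) p\<close> converges to \<open>f - f p\<close> for some sequence \<open>x\<close> in \<open>X\<close>, uniformly on bounded sets.
The map \<open>F\<close> extends if, for all these sequences, \<open>F (x n)\<close> converges in \<open>Z\<close> to one and the same point.
The argument rests on the Gromov product \<open>d p x + d p y - d x y\<close> and has two steps.

Visibility (lemma \<open>same_limit\<close>): if the Gromov product of \<open>x n\<close> and \<open>y n\<close> tends to infinity, then \<open>F (x n)\<close>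
and \<open>F (y n)\<close> cannot have different limits in \<open>Z\<close>.  Take an almost shortest path from \<open>x n\<close> to \<open>y n\<close>.
Its image under the quasi-isometric embedding \<open>F\<close> stays within a bounded distance of an almost-geodesic of
\<open>\<Omega>\<close>.  If the limits were different, visibility would make these almost-geodesics meet a fixed compact set
infinitely often.  Then infinitely many of the paths in \<open>X\<close> would pass within a bounded distance of \<open>p\<close>,
which bounds the Gromov product.  Visibility is assumed for pairs of boundary points only; a path that
leads from near an end to elsewhere must cross two disjoint compact sets, and this reduces ends to such pairs
(lemma \<open>visibility_at_end\<close>).

Horofunctions (lemma \<open>horo_limit_image_unique\<close>): two unbounded sequences that represent the same \<open>f\<close> are
compared through a third one.  Almost shortest paths from \<open>p\<close> to \<open>x n\<close> contain points \<open>w k\<close> at distance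
about \<open>k\<close> from \<open>p\<close> with \<open>f (w k) - f p\<close> about \<open>- k\<close>.  For every sequence \<open>y\<close> that represents \<open>f\<close>, the Gromov product
of \<open>y n\<close> and \<open>w k\<close> tends, as \<open>n\<close> grows, to \<open>d p (w k) - (f (w k) - f p)\<close>, which is about \<open>2 * k\<close>.  So \<open>F (y n)\<close> has
the same limits as \<open>F (w k)\<close>, whatever \<open>y\<close> is.

Both steps need paths.  A chain of holomorphic discs whose total length is close to the Kobayashi
distance yields one directly, made of hyperbolic geodesics of the discs; it is Lipschitz in charts and the discs
themselves show that its Kobayashi speed is at most 1, so that the Kobayashi distance never has to be
compared with the integrated Kobayashi metric.  These paths also give Barth's theorem
(lemma \<open>kobayashi_topology\<close>), and with the theorem of Hopf and Rinow they make \<open>X\<close> a proper length space.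

The components \<open>H j\<close> that define an end \<open>H\<close> need not be open, so the sets \<open>end_neighbourhood\<close> need not
be neighbourhoods of \<open>H\<close>.  For sequences of points of the closure of \<open>\<Omega>\<close> they behave as if they were
(lemmas \<open>limit_Inr\<close> and \<open>Z_separated\<close>), and this suffices for the continuity of the extension.\<close>

section \<open>Holomorphic discs\<close>

text \<open>In the normalization of the Poincare distance used here, \<open>tanh\<close> parametrizes the real diameter of the
disc by arc length.\<close>

lemma poincare_dist_tanh:
  fixes s t :: real
  shows "poincare_dist (of_real (tanh s)) (of_real (tanh t)) = \<bar>s - t\<bar>"
proof -
  have ne: "cosh s \<noteq> 0" "cosh t \<noteq> 0" "cosh s \<noteq> 0 \<and> cosh (- t) \<noteq> 0" by simp_all
  have "tanh (s - t) = (tanh s - tanh t) / (1 - tanh t * tanh s)"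
    using tanh_add[of s "- t"] by (simp add: mult.commute)
  then have "cmod ((of_real (tanh s) - of_real (tanh t)) /
      (1 - cnj (of_real (tanh t)) * of_real (tanh s))) = \<bar>tanh (s - t)\<bar>"
    by (metis complex_cnj_complex_of_real norm_of_real of_real_1 of_real_diff of_real_divide of_real_mult)
  moreover have "\<bar>tanh (s - t)\<bar> = tanh \<bar>s - t\<bar>"
    by (cases "s \<le> t") (auto simp: abs_if simp flip: tanh_minus)
  moreover have "1 / 2 * ln ((1 + tanh \<bar>s - t\<bar>) / (1 - tanh \<bar>s - t\<bar>)) = \<bar>s - t\<bar>"
    using artanh_tanh_real[of "\<bar>s - t\<bar>"] by (simp add: artanh_def)
  ultimately show ?thesis unfolding poincare_dist_def Let_def by presburger
qed

lemma Moebius_ball: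
  assumes "cmod w < 1" "cmod z < 1"
  shows "cmod ((z - w) / (1 - cnj w * z)) < 1"
  using Moebius_function_norm_lt_1[OF assms, of 0] by (simp add: Moebius_function_simple)

lemma tanh_half_ln:
  fixes r :: real
  assumes "0 \<le> r" "r < 1"
  shows "tanh (1 / 2 * ln ((1 + r) / (1 - r))) = r" "0 \<le> 1 / 2 * ln ((1 + r) / (1 - r))"
proof -
  let ?q = "(1 + r) / (1 - r)"
  have q: "?q \<ge> 1" using assms by (simp add: field_simps)
  have "1 / 2 * ln ?q = ln (sqrt ?q)" using q by (simp add: ln_sqrt)
  then have "tanh (1 / 2 * ln ?q) = ((sqrt ?q)\<^sup>2 - 1) / ((sqrt ?q)\<^sup>2 + 1)"
    using q by (subst tanh_ln_real[symmetric]) auto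
  also have "\<dots> = (?q - 1) / (?q + 1)" using q by simp
  also have "\<dots> = r" using assms by (simp add: field_simps)
  finally show "tanh (1 / 2 * ln ?q) = r" .
  show "0 \<le> 1 / 2 * ln ?q" using q by (simp add: ln_ge_zero)
qed

lemma poincare_dist_nonneg:
  assumes "cmod z < 1" "cmod w < 1"
  shows "0 \<le> poincare_dist z w"
  unfolding poincare_dist_def Let_def
  by (rule tanh_half_ln(2)) (use Moebius_ball[OF assms(2,1)] in auto)

text \<open>The automorphism that takes \<open>z\<close> to \<open>0\<close>, followed by a rotation, takes \<open>w\<close> to the nonnegative real
axis; the map \<open>g\<close> is its inverse.\<close>

lemma disc_normalize:
  assumes z: "cmod z < 1" and w: "cmod w < 1"
  obtains g where "g holomorphic_on ball 0 1" "g ` ball 0 1 \<subseteq> ball 0 1"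
    "g 0 = z" "g (of_real (tanh (poincare_dist z w))) = w"
proof -
  define b where "b = Moebius_function 0 z w"
  define u where "u = (if b = 0 then 1 else b / of_real (cmod b))"
  define g where "g = (\<lambda>\<zeta>. Moebius_function 0 (- z) (u * \<zeta>))"
  have u: "cmod u = 1" by (simp add: u_def norm_divide)
  have b: "cmod b < 1" unfolding b_def by (rule Moebius_function_norm_lt_1[OF z w])
  have ub: "u * \<zeta> \<in> ball 0 1" if "\<zeta> \<in> ball 0 1" for \<zeta> using that u by (simp add: norm_mult)
  have "g holomorphic_on ball 0 1"
    unfolding g_def
    by (rule holomorphic_on_compose_gen[OF _ Moebius_function_holomorphic, unfolded o_def])
      (use ub z in \<open>auto intro!: holomorphic_intros\<close>)
  moreover have "g ` ball 0 1 \<subseteq> ball 0 1"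
    using Moebius_function_norm_lt_1[of "- z"] ub z by (auto simp: g_def)
  moreover have "g 0 = z" by (simp add: g_def Moebius_function_of_zero)
  moreover have "cmod b = cmod ((z - w) / (1 - cnj w * z))"
  proof -
    have "cmod (1 - cnj z * w) = cmod (cnj (1 - cnj z * w))" by (simp only: complex_mod_cnj)
    also have "\<dots> = cmod (1 - cnj w * z)" by (simp add: mult.commute)
    finally show ?thesis
      by (simp add: b_def Moebius_function_simple norm_divide norm_minus_commute)
  qed
  then have "tanh (poincare_dist z w) = cmod b"
    unfolding poincare_dist_def Let_def using tanh_half_ln(1)[of "cmod b"] b by simp
  then have "u * of_real (tanh (poincare_dist z w)) = b" by (simp add: u_def)
  then have "g (of_real (tanh (poincare_dist z w))) = w"
    unfolding g_def using Moebius_function_compose[of "- z" z w] z w by (simp add: b_def)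
  ultimately show thesis using that by blast
qed

lemma tanh_in_disc [simp]: "of_real (tanh (t::real)) \<in> (ball 0 1 :: complex set)"
  using tanh_real_lt_1[of t] tanh_real_gt_neg1[of t] by (simp add: abs_less_iff)

lemma holomorphic_disc_compose:
  assumes f: "holomorphic_disc X A f"
    and g: "g holomorphic_on ball 0 1" "g ` ball 0 1 \<subseteq> ball 0 1"
  shows "holomorphic_disc X A (f \<circ> g)"
  unfolding holomorphic_disc_def
proof (intro conjI)
  have "continuous_on (ball 0 1) g" by (rule holomorphic_on_imp_continuous_on[OF g(1)])
  then show "continuous_map (top_of_set (ball 0 1)) X (f \<circ> g)"
    using f g(2) unfolding holomorphic_disc_def
    by (intro continuous_map_compose[of _ "top_of_set (ball 0 1)"])
      (auto simp: continuous_map_in_subtopology)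
  show "\<forall>(U, \<phi>)\<in>A. \<forall>i. (\<lambda>\<zeta>. \<phi> ((f \<circ> g) \<zeta>) $ i) holomorphic_on {\<zeta> \<in> ball 0 1. (f \<circ> g) \<zeta> \<in> U}"
  proof clarify
    fix U \<phi> i assume "(U, \<phi>) \<in> A"
    then have 1: "(\<lambda>\<zeta>. \<phi> (f \<zeta>) $ i) holomorphic_on {\<zeta> \<in> ball 0 1. f \<zeta> \<in> U}"
      using f unfolding holomorphic_disc_def by blast
    have 2: "g holomorphic_on {\<zeta> \<in> ball 0 1. (f \<circ> g) \<zeta> \<in> U}"
      using g(1) by (rule holomorphic_on_subset) auto
    have 3: "g ` {\<zeta> \<in> ball 0 1. (f \<circ> g) \<zeta> \<in> U} \<subseteq> {\<zeta> \<in> ball 0 1. f \<zeta> \<in> U}"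
      using g(2) by (auto simp: image_subset_iff)
    have "((\<lambda>\<zeta>. \<phi> (f \<zeta>) $ i) \<circ> g) holomorphic_on {\<zeta> \<in> ball 0 1. (f \<circ> g) \<zeta> \<in> U}"
      by (rule holomorphic_on_compose_gen[OF 2 1 3])
    then show "(\<lambda>\<zeta>. \<phi> ((f \<circ> g) \<zeta>) $ i) holomorphic_on {\<zeta> \<in> ball 0 1. (f \<circ> g) \<zeta> \<in> U}"
      by (simp add: o_def)
  qed
qed

lemma norm_vector_scalar_mult:
  fixes v :: "complex ^ 'n::finite"
  shows "norm (c *s v) = cmod c * norm v"
  by (simp add: norm_vec_def L2_set_def norm_mult power_mult_distrib real_sqrt_mult
      flip: sum_distrib_left)

lemma bounded_linear_scalar_mult_left:
  fixes v :: "complex ^ 'n::finite"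
  shows "bounded_linear (\<lambda>c. c *s v)"
  by (rule bounded_linear_intro[of _ "norm v"])
    (auto simp: vec_eq_iff norm_vector_scalar_mult ring_distribs)

lemma complex_atlasD:
  assumes "complex_atlas X A" "(U, \<phi>) \<in> A"
  shows "openin X U" "open (\<phi> ` U)" "homeomorphic_map (subtopology X U) (top_of_set (\<phi> ` U)) \<phi>"
    "inj_on \<phi> U" "continuous_map (top_of_set (\<phi> ` U)) (subtopology X U) (inv_into U \<phi>)"
proof -
  show U: "openin X U" and "open (\<phi> ` U)"
    and hom: "homeomorphic_map (subtopology X U) (top_of_set (\<phi> ` U)) \<phi>"
    using assms unfolding complex_atlas_def by auto
  have top: "topspace (subtopology X U) = U" using openin_subset[OF U] by auto
  show inj: "inj_on \<phi> U"
    using homeomorphic_imp_injective_map[OF hom] unfolding top .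
  obtain \<psi> where "homeomorphic_maps (subtopology X U) (top_of_set (\<phi> ` U)) \<phi> \<psi>"
    using hom homeomorphic_map_maps by blast
  then have \<psi>: "continuous_map (top_of_set (\<phi> ` U)) (subtopology X U) \<psi>"
      "\<And>x. x \<in> U \<Longrightarrow> \<psi> (\<phi> x) = x"
    unfolding homeomorphic_maps_def top by auto
  show "continuous_map (top_of_set (\<phi> ` U)) (subtopology X U) (inv_into U \<phi>)"
    by (rule continuous_map_eq[OF \<psi>(1)]) (use \<psi>(2) inj in auto)
qed

lemma chart_preimage_open:
  assumes A: "complex_atlas X A" "(U, \<phi>) \<in> A" and "open W"
  shows "openin X {y \<in> U. \<phi> y \<in> W}"
proof -
  note UD = complex_atlasD[OF A]
  have "continuous_map (subtopology X U) euclidean \<phi>"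
    using homeomorphic_imp_continuous_map[OF UD(3)] by (simp add: continuous_map_in_subtopology)
  then have "openin (subtopology X U) {y \<in> topspace (subtopology X U). \<phi> y \<in> W}"
    by (rule openin_continuous_map_preimage) (simp add: \<open>open W\<close>)
  moreover have top: "topspace (subtopology X U) = U" using openin_subset[OF UD(1)] by auto
  ultimately have "openin (subtopology X U) {y \<in> U. \<phi> y \<in> W}" unfolding top by argo
  then show ?thesis using openin_open_subtopology[OF UD(1)] by blast
qed

text \<open>Affine discs in a chart.  They bound the Kobayashi distance from above, and this is where the
compatibility of the charts enters: the disc has to be holomorphic in every chart.\<close>

lemma chart_disc:
  fixes A :: "('a, 'n::finite) chart set"
  assumes A: "complex_atlas X A" and U: "(U, \<phi>) \<in> A"
    and sub: "ball x r \<subseteq> \<phi> ` U" and u: "norm u \<le> r" and "r > 0"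
  shows "holomorphic_disc X A (\<lambda>\<zeta>. inv_into U \<phi> (x + \<zeta> *s u))" (is "holomorphic_disc X A ?f")
  unfolding holomorphic_disc_def
proof (intro conjI)
  note UD = complex_atlasD[OF A U]
  interpret bl: bounded_linear "\<lambda>c. c *s u" by (rule bounded_linear_scalar_mult_left)
  have in_ball: "x + \<zeta> *s u \<in> ball x r" if "\<zeta> \<in> ball 0 1" for \<zeta>
  proof -
    have "cmod \<zeta> * norm u \<le> cmod \<zeta> * r" using u by (rule mult_left_mono) simp
    also have "\<dots> < 1 * r" using that \<open>r > 0\<close> by (intro mult_strict_right_mono) auto
    finally have "cmod \<zeta> * norm u < r" by simp
    then show ?thesis by (simp add: norm_vector_scalar_mult dist_norm)
  qed
  have c: "continuous_map (top_of_set (ball 0 1)) (top_of_set (\<phi> ` U)) (\<lambda>\<zeta>. x + \<zeta> *s u)"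
    using in_ball sub by (auto intro!: continuous_intros bl.continuous_on)
  have c2: "continuous_map (top_of_set (ball 0 1)) (subtopology X U) ?f"
    using continuous_map_compose[OF c UD(5)] by (simp add: o_def)
  then show cf: "continuous_map (top_of_set (ball 0 1)) X ?f"
    by (simp add: continuous_map_in_subtopology)
  have "(\<lambda>\<zeta>. \<psi> (?f \<zeta>) $ i) holomorphic_on {\<zeta> \<in> ball 0 1. ?f \<zeta> \<in> V}"
    if V: "(V, \<psi>) \<in> A" for V \<psi> i
  proof -
    let ?S = "{\<zeta> \<in> ball 0 1. ?f \<zeta> \<in> V}"
    let ?T = "\<psi> \<circ> inv_into U \<phi>"
    have hol: "holomorphic_map_on ?T (\<phi> ` (U \<inter> V))"
      using A U V unfolding complex_atlas_def by fastforce
    have "(\<lambda>\<zeta>. \<psi> (?f \<zeta>) $ i) field_differentiable (at \<zeta>)" if \<zeta>: "\<zeta> \<in> ?S" for \<zeta>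
    proof -
      have m: "x + \<zeta> *s u \<in> \<phi> ` U" using in_ball[of \<zeta>] \<zeta> sub by blast
      have "x + \<zeta> *s u = \<phi> (?f \<zeta>)" by (rule f_inv_into_f[OF m, symmetric])
      moreover have "?f \<zeta> \<in> U" by (rule inv_into_into[OF m])
      moreover have "?f \<zeta> \<in> V" using \<zeta> by simp
      ultimately have "x + \<zeta> *s u \<in> \<phi> ` (U \<inter> V)" by (metis IntI imageI)
      then obtain D where D: "(?T has_derivative D) (at (x + \<zeta> *s u))" "\<And>c v. D (c *s v) = c *s D v"
        using hol unfolding holomorphic_map_on_def by metis
      have "((\<lambda>\<zeta>. x + \<zeta> *s u) has_derivative (\<lambda>c. c *s u)) (at \<zeta>)"
        by (auto intro!: derivative_eq_intros bl.has_derivative)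
      from diff_chain_at[OF this D(1)]
      have "(?T \<circ> (\<lambda>\<zeta>. x + \<zeta> *s u) has_derivative (\<lambda>c. c *s D u)) (at \<zeta>)"
        by (simp add: o_def D(2))
      from bounded_linear.has_derivative[OF bounded_linear_vec_nth this, of i]
      have "((\<lambda>\<zeta>. \<psi> (?f \<zeta>) $ i) has_derivative (\<lambda>c. D u $ i * c)) (at \<zeta>)"
        by (simp add: o_def mult.commute)
      then have "((\<lambda>\<zeta>. \<psi> (?f \<zeta>) $ i) has_field_derivative (D u $ i)) (at \<zeta>)"
        unfolding has_field_derivative_def .
      then show ?thesis using field_differentiable_def by blast
    qed
    then show "(\<lambda>\<zeta>. \<psi> (?f \<zeta>) $ i) holomorphic_on ?S"
      unfolding holomorphic_on_def by (meson field_differentiable_at_within)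
  qed
  then show "\<forall>(V, \<psi>)\<in>A. \<forall>i. (\<lambda>\<zeta>. \<psi> (?f \<zeta>) $ i) holomorphic_on {\<zeta> \<in> ball 0 1. ?f \<zeta> \<in> V}"
    by blast
qed

section \<open>Chains of discs\<close>

lemma kobayashi_neighbourhood:
  fixes A :: "('a, 'n::finite) chart set"
  assumes A: "complex_atlas X A" and x: "x \<in> topspace X" and "\<epsilon> > 0"
  obtains V where "openin X V" "x \<in> V"
    "\<And>y. y \<in> V \<Longrightarrow> \<exists>f \<omega>. holomorphic_disc X A f \<and> f 0 = x \<and> \<omega> \<in> ball 0 1 \<and> f \<omega> = y \<and>
      poincare_dist 0 \<omega> < \<epsilon>"
proof -
  obtain U \<phi> where U: "(U, \<phi>) \<in> A" "x \<in> U"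
    using A x unfolding complex_atlas_def by blast
  note UD = complex_atlasD[OF A U(1)]
  obtain r where r: "r > 0" "ball (\<phi> x) r \<subseteq> \<phi> ` U"
    using UD(2) U(2) open_contains_ball by blast
  (* An affine disc of radius r in the chart takes the value at distance r * tanh t from the centre
     at the parameter tanh t, whose Poincare distance from 0 is t. *)
  define \<rho> where "\<rho> = r * tanh \<epsilon>"
  have \<rho>: "\<rho> > 0" using r(1) \<open>\<epsilon> > 0\<close> by (simp add: \<rho>_def)
  define V where "V = {y \<in> U. \<phi> y \<in> ball (\<phi> x) \<rho>}"
  have "openin X V" unfolding V_def by (rule chart_preimage_open[OF A U(1) open_ball])
  moreover have "x \<in> V" using U(2) \<rho> by (simp add: V_def)
  moreover have "\<exists>f \<omega>. holomorphic_disc X A f \<and> f 0 = x \<and> \<omega> \<in> ball 0 1 \<and> f \<omega> = y \<and>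
      poincare_dist 0 \<omega> < \<epsilon>" if y: "y \<in> V" for y
  proof -
    define a where "a = norm (\<phi> y - \<phi> x) / r"
    have "a < tanh \<epsilon>" "0 \<le> a"
      using y r(1) by (auto simp: V_def a_def \<rho>_def field_simps dist_norm norm_minus_commute)
    moreover have "a < 1" using calculation tanh_real_lt_1[of \<epsilon>] by linarith
    ultimately obtain t where t: "a = tanh t" "t \<ge> 0" using tanh_half_ln[of a] by metis
    have t\<epsilon>: "t < \<epsilon>" using \<open>a < tanh \<epsilon>\<close> unfolding t(1) by simp
    define u where "u = (if a = 0 then 0 else inverse (of_real a) *s (\<phi> y - \<phi> x))"
    have "norm u = (if a = 0 then 0 else inverse a * norm (\<phi> y - \<phi> x))"
      using \<open>0 \<le> a\<close> unfolding u_def by (simp only: norm_vector_scalar_mult norm_inverse norm_of_real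
          abs_of_nonneg if_distrib[of norm] norm_zero)
    then have u: "norm u \<le> r" using r(1) by (auto simp: a_def)
    define f where "f = (\<lambda>\<zeta>. inv_into U \<phi> (\<phi> x + \<zeta> *s u))"
    have f0: "f 0 = x" using UD(4) U(2) by (simp add: f_def)
    have "of_real a *s u = \<phi> y - \<phi> x"
      using r(1) by (auto simp: u_def a_def)
    then have fa: "f (of_real a) = y"
      using UD(4) y by (simp add: f_def V_def)
    have "poincare_dist 0 (of_real a) = t"
      using poincare_dist_tanh[of 0 t] t by simp
    then show ?thesis
      using chart_disc[OF A U(1) r(2) u r(1)] f0 fa t\<epsilon> tanh_in_disc[of t] unfolding f_def[symmetric] t(1)
      by (intro exI[of _ f] exI[of _ "of_real (tanh t)"]) simp
  qed
  ultimately show thesis using that by blast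
qed

lemma disc_chain_snoc:
  assumes L: "L \<in> disc_chain_lengths X A x y" and f: "holomorphic_disc X A f"
    and zw: "z \<in> ball 0 1" "w \<in> ball 0 1" "f z = y"
  shows "L + poincare_dist z w \<in> disc_chain_lengths X A x (f w)"
proof -
  obtain m \<zeta> \<omega> p g where *: "L = (\<Sum>j<m. poincare_dist (\<zeta> j) (\<omega> j))" "p 0 = x" "p m = y"
    "\<And>j. j < m \<Longrightarrow> holomorphic_disc X A (g j) \<and> \<zeta> j \<in> ball 0 1 \<and> \<omega> j \<in> ball 0 1 \<and>
             g j (\<zeta> j) = p j \<and> g j (\<omega> j) = p (Suc j)"
    using L unfolding disc_chain_lengths_def by blast
  define \<zeta>' \<omega>' g' p'
    where defs: "\<zeta>' = fun_upd \<zeta> m z" "\<omega>' = fun_upd \<omega> m w" "g' = fun_upd g m f"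
      "p' = fun_upd p (Suc m) (f w)"
  have "L + poincare_dist z w = (\<Sum>j<Suc m. poincare_dist (\<zeta>' j) (\<omega>' j))"
    by (simp add: *(1) defs)
  moreover have "p' 0 = x \<and> p' (Suc m) = f w \<and>
      (\<forall>j<Suc m. holomorphic_disc X A (g' j) \<and> \<zeta>' j \<in> ball 0 1 \<and> \<omega>' j \<in> ball 0 1 \<and>
         g' j (\<zeta>' j) = p' j \<and> g' j (\<omega>' j) = p' (Suc j))"
    using * f zw by (auto simp: defs less_Suc_eq)
  ultimately show ?thesis unfolding disc_chain_lengths_def by blast
qed

lemma disc_chain_Nil: "0 \<in> disc_chain_lengths X A x x"
  unfolding disc_chain_lengths_def by (intro CollectI exI[of _ 0] exI[of _ "\<lambda>_. x"]) auto

lemma disc_chain_lengths_nonneg: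
  "L \<in> disc_chain_lengths X A x y \<Longrightarrow> 0 \<le> L"
  unfolding disc_chain_lengths_def by (auto intro!: sum_nonneg poincare_dist_nonneg)

lemma kobayashi_dist_le_chain:
  assumes "L \<in> disc_chain_lengths X A x y"
  shows "kobayashi_dist X A x y \<le> L"
  using assms disc_chain_lengths_nonneg[of _ X A x y] disc_chain_lengths_nonneg[OF assms]
  unfolding kobayashi_dist_def by (auto intro!: cInf_lower bdd_belowI[of _ 0])

lemma kobayashi_dist_le_disc:
  assumes "holomorphic_disc X A f" "z \<in> ball 0 1" "w \<in> ball 0 1"
  shows "kobayashi_dist X A (f z) (f w) \<le> poincare_dist z w"
  using kobayashi_dist_le_chain[OF disc_chain_snoc[OF disc_chain_Nil assms refl]] by simp

text \<open>Points near a given one are joined to it by a disc, so the points that can be reached by a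
  chain of discs, and those that cannot, both form open sets.\<close>

lemma disc_chain_exists:
  assumes A: "complex_atlas X A" and "connected_space X"
    and x: "x \<in> topspace X" and y: "y \<in> topspace X"
  shows "disc_chain_lengths X A x y \<noteq> {}"
proof -
  define S where "S = {y \<in> topspace X. disc_chain_lengths X A x y \<noteq> {}}"
  have nbhd: "\<exists>V. openin X V \<and> y \<in> V \<and> (\<forall>q\<in>V. q \<in> topspace X \<and> (y \<in> S \<longleftrightarrow> q \<in> S))"
    if y: "y \<in> topspace X" for y
  proof -
    obtain V where V: "openin X V" "y \<in> V"
      "\<And>q. q \<in> V \<Longrightarrow> \<exists>f \<omega>. holomorphic_disc X A f \<and> f 0 = y \<and> \<omega> \<in> ball 0 1 \<and> f \<omega> = q \<and>
        poincare_dist 0 \<omega> < 1"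
      using kobayashi_neighbourhood[OF A y, of 1] by (metis zero_less_one)
    have "q \<in> topspace X \<and> (y \<in> S \<longleftrightarrow> q \<in> S)" if q: "q \<in> V" for q
    proof -
      obtain f \<omega> where f: "holomorphic_disc X A f" "f 0 = y" "\<omega> \<in> ball 0 1" "f \<omega> = q"
        using V(3)[OF q] by blast
      have "q \<in> topspace X" using openin_subset[OF V(1)] q by blast
      then show ?thesis
        using disc_chain_snoc[OF _ f(1), of _ x y 0 \<omega>] disc_chain_snoc[OF _ f(1), of _ x q \<omega> 0]
          f(2,3,4) y unfolding S_def by fastforce
    qed
    then show ?thesis using V(1,2) by blast
  qed
  have "openin X S"
  proof (subst openin_subopen, intro ballI)
    fix y assume y: "y \<in> S"
    then have "y \<in> topspace X" by (simp add: S_def)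
    from nbhd[OF this] y show "\<exists>T. openin X T \<and> y \<in> T \<and> T \<subseteq> S" by blast
  qed
  moreover have "openin X (topspace X - S)"
  proof (subst openin_subopen, intro ballI)
    fix y assume y: "y \<in> topspace X - S"
    then have "y \<in> topspace X" by simp
    from nbhd[OF this] y show "\<exists>T. openin X T \<and> y \<in> T \<and> T \<subseteq> topspace X - S" by blast
  qed
  then have "closedin X S" by (simp add: closedin_def S_def)
  moreover have "x \<in> S" using x disc_chain_Nil[of X A x] by (auto simp: S_def)
  ultimately have "S = topspace X"
    using \<open>connected_space X\<close> unfolding connected_space_clopen_in by blast
  then show ?thesis using y by (auto simp: S_def)
qed

section \<open>Paths made of hyperbolic geodesics of discs\<close>

text \<open>Every pair of points of the disc is the image of \<open>0\<close> and a point \<open>tanh L\<close> under an automorphism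
(lemma \<open>disc_normalize\<close>), so it is enough to admit arcs that start at the centre of their disc.  In
this form the parameter is the arc length, and the length of a path is the total length of a chain.\<close>

inductive disc_path ::
    "'a topology \<Rightarrow> ('a, 'n::finite) chart set \<Rightarrow> real \<Rightarrow> (real \<Rightarrow> 'a) \<Rightarrow> bool"
  for X A where
  arc: "holomorphic_disc X A f \<Longrightarrow> 0 \<le> L \<Longrightarrow> disc_path X A L (\<lambda>t. f (of_real (tanh t)))"
| join: "disc_path X A L \<sigma> \<Longrightarrow> disc_path X A L' \<sigma>' \<Longrightarrow> \<sigma> L = \<sigma>' 0 \<Longrightarrow>
    disc_path X A (L + L') (\<lambda>t. if t \<le> L then \<sigma> t else \<sigma>' (t - L))"

lemma disc_path_nonneg: "disc_path X A L \<sigma> \<Longrightarrow> 0 \<le> L"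
  by (induction rule: disc_path.induct) auto

lemma holomorphic_disc_const:
  "x \<in> topspace X \<Longrightarrow> holomorphic_disc X A (\<lambda>_. x)"
  unfolding holomorphic_disc_def by auto

lemma disc_path_of_chain:
  fixes A :: "('a, 'n::finite) chart set"
  assumes "L \<in> disc_chain_lengths X A x y" and x: "x \<in> topspace X"
  obtains \<sigma> where "disc_path X A L \<sigma>" "\<sigma> 0 = x" "\<sigma> L = y"
proof -
  obtain m \<zeta> \<omega> p f where *: "L = (\<Sum>j<m. poincare_dist (\<zeta> j) (\<omega> j))" "p 0 = x" "p m = y"
    "\<And>j. j < m \<Longrightarrow> holomorphic_disc X A (f j) \<and> \<zeta> j \<in> ball 0 1 \<and> \<omega> j \<in> ball 0 1 \<and>
             f j (\<zeta> j) = p j \<and> f j (\<omega> j) = p (Suc j)"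
    using assms(1) unfolding disc_chain_lengths_def by blast
  have "\<exists>\<sigma>. disc_path X A (\<Sum>j<n. poincare_dist (\<zeta> j) (\<omega> j)) \<sigma> \<and> \<sigma> 0 = x \<and>
      \<sigma> (\<Sum>j<n. poincare_dist (\<zeta> j) (\<omega> j)) = p n" if "n \<le> m" for n
    using that
  proof (induction n)
    case 0
    show ?case using disc_path.arc[OF holomorphic_disc_const[OF x, of A], of 0] *(2) by auto
  next
    case (Suc n)
    let ?L = "\<Sum>j<n. poincare_dist (\<zeta> j) (\<omega> j)"
    let ?d = "poincare_dist (\<zeta> n) (\<omega> n)"
    obtain \<sigma> where \<sigma>: "disc_path X A ?L \<sigma>" "\<sigma> 0 = x" "\<sigma> ?L = p n" using Suc by auto
    have f: "holomorphic_disc X A (f n)" "cmod (\<zeta> n) < 1" "cmod (\<omega> n) < 1"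
       "f n (\<zeta> n) = p n" "f n (\<omega> n) = p (Suc n)" using *(4)[of n] Suc.prems by auto
    obtain g where g: "g holomorphic_on ball 0 1" "g ` ball 0 1 \<subseteq> ball 0 1" "g 0 = \<zeta> n"
      "g (of_real (tanh ?d)) = \<omega> n" using disc_normalize[OF f(2,3)] by blast
    have d: "0 \<le> ?d" using poincare_dist_nonneg f by blast
    have "disc_path X A ?d (\<lambda>t. (f n \<circ> g) (of_real (tanh t)))"
      by (rule disc_path.arc[OF holomorphic_disc_compose[OF f(1) g(1,2)] d])
    from disc_path.join[OF \<sigma>(1) this] show ?case
      using \<sigma> f g d disc_path_nonneg[OF \<sigma>(1)]
      by (intro exI[of _ "\<lambda>t. if t \<le> ?L then \<sigma> t else (f n \<circ> g) (of_real (tanh (t - ?L)))"]) auto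
  qed
  from this[of m] that show thesis using *(1,3) by auto
qed

text \<open>A chain of discs gives a path whose length is the sum of the Poincare distances along the chain, and the
Kobayashi distance is the infimum of these sums.\<close>

lemma short_disc_path:
  assumes "complex_atlas X A" "connected_space X" and x: "x \<in> topspace X" and y: "y \<in> topspace X"
    and "\<epsilon> > 0"
  obtains L \<sigma> where "disc_path X A L \<sigma>" "\<sigma> 0 = x" "\<sigma> L = y" "L < kobayashi_dist X A x y + \<epsilon>"
proof -
  have "Inf (disc_chain_lengths X A x y) < kobayashi_dist X A x y + \<epsilon>"
    using x y \<open>\<epsilon> > 0\<close> by (simp add: kobayashi_dist_def)
  then obtain L where "L \<in> disc_chain_lengths X A x y" "L < kobayashi_dist X A x y + \<epsilon>"
    using disc_chain_exists[OF assms(1,2) x y] cInf_lessD by blast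
  then show thesis using disc_path_of_chain[OF _ x] that by blast
qed

lemma disc_path_continuous:
  "disc_path X A L \<sigma> \<Longrightarrow> continuous_map (top_of_set {0..L}) X \<sigma>"
proof (induction rule: disc_path.induct)
  case (arc f L)
  have "continuous_map (top_of_set {0..L}) (top_of_set (ball 0 1 :: complex set)) (\<lambda>t. of_real (tanh t))"
    unfolding continuous_map_in_subtopology continuous_map_iff_continuous
  proof
    have "continuous_on {0..L} tanh" by (rule continuous_on_tanh) (auto intro: continuous_on_id)
    then show "continuous_on {0..L} (\<lambda>t. complex_of_real (tanh t))" by (rule continuous_on_of_real)
    show "(\<lambda>t. complex_of_real (tanh t)) \<in> topspace (top_of_set {0..L}) \<rightarrow> ball 0 1"
      using tanh_in_disc by blast
  qed
  from continuous_map_compose[OF this, of X f] show ?case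
    using arc unfolding holomorphic_disc_def by (simp add: o_def)
next
  case (join L \<sigma> L' \<sigma>')
  note nn = disc_path_nonneg[OF join(1)] disc_path_nonneg[OF join(2)]
  have 1: "continuous_map (top_of_set {0..L}) X \<sigma>" by fact
  have "continuous_map (top_of_set {L..L + L'}) (top_of_set {0..L'}) (\<lambda>t. t - L)"
    by (auto simp: continuous_map_in_subtopology intro!: continuous_intros)
  from continuous_map_compose[OF this join.IH(2)]
  have 2: "continuous_map (top_of_set {L..L + L'}) X (\<lambda>t. \<sigma>' (t - L))" by (simp add: o_def)
  show ?case
  proof (rule continuous_map_cases_le[of _ "\<lambda>t. t" "\<lambda>_. L"])
    show "continuous_map (subtopology (top_of_set {0..L + L'}) {x \<in> topspace (top_of_set {0..L + L'}). x \<le> L}) X \<sigma>"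
      using 1 nn by (simp add: subtopology_subtopology) (rule continuous_map_from_subtopology_mono, auto)
    show "continuous_map (subtopology (top_of_set {0..L + L'}) {x \<in> topspace (top_of_set {0..L + L'}). L \<le> x}) X (\<lambda>t. \<sigma>' (t - L))"
      using 2 nn by (simp add: subtopology_subtopology) (rule continuous_map_from_subtopology_mono, auto)
  qed (use join in auto)
qed

lemma disc_path_in_topspace:
  "disc_path X A L \<sigma> \<Longrightarrow> t \<in> {0..L} \<Longrightarrow> \<sigma> t \<in> topspace X"
  using disc_path_continuous[of X A L \<sigma>] unfolding continuous_map_def by auto

lemma disc_path_dist_le:
  assumes hyp: "kobayashi_hyperbolic X A"
  shows "disc_path X A L \<sigma> \<Longrightarrow> s \<in> {0..L} \<Longrightarrow> t \<in> {0..L} \<Longrightarrow> kobayashi_dist X A (\<sigma> s) (\<sigma> t) \<le> \<bar>s - t\<bar>"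
proof (induction arbitrary: s t rule: disc_path.induct)
  case (arc f L)
  show ?case using kobayashi_dist_le_disc[OF arc(1), of "of_real (tanh s)" "of_real (tanh t)"]
    by (simp only: poincare_dist_tanh tanh_in_disc)
next
  case (join L \<sigma> L' \<sigma>')
  interpret Metric_space "topspace X" "kobayashi_dist X A" using hyp by (simp add: kobayashi_hyperbolic_def)
  note nn = disc_path_nonneg[OF join(1)] disc_path_nonneg[OF join(2)]
  let ?\<tau> = "\<lambda>t. if t \<le> L then \<sigma> t else \<sigma>' (t - L)"
  have le: "kobayashi_dist X A (?\<tau> s) (?\<tau> t) \<le> t - s"
    if "s \<le> t" "s \<in> {0..L + L'}" "t \<in> {0..L + L'}" for s t
  proof -
    consider "t \<le> L" | "L < s" | "s \<le> L" "L < t" by linarith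
    then show ?thesis
    proof cases
      case 3
      have "kobayashi_dist X A (\<sigma> s) (\<sigma>' (t - L))
          \<le> kobayashi_dist X A (\<sigma> s) (\<sigma> L) + kobayashi_dist X A (\<sigma> L) (\<sigma>' (t - L))"
        using disc_path_in_topspace[OF join(1)] disc_path_in_topspace[OF join(2)] that 3 nn
        by (intro triangle) auto
      also have "\<dots> \<le> (L - s) + (t - L)"
        using join.IH(1)[of s L] join.IH(2)[of 0 "t - L"] that 3 nn join(3) by auto
      finally show ?thesis using 3 by simp
    qed (use that join.IH(1)[of s t] join.IH(2)[of "s - L" "t - L"] in auto)
  qed
  show ?case
  proof (cases "s \<le> t")
    case False
    then show ?thesis using le[of t s] join.prems
      by (subst commute) auto
  qed (use le[of s t] join.prems in auto)
qed

section \<open>The Kobayashi distance induces the manifold topology\<close>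

lemma chart_image_open:
  assumes A: "complex_atlas X A" "(U, \<phi>) \<in> A" and S: "openin X S" "S \<subseteq> U"
  shows "open (\<phi> ` S)"
proof -
  note UD = complex_atlasD[OF A]
  have "openin (subtopology X U) S" using S UD(1) openin_open_subtopology by blast
  then have "openin (top_of_set (\<phi> ` U)) (\<phi> ` S)"
    using homeomorphic_imp_open_map[OF UD(3)] unfolding open_map_def by blast
  then show ?thesis using UD(2) openin_open_eq by blast
qed

lemma complex_atlas_locally_compact:
  assumes A: "complex_atlas X A"
  shows "locally_compact_space X"
  unfolding locally_compact_space_def
proof
  fix x assume "x \<in> topspace X"
  then obtain U \<phi> where U: "(U, \<phi>) \<in> A" "x \<in> U"
    using A unfolding complex_atlas_def by blast
  note UD = complex_atlasD[OF A U(1)]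
  obtain r where r: "r > 0" "cball (\<phi> x) r \<subseteq> \<phi> ` U"
    using UD(2) U(2) open_contains_cball by blast
  let ?V = "{y \<in> U. \<phi> y \<in> ball (\<phi> x) r}" and ?K = "inv_into U \<phi> ` cball (\<phi> x) r"
  have "continuous_map (top_of_set (\<phi> ` U)) X (inv_into U \<phi>)"
    using UD(5) by (simp add: continuous_map_in_subtopology)
  moreover have "compactin (top_of_set (\<phi> ` U)) (cball (\<phi> x) r)"
    using r by (simp add: compactin_subtopology)
  ultimately have "compactin X ?K" by (rule image_compactin[rotated])
  moreover have "?V \<subseteq> ?K"
  proof
    fix y assume "y \<in> ?V"
    then have "inv_into U \<phi> (\<phi> y) = y" "\<phi> y \<in> cball (\<phi> x) r" using UD(4) by auto
    then show "y \<in> ?K" by (metis imageI)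
  qed
  moreover have "openin X ?V" by (rule chart_preimage_open[OF A U(1) open_ball])
  moreover have "x \<in> ?V" using U(2) r(1) by simp
  ultimately show "\<exists>V K. openin X V \<and> compactin X K \<and> x \<in> V \<and> V \<subseteq> K" by blast
qed

lemma compact_neighbourhood:
  assumes "locally_compact_space X" "Hausdorff_space X" "openin X S" "x \<in> S"
  obtains W C where "openin X W" "compactin X C" "closedin X C" "x \<in> W" "W \<subseteq> C" "C \<subseteq> S"
proof -
  have "neighbourhood_base_of (\<lambda>C. compactin X C \<and> closedin X C) X"
    using assms(1,2) locally_compact_Hausdorff_imp_regular_space
      locally_compact_regular_space_neighbourhood_base by blast
  then show thesis
    using assms(3,4) that unfolding neighbourhood_base_of by (metis (no_types, lifting))
qed

lemma openin_kobayashi_imp_openin: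
  assumes A: "complex_atlas X A" and hyp: "kobayashi_hyperbolic X A"
    and S: "openin (Metric_space.mtopology (topspace X) (kobayashi_dist X A)) S"
  shows "openin X S"
proof (subst openin_subopen, intro ballI)
  interpret Metric_space "topspace X" "kobayashi_dist X A"
    using hyp by (simp add: kobayashi_hyperbolic_def)
  fix x assume x: "x \<in> S"
  then have xX: "x \<in> topspace X" using S by (auto simp: openin_mtopology)
  obtain r where r: "r > 0" "mball x r \<subseteq> S" using S x unfolding openin_mtopology by blast
  obtain V where V: "openin X V" "x \<in> V"
    "\<And>y. y \<in> V \<Longrightarrow> \<exists>f \<omega>. holomorphic_disc X A f \<and> f 0 = x \<and> \<omega> \<in> ball 0 1 \<and> f \<omega> = y \<and>
      poincare_dist 0 \<omega> < r"
    using kobayashi_neighbourhood[OF A xX r(1)] by blast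
  have "V \<subseteq> mball x r"
  proof
    fix y assume y: "y \<in> V"
    then obtain f \<omega> where f: "holomorphic_disc X A f" "f 0 = x" "\<omega> \<in> ball 0 1" "f \<omega> = y"
      "poincare_dist 0 \<omega> < r" using V(3) by blast
    have "kobayashi_dist X A (f 0) (f \<omega>) \<le> poincare_dist 0 \<omega>"
      by (rule kobayashi_dist_le_disc[OF f(1) _ f(3)]) simp
    then show "y \<in> mball x r" using f xX y openin_subset[OF V(1)] by (auto simp: in_mball)
  qed
  then show "\<exists>T. openin X T \<and> x \<in> T \<and> T \<subseteq> S" using V(1,2) r(2) by blast
qed

text \<open>This is Barth's theorem.  The frontier of a compact neighbourhood of \<open>x\<close> is compact, hence at a
  positive distance from \<open>x\<close>; a path of length less than that distance cannot cross it.\<close>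

lemma kobayashi_topology:
  assumes X: "complex_manifold X A" and conn: "connected_space X"
    and hyp: "kobayashi_hyperbolic X A"
  shows "Metric_space.mtopology (topspace X) (kobayashi_dist X A) = X"
proof -
  interpret Metric_space "topspace X" "kobayashi_dist X A"
    using hyp by (simp add: kobayashi_hyperbolic_def)
  have A: "complex_atlas X A" and Haus: "Hausdorff_space X"
    using X by (auto simp: complex_manifold_def)
  note coarser = openin_kobayashi_imp_openin[OF A hyp]
  have "openin mtopology S" if S: "openin X S" for S
    unfolding openin_mtopology
  proof (intro conjI allI impI)
    show "S \<subseteq> topspace X" by (rule openin_subset[OF S])
    fix x assume x: "x \<in> S"
    then have xX: "x \<in> topspace X" using openin_subset[OF S] by blast
    obtain W C where W: "openin X W" "compactin X C" "closedin X C" "x \<in> W" "W \<subseteq> C" "C \<subseteq> S"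
      using compact_neighbourhood[OF complex_atlas_locally_compact[OF A] Haus S x] .
    let ?Fr = "X frontier_of W"
    have "?Fr \<subseteq> C" using closure_of_minimal[OF W(5,3)] by (auto simp: frontier_of_def)
    then have "compactin X ?Fr" using W(2) closed_compactin closedin_frontier_of by blast
    moreover have "continuous_map X mtopology id"
      unfolding continuous_map_def
    proof (intro conjI allI impI)
      fix U assume U: "openin mtopology U"
      have "{y \<in> topspace X. id y \<in> U} = U" using openin_subset[OF coarser[OF U]] by auto
      then show "openin X {y \<in> topspace X. id y \<in> U}" using coarser[OF U] by simp
    qed simp
    ultimately have "compactin mtopology ?Fr" using image_compactin[of X ?Fr mtopology id] by simp
    then have "closedin mtopology ?Fr"
      using Hausdorff_space_mtopology compactin_imp_closedin by blast
    moreover have "x \<notin> ?Fr" using W(1,4) by (simp add: frontier_of_def interior_of_openin)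
    ultimately obtain \<delta> where \<delta>: "\<delta> > 0" "mball x \<delta> \<subseteq> topspace X - ?Fr"
      using xX unfolding closedin_def openin_mtopology by auto
    have "mball x \<delta> \<subseteq> W"
    proof
      fix y assume y: "y \<in> mball x \<delta>"
      then have yX: "y \<in> topspace X" and d: "\<delta> - kobayashi_dist X A x y > 0" by auto
      obtain L \<sigma> where L: "disc_path X A L \<sigma>" "\<sigma> 0 = x" "\<sigma> L = y" "L < \<delta>"
        using short_disc_path[OF A conn xX yX d] by auto
      have L0: "0 \<le> L" by (rule disc_path_nonneg[OF L(1)])
      have "connectedin X (\<sigma> ` {0..L})"
        using connectedin_continuous_map_image[OF disc_path_continuous[OF L(1)], of "{0..L}"]
        by (simp add: connectedin_subtopology)
      moreover have "\<sigma> ` {0..L} \<inter> ?Fr = {}"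
      proof -
        have "\<sigma> t \<in> mball x \<delta>" if "t \<in> {0..L}" for t
          using disc_path_dist_le[OF hyp L(1), of 0 t] that L disc_path_in_topspace[OF L(1) that] xX by auto
        then show ?thesis using \<delta>(2) by blast
      qed
      moreover have "\<sigma> ` {0..L} \<inter> W \<noteq> {}" using L(2) W(4) L0 by force
      ultimately have "\<sigma> ` {0..L} \<subseteq> W" using connectedin_Int_frontier_of by blast
      then show "y \<in> W" using L(3) L0 by force
    qed
    then show "\<exists>r>0. mball x r \<subseteq> S" using \<delta>(1) W(5,6) by blast
  qed
  then show ?thesis unfolding topology_eq using coarser by blast
qed

section \<open>Open submanifolds\<close>

lemma complex_atlas_restrict:
  fixes B :: "('b, 'm::finite) chart set"
  assumes B: "complex_atlas Y B" and W: "openin Y W"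
  shows "complex_atlas (subtopology Y W) (restrict_atlas W B)"
proof -
  have chart: "openin (subtopology Y W) (U \<inter> W) \<and> open (\<phi> ` (U \<inter> W)) \<and>
      homeomorphic_map (subtopology (subtopology Y W) (U \<inter> W)) (top_of_set (\<phi> ` (U \<inter> W))) \<phi>"
    if U: "(U, \<phi>) \<in> B" for U \<phi>
  proof -
    note UD = complex_atlasD[OF B U]
    have o: "openin Y (U \<inter> W)" using UD(1) W by blast
    have "homeomorphic_map (subtopology (subtopology Y U) (U \<inter> W))
        (subtopology (top_of_set (\<phi> ` U)) (\<phi> ` (U \<inter> W))) \<phi>"
      by (rule homeomorphic_map_subtopologies[OF UD(3)]) (use openin_subset[OF UD(1)] in auto)
    moreover have "\<phi> ` U \<inter> \<phi> ` (U \<inter> W) = \<phi> ` (U \<inter> W)" "U \<inter> (U \<inter> W) = U \<inter> W"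
      "W \<inter> (U \<inter> W) = U \<inter> W" by auto
    ultimately have "homeomorphic_map (subtopology (subtopology Y W) (U \<inter> W))
        (top_of_set (\<phi> ` (U \<inter> W))) \<phi>"
      by (simp add: subtopology_subtopology)
    then show ?thesis
      using o W chart_image_open[OF B U o] openin_open_subtopology[OF W] by simp
  qed
  have trans: "holomorphic_map_on (\<psi> \<circ> inv_into (U \<inter> W) \<phi>) (\<phi> ` (U \<inter> W \<inter> (V \<inter> W)))"
    if U: "(U, \<phi>) \<in> B" and V: "(V, \<psi>) \<in> B" for U \<phi> V \<psi>
  proof -
    note UD = complex_atlasD[OF B U] and VD = complex_atlasD[OF B V]
    let ?S = "\<phi> ` (U \<inter> W \<inter> (V \<inter> W))"
    have oS: "open ?S" by (rule chart_image_open[OF B U]) (use UD(1) VD(1) W in auto)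
    have hol: "holomorphic_map_on (\<psi> \<circ> inv_into U \<phi>) (\<phi> ` (U \<inter> V))"
      using B U V unfolding complex_atlas_def by fastforce
    have eq: "(\<psi> \<circ> inv_into U \<phi>) z = (\<psi> \<circ> inv_into (U \<inter> W) \<phi>) z" if z: "z \<in> ?S" for z
    proof -
      obtain y where y: "y \<in> U" "y \<in> W" "z = \<phi> y" using z by auto
      moreover have "inj_on \<phi> (U \<inter> W)" using UD(4) inj_on_subset by blast
      ultimately show ?thesis using UD(4) by simp
    qed
    have sub: "?S \<subseteq> \<phi> ` (U \<inter> V)" by blast
    show ?thesis
      unfolding holomorphic_map_on_def
    proof (intro conjI ballI oS)
      fix z assume z: "z \<in> ?S"
      then obtain D where D: "((\<psi> \<circ> inv_into U \<phi>) has_derivative D) (at z)" "\<forall>c v. D (c *s v) = c *s D v"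
        using hol sub unfolding holomorphic_map_on_def by (metis subsetD)
      have "((\<psi> \<circ> inv_into (U \<inter> W) \<phi>) has_derivative D) (at z)"
        by (rule has_derivative_transform_within_open[OF D(1) oS z eq])
      then show "\<exists>D. ((\<psi> \<circ> inv_into (U \<inter> W) \<phi>) has_derivative D) (at z) \<and> (\<forall>c v. D (c *s v) = c *s D v)"
        using D(2) by blast
    qed
  qed
  have cover: "(\<Union>(U, \<phi>)\<in>restrict_atlas W B. U) = topspace (subtopology Y W)"
  proof -
    have "(\<Union>(U, \<phi>)\<in>restrict_atlas W B. U) = (\<Union>(U, \<phi>)\<in>B. U) \<inter> W"
      by (auto simp: restrict_atlas_def)
    also have "(\<Union>(U, \<phi>)\<in>B. U) = topspace Y" using B by (simp add: complex_atlas_def)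
    finally show ?thesis by simp
  qed
  show ?thesis
    unfolding complex_atlas_def
  proof (intro conjI cover)
    show "\<forall>(U, \<phi>)\<in>restrict_atlas W B. openin (subtopology Y W) U \<and> open (\<phi> ` U) \<and>
        homeomorphic_map (subtopology (subtopology Y W) U) (top_of_set (\<phi> ` U)) \<phi>"
      unfolding restrict_atlas_def using chart by fastforce
    show "\<forall>(U, \<phi>)\<in>restrict_atlas W B. \<forall>(V, \<psi>)\<in>restrict_atlas W B.
        holomorphic_map_on (\<psi> \<circ> inv_into U \<phi>) (\<phi> ` (U \<inter> V))"
      unfolding restrict_atlas_def using trans by fastforce
  qed
qed

lemma complex_manifold_restrict:
  assumes "complex_manifold Y B" "openin Y W"
  shows "complex_manifold (subtopology Y W) (restrict_atlas W B)"
  using assms complex_atlas_restrict Hausdorff_space_subtopology second_countable_subtopology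
  unfolding complex_manifold_def by blast

section \<open>Regularity of disc paths\<close>

lemma has_vector_derivative_vec:
  fixes g :: "real \<Rightarrow> complex ^ 'n::finite"
  assumes "\<And>i. ((\<lambda>t. g t $ i) has_vector_derivative v $ i) (at t)"
  shows "(g has_vector_derivative v) (at t)"
  unfolding has_vector_derivative_def
proof (subst has_derivative_componentwise_within, intro ballI)
  fix b :: "complex ^ 'n" assume "b \<in> Basis"
  then obtain i c where b: "b = axis i c" by (auto simp: Basis_vec_def)
  have "((\<lambda>t. g t $ i) has_derivative (\<lambda>s. s *\<^sub>R v $ i)) (at t)"
    using assms[of i] by (simp add: has_vector_derivative_def)
  from bounded_linear.has_derivative[OF bounded_linear_inner_left this, of c]
  show "((\<lambda>x. g x \<bullet> b) has_derivative (\<lambda>x. (x *\<^sub>R v) \<bullet> b)) (at t)"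
    by (simp add: b inner_axis)
qed

text \<open>The derivative of \<open>\<phi> \<circ> f \<circ> tanh\<close>, by the chain rule and \<open>tanh' = 1 - tanh\<^sup>2\<close>.\<close>

definition disc_velocity ::
    "(complex \<Rightarrow> 'a) \<Rightarrow> ('a \<Rightarrow> complex ^ 'n) \<Rightarrow> real \<Rightarrow> complex ^ 'n" where
  "disc_velocity f \<phi> t = (\<chi> i. of_real (1 - (tanh t)\<^sup>2) * deriv (\<lambda>\<zeta>. \<phi> (f \<zeta>) $ i) (of_real (tanh t)))"

lemma disc_preimage_open:
  assumes f: "holomorphic_disc X A f" and U: "openin X U"
  shows "open {\<zeta> \<in> ball 0 1. f \<zeta> \<in> U}"
proof -
  have "openin (top_of_set (ball 0 1)) {\<zeta> \<in> topspace (top_of_set (ball 0 1)). f \<zeta> \<in> U}"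
    using f U unfolding holomorphic_disc_def by (intro openin_continuous_map_preimage) auto
  then have "openin (top_of_set (ball 0 1)) {\<zeta> \<in> ball 0 1. f \<zeta> \<in> U}" by simp
  then show ?thesis using openin_open_eq open_ball by blast
qed

lemma disc_components_holomorphic:
  assumes "holomorphic_disc X A f" "(U, \<phi>) \<in> A"
  shows "(\<lambda>\<zeta>. \<phi> (f \<zeta>) $ i) holomorphic_on {\<zeta> \<in> ball 0 1. f \<zeta> \<in> U}"
  using assms unfolding holomorphic_disc_def by fastforce

lemma has_vector_derivative_tanh:
  "((\<lambda>t. complex_of_real (tanh t)) has_vector_derivative of_real (1 - (tanh t)\<^sup>2)) (at t)"
proof -
  have "(tanh has_field_derivative (1 - (tanh t)\<^sup>2)) (at t)"
    using has_field_derivative_tanh[of "\<lambda>t. t" t 1 UNIV] by simp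
  then show ?thesis
    by (intro has_vector_derivative_of_real) (simp add: has_real_derivative_iff_has_vector_derivative)
qed

lemma disc_arc_derivative:
  fixes A :: "('a, 'n::finite) chart set"
  assumes f: "holomorphic_disc X A f" and A: "complex_atlas X A" "(U, \<phi>) \<in> A"
    and t: "f (of_real (tanh t)) \<in> U"
  shows "((\<phi> \<circ> (\<lambda>t. f (of_real (tanh t)))) has_vector_derivative disc_velocity f \<phi> t) (at t)"
proof (rule has_vector_derivative_vec)
  fix i
  let ?h = "\<lambda>\<zeta>. \<phi> (f \<zeta>) $ i"
  let ?D = "{\<zeta> \<in> ball 0 1. f \<zeta> \<in> U}"
  have "open ?D" by (rule disc_preimage_open[OF f complex_atlasD(1)[OF A]])
  moreover have "of_real (tanh t) \<in> ?D" using t tanh_in_disc by blast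
  ultimately have "(?h has_field_derivative deriv ?h (of_real (tanh t))) (at (of_real (tanh t)))"
    using disc_components_holomorphic[OF f A(2)] holomorphic_derivI by blast
  from field_vector_diff_chain_at[OF has_vector_derivative_tanh this]
  show "((\<lambda>t. (\<phi> \<circ> (\<lambda>t. f (of_real (tanh t)))) t $ i) has_vector_derivative disc_velocity f \<phi> t $ i) (at t)"
    by (simp add: o_def disc_velocity_def)
qed

text \<open>Where the curve is differentiable, the disc itself, recentred at the point, shows that the
  curve has Kobayashi speed at most 1.\<close>

lemma disc_arc_speed:
  fixes A :: "('a, 'n::finite) chart set"
  assumes f: "holomorphic_disc X A f" and A: "complex_atlas X A"
  shows "kobayashi_metric X A (f (of_real (tanh t)))
    (\<lambda>(U, \<phi>). vector_derivative (\<phi> \<circ> (\<lambda>t. f (of_real (tanh t)))) (at t)) \<le> 1"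
proof -
  define a where "a = tanh t"
  have a: "\<bar>a\<bar> < 1" using tanh_real_lt_1[of t] tanh_real_gt_neg1[of t] by (auto simp: a_def)
  define m where "m = Moebius_function 0 (- complex_of_real a)"
  have m: "m holomorphic_on ball 0 1" "m ` ball 0 1 \<subseteq> ball 0 1"
    using Moebius_function_holomorphic[of "- complex_of_real a" 0]
      Moebius_function_norm_lt_1[of "- complex_of_real a" _ 0] a by (auto simp: m_def)
  have m0: "m 0 = of_real a" by (simp add: m_def Moebius_function_of_zero)
  have "((\<lambda>z. (z + complex_of_real a) / (1 + of_real a * z)) has_field_derivative 1 - (of_real a)\<^sup>2) (at 0)"
    by (auto intro!: derivative_eq_intros simp: power2_eq_square)
  moreover have "m = (\<lambda>z. (z + complex_of_real a) / (1 + of_real a * z))"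
    by (rule ext) (simp add: m_def Moebius_function_simple)
  ultimately have dm: "(m has_field_derivative of_real (1 - a\<^sup>2)) (at 0)" by simp
  let ?v = "\<lambda>(U, \<phi>). vector_derivative (\<phi> \<circ> (\<lambda>t. f (of_real (tanh t)))) (at t)"
  have comp: "1 * deriv (\<lambda>\<zeta>. \<phi> ((f \<circ> m) \<zeta>) $ i) 0 = ?v (U, \<phi>) $ i"
    if U: "(U, \<phi>) \<in> A" and fa: "f (of_real a) \<in> U" for U \<phi> i
  proof -
    let ?h = "\<lambda>\<zeta>. \<phi> (f \<zeta>) $ i"
    let ?D = "{\<zeta> \<in> ball 0 1. f \<zeta> \<in> U}"
    have "open ?D" by (rule disc_preimage_open[OF f complex_atlasD(1)[OF A U]])
    moreover have "of_real a \<in> ?D" using fa a by simp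
    ultimately have dh: "(?h has_field_derivative deriv ?h (of_real a)) (at (m 0))"
      unfolding m0 using disc_components_holomorphic[OF f U] holomorphic_derivI by blast
    have "deriv (\<lambda>\<zeta>. \<phi> ((f \<circ> m) \<zeta>) $ i) 0 = deriv ?h (of_real a) * of_real (1 - a\<^sup>2)"
      using DERIV_imp_deriv[OF DERIV_chain[OF dh dm]] by (simp add: o_def)
    moreover have "?v (U, \<phi>) = disc_velocity f \<phi> t"
      using vector_derivative_at[OF disc_arc_derivative[OF f A U]] fa by (simp add: a_def)
    ultimately show ?thesis by (simp add: disc_velocity_def a_def mult.commute)
  qed
  let ?S = "{cmod \<xi> |\<xi>. \<exists>g. holomorphic_disc X A g \<and> g 0 = f (of_real (tanh t)) \<and>
            (\<forall>(U, \<phi>)\<in>A. f (of_real (tanh t)) \<in> U \<longrightarrow>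
               (\<forall>i. \<xi> * deriv (\<lambda>\<zeta>. \<phi> (g \<zeta>) $ i) 0 = ?v (U, \<phi>) $ i))}"
  have "holomorphic_disc X A (f \<circ> m) \<and> (f \<circ> m) 0 = f (of_real (tanh t)) \<and>
            (\<forall>(U, \<phi>)\<in>A. f (of_real (tanh t)) \<in> U \<longrightarrow>
               (\<forall>i. 1 * deriv (\<lambda>\<zeta>. \<phi> ((f \<circ> m) \<zeta>) $ i) 0 = ?v (U, \<phi>) $ i))"
    using holomorphic_disc_compose[OF f m] m0 comp unfolding a_def by fastforce
  then have "\<exists>g. holomorphic_disc X A g \<and> g 0 = f (of_real (tanh t)) \<and>
            (\<forall>(U, \<phi>)\<in>A. f (of_real (tanh t)) \<in> U \<longrightarrow>
               (\<forall>i. 1 * deriv (\<lambda>\<zeta>. \<phi> (g \<zeta>) $ i) 0 = ?v (U, \<phi>) $ i))"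
    by (rule exI[of _ "f \<circ> m"])
  then have "cmod 1 \<in> ?S"
    by (intro CollectI exI[of _ "1::complex"] conjI refl)
  then have "1 \<in> ?S" by simp
  then have "Inf ?S \<le> 1" by (rule cInf_lower) (auto intro: bdd_belowI[of _ 0])
  then show ?thesis unfolding kobayashi_metric_def .
qed

text \<open>Absolute continuity of a path made of several arcs is obtained from Lipschitz bounds in charts, because
these add up where two arcs meet.\<close>

definition locally_lipschitz_curve ::
    "('a, 'n::finite) chart set \<Rightarrow> real \<Rightarrow> (real \<Rightarrow> 'a) \<Rightarrow> bool" where
  "locally_lipschitz_curve A L \<sigma> \<longleftrightarrow> (\<forall>U \<phi> a b. (U, \<phi>) \<in> A \<longrightarrow> 0 \<le> a \<longrightarrow> b \<le> L \<longrightarrow> \<sigma> ` {a..b} \<subseteq> U \<longrightarrow>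
     (\<exists>C\<ge>0. \<forall>s t. a \<le> s \<longrightarrow> s \<le> t \<longrightarrow> t \<le> b \<longrightarrow> norm (\<phi> (\<sigma> s) - \<phi> (\<sigma> t)) \<le> C * (t - s)))"

lemma disc_arc_lipschitz:
  fixes A :: "('a, 'n::finite) chart set"
  assumes f: "holomorphic_disc X A f" and A: "complex_atlas X A"
  shows "locally_lipschitz_curve A L (\<lambda>t. f (of_real (tanh t)))"
  unfolding locally_lipschitz_curve_def
proof (intro allI impI)
  fix U \<phi> a b
  assume U: "(U, \<phi>) \<in> A" and sub: "(\<lambda>t. f (of_real (tanh t))) ` {a..b} \<subseteq> U"
  let ?D = "{\<zeta> \<in> ball 0 1. f \<zeta> \<in> U}"
  let ?g = "\<phi> \<circ> (\<lambda>t. f (of_real (tanh t)))"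
  have oD: "open ?D" by (rule disc_preimage_open[OF f complex_atlasD(1)[OF A U]])
  have cth: "continuous_on {a..b} (\<lambda>t. complex_of_real (tanh t))"
    by (intro continuous_on_of_real continuous_on_tanh continuous_on_id) simp
  have ctr: "continuous_on {a..b} (tanh :: real \<Rightarrow> real)"
    by (intro continuous_on_tanh continuous_on_id) simp
  have inD: "(\<lambda>t. complex_of_real (tanh t)) ` {a..b} \<subseteq> ?D"
    using sub tanh_in_disc by blast
  have "continuous_on {a..b} (disc_velocity f \<phi>)"
    unfolding disc_velocity_def
  proof (rule continuous_on_vec_lambda)
    fix i
    have "continuous_on ?D (deriv (\<lambda>\<zeta>. \<phi> (f \<zeta>) $ i))"
      by (intro holomorphic_on_imp_continuous_on holomorphic_deriv disc_components_holomorphic[OF f U] oD)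
    from continuous_on_compose2[OF this cth inD]
    show "continuous_on {a..b} (\<lambda>t. of_real (1 - (tanh t)\<^sup>2) * deriv (\<lambda>\<zeta>. \<phi> (f \<zeta>) $ i) (of_real (tanh t)))"
      by (intro continuous_on_mult continuous_on_of_real continuous_on_diff continuous_on_power
          continuous_on_const ctr)
  qed
  from compact_imp_bounded[OF compact_continuous_image[OF this compact_Icc]]
  obtain C where C: "\<And>t. t \<in> {a..b} \<Longrightarrow> norm (disc_velocity f \<phi> t) \<le> C"
    unfolding bounded_iff by blast
  have "norm (?g s - ?g t) \<le> max C 0 * (t - s)" if st: "a \<le> s" "s \<le> t" "t \<le> b" for s t
  proof -
    have "norm (?g t - ?g s) \<le> max C 0 * norm (t - s)"
    proof (rule differentiable_bound)
      show "convex {a..b}" by simp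
      fix r assume r: "r \<in> {a..b}"
      then have "(?g has_vector_derivative disc_velocity f \<phi> r) (at r)"
        by (intro disc_arc_derivative[OF f A U]) (use sub in blast)
      then show "(?g has_derivative (\<lambda>h. h *\<^sub>R disc_velocity f \<phi> r)) (at r within {a..b})"
        unfolding has_vector_derivative_def by (rule has_derivative_at_withinI)
      show "onorm (\<lambda>h. h *\<^sub>R disc_velocity f \<phi> r) \<le> max C 0"
      proof (rule onorm_le)
        fix h :: real
        have "norm (disc_velocity f \<phi> r) \<le> max C 0" using C[OF r] by simp
        then show "norm (h *\<^sub>R disc_velocity f \<phi> r) \<le> max C 0 * norm h"
          unfolding norm_scaleR real_norm_def mult.commute[of "\<bar>h\<bar>"] by (rule mult_right_mono) simp
      qed
    qed (use st in auto)
    then show ?thesis using st by (simp add: norm_minus_commute)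
  qed
  then show "\<exists>C\<ge>0. \<forall>s t. a \<le> s \<longrightarrow> s \<le> t \<longrightarrow> t \<le> b \<longrightarrow>
      norm (\<phi> (f (of_real (tanh s))) - \<phi> (f (of_real (tanh t)))) \<le> C * (t - s)"
    by (intro exI[of _ "max C 0"]) auto
qed

lemma disc_path_lipschitz:
  fixes A :: "('a, 'n::finite) chart set"
  assumes A: "complex_atlas X A"
  shows "disc_path X A L \<sigma> \<Longrightarrow> locally_lipschitz_curve A L \<sigma>"
proof (induction rule: disc_path.induct)
  case (arc f L)
  show ?case by (rule disc_arc_lipschitz[OF arc(1) A])
next
  case (join L \<sigma> L' \<sigma>')
  let ?\<tau> = "\<lambda>t. if t \<le> L then \<sigma> t else \<sigma>' (t - L)"
  note nn = disc_path_nonneg[OF join(1)] disc_path_nonneg[OF join(2)]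
  show ?case
    unfolding locally_lipschitz_curve_def
  proof (intro allI impI)
    fix U \<phi> a b
    assume U: "(U, \<phi>) \<in> A" and ab: "0 \<le> a" "b \<le> L + L'" and sub: "?\<tau> ` {a..b} \<subseteq> U"
    have s1: "\<sigma> ` {a..min b L} \<subseteq> U"
    proof
      fix y assume "y \<in> \<sigma> ` {a..min b L}"
      then obtain t where t: "t \<in> {a..min b L}" "y = \<sigma> t" by blast
      then have "?\<tau> t \<in> U" using sub by (intro subsetD[OF sub] imageI) auto
      then show "y \<in> U" using t by simp
    qed
    have s2: "\<sigma>' ` {max a L - L..b - L} \<subseteq> U"
    proof
      fix y assume "y \<in> \<sigma>' ` {max a L - L..b - L}"
      then obtain t where t: "t \<in> {max a L - L..b - L}" "y = \<sigma>' t" by blast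
      then have "?\<tau> (t + L) \<in> U" by (intro subsetD[OF sub] imageI) auto
      moreover have "t \<ge> 0" using t(1) by auto
      ultimately show "y \<in> U" using t(2) join(3) by (cases "t = 0") auto
    qed
    obtain C where C: "C \<ge> 0" "\<And>s t. a \<le> s \<Longrightarrow> s \<le> t \<Longrightarrow> t \<le> min b L \<Longrightarrow>
        norm (\<phi> (\<sigma> s) - \<phi> (\<sigma> t)) \<le> C * (t - s)"
      using join.IH(1)[unfolded locally_lipschitz_curve_def, rule_format, OF U ab(1) _ s1] by auto
    obtain C' where C': "C' \<ge> 0" "\<And>s t. max a L - L \<le> s \<Longrightarrow> s \<le> t \<Longrightarrow> t \<le> b - L \<Longrightarrow>
        norm (\<phi> (\<sigma>' s) - \<phi> (\<sigma>' t)) \<le> C' * (t - s)"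
      using join.IH(2)[unfolded locally_lipschitz_curve_def, rule_format, OF U _ _ s2] ab by auto
    have "norm (\<phi> (?\<tau> s) - \<phi> (?\<tau> t)) \<le> max C C' * (t - s)"
      if st: "a \<le> s" "s \<le> t" "t \<le> b" for s t
    proof -
      have C1: "C * (t - s) \<le> max C C' * (t - s)" "C' * (t - s) \<le> max C C' * (t - s)"
        if "s \<le> t" for s t :: real using that by (auto intro!: mult_right_mono)
      consider "t \<le> L" | "L < s" | "s \<le> L" "L < t" by linarith
      then show ?thesis
      proof cases
        case 1
        then show ?thesis using C(2)[of s t] C1(1)[of s t] st by auto
      next
        case 2
        then show ?thesis using C'(2)[of "s - L" "t - L"] C1(2)[of s t] st by auto
      next
        case 3
        have "norm (\<phi> (\<sigma> s) - \<phi> (\<sigma>' (t - L)))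
            \<le> norm (\<phi> (\<sigma> s) - \<phi> (\<sigma> L)) + norm (\<phi> (\<sigma>' 0) - \<phi> (\<sigma>' (t - L)))"
          using norm_triangle_ineq[of "\<phi> (\<sigma> s) - \<phi> (\<sigma> L)" "\<phi> (\<sigma>' 0) - \<phi> (\<sigma>' (t - L))"] join(3)
          by simp
        also have "\<dots> \<le> max C C' * (L - s) + max C C' * (t - L)"
        proof (rule add_mono)
          show "norm (\<phi> (\<sigma> s) - \<phi> (\<sigma> L)) \<le> max C C' * (L - s)"
            by (rule order_trans[OF C(2) C1(1)]) (use st 3 in auto)
          have "norm (\<phi> (\<sigma>' 0) - \<phi> (\<sigma>' (t - L))) \<le> C' * (t - L)"
            using C'(2)[of 0 "t - L"] st 3 by auto
          also have "\<dots> \<le> max C C' * (t - L)" by (rule C1(2)) (use 3 in simp)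
          finally show "norm (\<phi> (\<sigma>' 0) - \<phi> (\<sigma>' (t - L))) \<le> max C C' * (t - L)" .
        qed
        also have "\<dots> = max C C' * (t - s)" by (simp add: algebra_simps)
        finally show ?thesis using 3 by simp
      qed
    qed
    moreover have "max C C' \<ge> 0" using C(1) by simp
    ultimately show "\<exists>C\<ge>0. \<forall>s t. a \<le> s \<longrightarrow> s \<le> t \<longrightarrow> t \<le> b \<longrightarrow>
      norm (\<phi> (?\<tau> s) - \<phi> (?\<tau> t)) \<le> C * (t - s)" by blast
  qed
qed

lemma vector_derivative_shift:
  fixes g :: "real \<Rightarrow> 'a::real_normed_vector"
  shows "vector_derivative (\<lambda>t. g (t + c)) (at t) = vector_derivative g (at (t + c :: real))"
proof -
  have *: "((\<lambda>t. g (t + c)) has_vector_derivative D) (at t)"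
    if "(g has_vector_derivative D) (at (t + c))" for g :: "real \<Rightarrow> 'a" and D c t
  proof -
    have "((\<lambda>t. t + c) has_vector_derivative 1) (at t)"
      by (auto intro!: derivative_eq_intros)
    from vector_diff_chain_at[OF this that] show ?thesis by (simp add: o_def)
  qed
  have "((\<lambda>t. g (t + c)) has_vector_derivative D) (at t) \<longleftrightarrow> (g has_vector_derivative D) (at (t + c))" for D
    using *[of g D t c] *[of "\<lambda>t. g (t + c)" D "t + c" "- c"] by auto
  then show ?thesis by (simp add: vector_derivative_def)
qed

lemma disc_path_speed:
  fixes A :: "('a, 'n::finite) chart set"
  assumes A: "complex_atlas X A"
  shows "disc_path X A L \<sigma> \<Longrightarrow> \<exists>S. finite S \<and> (\<forall>t\<in>{0<..<L} - S.
    kobayashi_metric X A (\<sigma> t) (\<lambda>(U, \<phi>). vector_derivative (\<phi> \<circ> \<sigma>) (at t)) \<le> 1)"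
proof (induction rule: disc_path.induct)
  case (arc f L)
  show ?case by (intro exI[of _ "{}"] conjI ballI finite.emptyI disc_arc_speed[OF arc(1) A])
next
  case (join L \<sigma> L' \<sigma>')
  let ?\<tau> = "\<lambda>t. if t \<le> L then \<sigma> t else \<sigma>' (t - L)"
  obtain S S' where S: "finite S" "finite S'"
    "\<And>t. t \<in> {0<..<L} - S \<Longrightarrow> kobayashi_metric X A (\<sigma> t) (\<lambda>(U, \<phi>). vector_derivative (\<phi> \<circ> \<sigma>) (at t)) \<le> 1"
    "\<And>t. t \<in> {0<..<L'} - S' \<Longrightarrow> kobayashi_metric X A (\<sigma>' t) (\<lambda>(U, \<phi>). vector_derivative (\<phi> \<circ> \<sigma>') (at t)) \<le> 1"
    using join.IH by blast
  have "kobayashi_metric X A (?\<tau> t) (\<lambda>(U, \<phi>). vector_derivative (\<phi> \<circ> ?\<tau>) (at t)) \<le> 1"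
    if t: "t \<in> {0<..<L + L'} - (insert L (S \<union> (\<lambda>t. t + L) ` S'))" for t
  proof (cases "t < L")
    case True
    have "vector_derivative (\<phi> \<circ> ?\<tau>) (at t) = vector_derivative (\<phi> \<circ> \<sigma>) (at t)" for \<phi> :: "'a \<Rightarrow> complex ^ 'n"
      by (rule vector_derivative_cong_eq)
        (use eventually_nhds_in_open[of "{..<L}" t] True in \<open>auto elim!: eventually_mono\<close>)
    then show ?thesis using S(3)[of t] t True by simp
  next
    case False
    then have "t > L" using t by auto
    have "vector_derivative (\<phi> \<circ> ?\<tau>) (at t) = vector_derivative (\<phi> \<circ> \<sigma>') (at (t - L))" for \<phi> :: "'a \<Rightarrow> complex ^ 'n"
    proof -
      have "vector_derivative (\<phi> \<circ> ?\<tau>) (at t) = vector_derivative (\<lambda>t. (\<phi> \<circ> \<sigma>') (t + (- L))) (at t)"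
        by (rule vector_derivative_cong_eq)
          (use eventually_nhds_in_open[of "{L<..}" t] \<open>t > L\<close> in \<open>auto elim!: eventually_mono\<close>)
      also have "\<dots> = vector_derivative (\<phi> \<circ> \<sigma>') (at (t - L))"
        using vector_derivative_shift[of "\<phi> \<circ> \<sigma>'" "- L" t] by simp
      finally show ?thesis .
    qed
    moreover have "t - L \<in> {0<..<L'} - S'"
    proof -
      have "t - L \<notin> S'"
      proof
        assume "t - L \<in> S'"
        then have "t - L + L \<in> (\<lambda>t. t + L) ` S'" by (rule imageI)
        then show False using t by simp
      qed
      then show ?thesis using t \<open>t > L\<close> by simp
    qed
    ultimately show ?thesis using S(4)[of "t - L"] \<open>t > L\<close> by simp
  qed
  moreover have "finite (insert L (S \<union> (\<lambda>t. t + L) ` S'))" using S by simp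
  ultimately show ?case by blast
qed

lemma lipschitz_imp_absolutely_continuous:
  fixes g :: "real \<Rightarrow> 'b::real_normed_vector"
  assumes "C \<ge> 0" and lip: "\<And>s t. a \<le> s \<Longrightarrow> s \<le> t \<Longrightarrow> t \<le> b \<Longrightarrow> norm (g s - g t) \<le> C * (t - s)"
  shows "absolutely_continuous_map_on {a..b} g"
  unfolding absolutely_continuous_map_on_def
proof (intro allI impI)
  fix \<epsilon> :: real assume "\<epsilon> > 0"
  define \<delta> where "\<delta> = \<epsilon> / (C + 1)"
  have \<delta>: "\<delta> > 0" using \<open>\<epsilon> > 0\<close> \<open>C \<ge> 0\<close> by (simp add: \<delta>_def)
  have "(\<Sum>(a, b)\<in>D. norm (g b - g a)) < \<epsilon>"
    if D: "finite D" "\<forall>(c, d)\<in>D. c \<le> d \<and> {c..d} \<subseteq> {a..b}" "(\<Sum>(a, b)\<in>D. b - a) < \<delta>" for D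
  proof -
    have "(\<Sum>(a, b)\<in>D. norm (g b - g a)) \<le> (\<Sum>(a, b)\<in>D. C * (b - a))"
    proof (rule sum_mono)
      fix p assume "p \<in> D"
      moreover obtain c d where p: "p = (c, d)" by fastforce
      ultimately have "c \<le> d" "a \<le> c" "d \<le> b" using D(2) by auto
      then show "(case p of (a, b) \<Rightarrow> norm (g b - g a)) \<le> (case p of (a, b) \<Rightarrow> C * (b - a))"
        using lip[of c d] by (simp add: p norm_minus_commute)
    qed
    also have "\<dots> = C * (\<Sum>(a, b)\<in>D. b - a)" by (simp add: sum_distrib_left case_prod_unfold)
    also have "\<dots> \<le> C * \<delta>" using D(3) \<open>C \<ge> 0\<close> by (intro mult_left_mono) auto
    also have "\<dots> < \<epsilon>" using \<open>\<epsilon> > 0\<close> \<open>C \<ge> 0\<close> by (simp add: \<delta>_def field_simps)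
    finally show ?thesis .
  qed
  then show "\<exists>\<delta>>0. \<forall>D. finite D \<and> (\<forall>(c, d)\<in>D. c \<le> d \<and> {c..d} \<subseteq> {a..b}) \<and>
      pairwise (\<lambda>(a, b) (c, d). disjnt {a<..<b} {c<..<d}) D \<and> (\<Sum>(a, b)\<in>D. b - a) < \<delta> \<longrightarrow>
      (\<Sum>(a, b)\<in>D. norm (g b - g a)) < \<epsilon>"
    using \<delta> by blast
qed

text \<open>Of the conditions on an almost-geodesic, only the lower estimate of the distances is an assumption;
the others hold for every path of this kind.  The statement is about a subpath because visibility is
applied to parts of paths.\<close>

lemma disc_path_almost_geodesic:
  fixes A :: "('a, 'n::finite) chart set"
  assumes A: "complex_atlas X A" and hyp: "kobayashi_hyperbolic X A"
    and \<sigma>: "disc_path X A L \<sigma>" and ab: "0 \<le> a" "a \<le> b" "b \<le> L" and l: "l \<ge> 1" "\<kappa> \<ge> 0"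
    and lower: "\<And>s t. s \<in> {0..L} \<Longrightarrow> t \<in> {0..L} \<Longrightarrow> inverse l * \<bar>s - t\<bar> - \<kappa> \<le> kobayashi_dist X A (\<sigma> s) (\<sigma> t)"
  shows "almost_geodesic X A l \<kappa> {0..b - a} (\<lambda>t. \<sigma> (t + a))"
proof -
  let ?I = "{0..b - a}" and ?\<tau> = "\<lambda>t. \<sigma> (t + a)"
  have shift: "continuous_map (top_of_set ?I) (top_of_set {0..L}) (\<lambda>t. t + a)"
    using ab by (auto simp: continuous_map_in_subtopology intro!: continuous_intros)
  have cont: "continuous_map (top_of_set ?I) X ?\<tau>"
    using continuous_map_compose[OF shift disc_path_continuous[OF \<sigma>]] by (simp add: o_def)
  have upper: "kobayashi_dist X A (?\<tau> s) (?\<tau> t) \<le> l * \<bar>s - t\<bar> + \<kappa>" if "s \<in> ?I" "t \<in> ?I" for s t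
  proof -
    have "kobayashi_dist X A (?\<tau> s) (?\<tau> t) \<le> 1 * \<bar>s - t\<bar>"
      using disc_path_dist_le[OF hyp \<sigma>, of "s + a" "t + a"] that ab by simp
    also have "\<dots> \<le> l * \<bar>s - t\<bar>" using l by (intro mult_right_mono) auto
    finally show ?thesis using l by simp
  qed
  have ac: "absolutely_continuous_curve X A ?I ?\<tau>"
    unfolding absolutely_continuous_curve_def
  proof (intro conjI cont)
    have "absolutely_continuous_map_on {c..d} (\<phi> \<circ> ?\<tau>)"
      if U: "(U, \<phi>) \<in> A" and cd: "c \<le> d" "{c..d} \<subseteq> ?I" "?\<tau> ` {c..d} \<subseteq> U" for U \<phi> c d
    proof -
      have cd': "0 \<le> c" "d \<le> b - a" using cd by auto
      have "\<sigma> ` {c + a..d + a} \<subseteq> U"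
      proof
        fix y assume "y \<in> \<sigma> ` {c + a..d + a}"
        then obtain t where "t \<in> {c + a..d + a}" "y = \<sigma> t" by blast
        then have "y = ?\<tau> (t - a)" "t - a \<in> {c..d}" by auto
        then show "y \<in> U" using cd(3) by blast
      qed
      then obtain C where C: "C \<ge> 0" "\<And>s t. c + a \<le> s \<Longrightarrow> s \<le> t \<Longrightarrow> t \<le> d + a \<Longrightarrow>
          norm (\<phi> (\<sigma> s) - \<phi> (\<sigma> t)) \<le> C * (t - s)"
        using disc_path_lipschitz[OF A \<sigma>, unfolded locally_lipschitz_curve_def, rule_format, OF U, of "c + a" "d + a"]
          cd' ab by auto
      show ?thesis
        by (rule lipschitz_imp_absolutely_continuous[OF C(1)]) (use C(2)[of "_ + a" "_ + a"] in auto)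
    qed
    then show "\<forall>(U, \<phi>)\<in>A. \<forall>c d. c \<le> d \<and> {c..d} \<subseteq> ?I \<and> ?\<tau> ` {c..d} \<subseteq> U \<longrightarrow>
        absolutely_continuous_map_on {c..d} (\<phi> \<circ> ?\<tau>)" by fast
  qed
  obtain S where S: "finite S" "\<And>t. t \<in> {0<..<L} - S \<Longrightarrow>
      kobayashi_metric X A (\<sigma> t) (\<lambda>(U, \<phi>). vector_derivative (\<phi> \<circ> \<sigma>) (at t)) \<le> 1"
    using disc_path_speed[OF A \<sigma>] by blast
  define N where "N = {0, b - a} \<union> (\<lambda>t. t - a) ` S"
  have "finite N" using S(1) by (simp add: N_def)
  then have null: "N \<in> null_sets lebesgue"
    using negligible_finite negligible_iff_null_sets by blast
  have "kobayashi_metric X A (?\<tau> t) (velocity ?I ?\<tau> t) \<le> l" if t: "t \<in> ?I" "t \<notin> N" for t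
  proof -
    have t': "0 < t" "t < b - a" using t by (auto simp: N_def less_le)
    then have "at t within ?I = at t" by (rule at_within_Icc_at)
    then have "velocity ?I ?\<tau> t = (\<lambda>(U, \<phi> :: 'a \<Rightarrow> complex ^ 'n).   vector_derivative (\<phi> \<circ> \<sigma>) (at (t + a)))"
      unfolding velocity_def using vector_derivative_shift[of "_ \<circ> \<sigma>" a t]
      by (auto simp: o_def fun_eq_iff)
    moreover have "t + a \<notin> S"
    proof
      assume "t + a \<in> S"
      then have "t + a - a \<in> (\<lambda>t. t - a) ` S" by (rule imageI)
      then show False using t(2) by (simp add: N_def)
    qed
    ultimately show ?thesis using S(2)[of "t + a"] t' ab l(1) by auto
  qed
  then have ae: "AE t in lebesgue. t \<in> ?I \<longrightarrow> kobayashi_metric X A (?\<tau> t) (velocity ?I ?\<tau> t) \<le> l"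
    by (intro AE_I'[OF null]) blast
  have lower': "inverse l * \<bar>s - t\<bar> - \<kappa> \<le> kobayashi_dist X A (?\<tau> s) (?\<tau> t)" if "s \<in> ?I" "t \<in> ?I" for s t
    using lower[of "s + a" "t + a"] that ab by simp
  have "?\<tau> ` ?I \<subseteq> topspace X" using cont unfolding continuous_map_def by auto
  then show ?thesis
    unfolding almost_geodesic_def using upper lower' ac ae by (auto simp: is_interval_cc)
qed

section \<open>Proper length spaces\<close>

context Metric_space
begin

definition approx_length_space :: bool where
  "approx_length_space \<longleftrightarrow> (\<forall>x\<in>M. \<forall>y\<in>M. \<forall>r \<epsilon>. 0 \<le> r \<longrightarrow> r \<le> d x y \<longrightarrow> 0 < \<epsilon> \<longrightarrow>
     (\<exists>z\<in>M. d x z \<le> r \<and> d z y < d x y - r + \<epsilon>))"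

lemma approx_length_spaceD:
  assumes "approx_length_space" "x \<in> M" "y \<in> M" "0 \<le> r" "r \<le> d x y" "0 < \<epsilon>"
  obtains z where "z \<in> M" "d x z \<le> r" "d z y < d x y - r + \<epsilon>"
  using assms unfolding approx_length_space_def by blast

text \<open>If this failed, points of \<open>K\<close> arbitrarily close to the complement of \<open>U\<close> would accumulate at a point of \<open>K\<close>.\<close>

lemma compact_uniform_neighbourhood:
  assumes K: "compactin mtopology K" and U: "openin mtopology U" and sub: "K \<subseteq> U"
  obtains \<delta> where "\<delta> > 0" "\<And>y. y \<in> K \<Longrightarrow> mball y \<delta> \<subseteq> U"
proof (rule ccontr)
  assume "\<not> thesis"
  then have "\<exists>y z. y \<in> K \<and> z \<in> mball y (1 / (real n + 1)) \<and> z \<notin> U" for n :: nat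
    using that[of "1 / (real n + 1)"] by fastforce
  then obtain y z where yz: "\<And>n. y n \<in> K" "\<And>n. z n \<in> mball (y n) (1 / (real n + 1))" "\<And>n. z n \<notin> U"
    by metis
  obtain l r where lr: "l \<in> K" "strict_mono (r :: nat \<Rightarrow> nat)" "limitin mtopology (y \<circ> r) l sequentially"
    using K yz(1) unfolding compactin_sequentially by (metis image_subsetI)
  obtain e where e: "e > 0" "mball l e \<subseteq> U" using U lr(1) sub unfolding openin_mtopology by blast
  have "eventually (\<lambda>n. y (r n) \<in> M \<and> d (y (r n)) l < e / 2) sequentially"
    using lr(3) e(1) unfolding limitin_metric by (auto elim: allE[of _ "e / 2"])
  moreover have "eventually (\<lambda>n. 1 / (real n + 1) < e / 2) sequentially"
    using e(1) by real_asymp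
  ultimately have "eventually (\<lambda>n. False) sequentially"
  proof eventually_elim
    case (elim n)
    have "n \<le> r n" using lr(2) by (rule seq_suble)
    then have "1 / (real (r n) + 1) \<le> 1 / (real n + 1)" by (simp add: frac_le)
    then have "d (y (r n)) (z (r n)) < e / 2" "z (r n) \<in> M" using yz(2)[of "r n"] elim by auto
    moreover have "l \<in> M" using lr(3) limitin_mspace by blast
    moreover have "y (r n) \<in> M" using elim by blast
    ultimately have "d l (z (r n)) < e"
      using triangle[of l "y (r n)" "z (r n)"] commute[of l "y (r n)"] elim by linarith
    then have "z (r n) \<in> mball l e" using \<open>l \<in> M\<close> \<open>z (r n) \<in> M\<close> by simp
    then show False using e(2) yz(3) by blast
  qed
  then show False by simp
qed

text \<open>This is the theorem of Hopf and Rinow.  If a ball were not compact, let \<open>R\<close> be the supremum of the radii of compact balls about \<open>x\<close>.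
  Up to an error that is as small as desired, points at distance \<open>R\<close> are close to a smaller ball, so
  the ball of radius \<open>R\<close> is totally bounded, hence compact; local compactness then gives a compact
  ball of a larger radius.\<close>

lemma hopf_rinow:
  assumes lc: "locally_compact_space mtopology" and complete: mcomplete
    and len: approx_length_space and x: "x \<in> M"
  shows "compactin mtopology (mcball x r)"
proof (rule ccontr)
  define P where "P r \<longleftrightarrow> compactin mtopology (mcball x r)" for r
  assume "\<not> compactin mtopology (mcball x r)"
  then have nP: "\<not> P r" by (simp add: P_def)
  have mono: "P s" if "P t" "s \<le> t" for s t
  proof -
    have "mcball x s \<subseteq> mcball x t" using that by auto
    then show ?thesis using that(1) closed_compactin closedin_mcball unfolding P_def by blast
  qed
  have P0: "P 0"
  proof -
    have "y = x" if "y \<in> M" "d x y \<le> 0" for y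
      using that x nonneg[of x y] by simp
    then have "mcball x 0 = {x}" using x by auto
    then show ?thesis using x by (simp add: P_def)
  qed
  define S where "S = {s. P s}"
  define R where "R = Sup S"
  have bdd: "bdd_above S" using nP mono by (auto simp: S_def bdd_above_def) (meson linear)
  have "S \<noteq> {}" using P0 by (auto simp: S_def)
  have upper: "s \<le> R" if "P s" for s using cSup_upper[OF _ bdd] that by (simp add: R_def S_def)
  have less: "P s" if sR: "s < R" for s
  proof -
    obtain t where "t \<in> S" "s < t" using less_cSupE[OF sR[unfolded R_def] \<open>S \<noteq> {}\<close>] .
    then show ?thesis using mono[of t s] by (simp add: S_def)
  qed
  have R0: "0 \<le> R" using upper P0 by blast
  have PR: "P R"
  proof (cases "R = 0")
    case False
    then have R: "R > 0" using R0 by simp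
    have "\<exists>K. finite K \<and> K \<subseteq> mcball x R \<and> mcball x R \<subseteq> (\<Union>k\<in>K. mball k \<epsilon>)" if \<epsilon>: "\<epsilon> > 0" for \<epsilon>
    proof -
      define s where "s = max 0 (R - \<epsilon> / 4)"
      have s: "0 \<le> s" "s < R" "R - s \<le> \<epsilon> / 4" using R \<epsilon> unfolding s_def by (simp_all add: max_def)
      have "mtotally_bounded (mcball x s)"
        using less[OF s(2)] compactin_imp_mtotally_bounded by (simp add: P_def)
      then obtain K where K: "finite K" "K \<subseteq> mcball x s" "mcball x s \<subseteq> (\<Union>k\<in>K. mball k (\<epsilon> / 2))"
        using \<epsilon> unfolding mtotally_bounded_def by (meson half_gt_zero)
      have "y \<in> (\<Union>k\<in>K. mball k \<epsilon>)" if y: "y \<in> mcball x R" for y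
      proof -
        have yM: "y \<in> M" "d x y \<le> R" using y by auto
        obtain z where z: "z \<in> mcball x s" "d z y \<le> \<epsilon> / 2"
        proof (cases "d x y \<le> s")
          case True
          then show thesis using that[of y] yM x \<epsilon> by simp
        next
          case False
          obtain z where "z \<in> M" "d x z \<le> s" "d z y < d x y - s + \<epsilon> / 4"
            by (rule approx_length_spaceD[OF len x yM(1) s(1), of "\<epsilon> / 4"]) (use False \<epsilon> in auto)
          then show thesis using that[of z] x yM s by auto
        qed
        then obtain k where k: "k \<in> K" "z \<in> mball k (\<epsilon> / 2)" using K(3) by blast
        then have "d k y \<le> d k z + d z y" using yM by (intro triangle) auto
        then have "y \<in> mball k \<epsilon>" using k z yM by auto
        then show ?thesis using k(1) by blast
      qed
      moreover have "K \<subseteq> mcball x R" using K(2) s(2) by force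
      ultimately show ?thesis using K(1) by blast
    qed
    then have "mtotally_bounded (mcball x R)" unfolding mtotally_bounded_def by blast
    then have "compactin mtopology (mtopology closure_of mcball x R)"
      using mtotally_bounded_eq_compact_closure_of[OF complete] by blast
    moreover have "mtopology closure_of mcball x R = mcball x R"
      using closedin_mcball closure_of_closedin by blast
    ultimately show ?thesis by (simp add: P_def)
  qed (use P0 in simp)
  obtain U L where UL: "openin mtopology U" "compactin mtopology L" "mcball x R \<subseteq> U" "U \<subseteq> L"
    using lc PR locally_compact_space_compact_closed_compact[of mtopology] Hausdorff_space_mtopology
    unfolding P_def by blast
  obtain \<delta> where \<delta>: "\<delta> > 0" "\<And>y. y \<in> mcball x R \<Longrightarrow> mball y \<delta> \<subseteq> U"
    using compact_uniform_neighbourhood[OF PR[unfolded P_def] UL(1,3)] by blast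
  have "mcball x (R + \<delta> / 3) \<subseteq> L"
  proof
    fix y assume y: "y \<in> mcball x (R + \<delta> / 3)"
    then have yM: "y \<in> M" "d x y \<le> R + \<delta> / 3" by auto
    show "y \<in> L"
    proof (cases "d x y \<le> R")
      case True
      then have "y \<in> mcball x R" using x yM by simp
      then show ?thesis using UL by blast
    next
      case False
      obtain z where z: "z \<in> M" "d x z \<le> R" "d z y < d x y - R + \<delta> / 3"
        by (rule approx_length_spaceD[OF len x yM(1) R0, of "\<delta> / 3"]) (use False \<delta>(1) in auto)
      then have "y \<in> mball z \<delta>" using yM \<delta>(1) by auto
      moreover have "z \<in> mcball x R" using z x by simp
      ultimately show ?thesis using \<delta>(2) UL by blast
    qed
  qed
  then have "P (R + \<delta> / 3)"
    unfolding P_def using UL(2) closed_compactin closedin_mcball by blast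
  then show False using upper[of "R + \<delta> / 3"] \<delta>(1) by simp
qed

section \<open>The metric compactification of a proper space\<close>

lemma continuous_dist: "x \<in> M \<Longrightarrow> continuous_map mtopology euclideanreal (d x)"
proof -
  assume x: "x \<in> M"
  have "continuous_map mtopology euclideanreal (\<lambda>y. mdist (metric (M, d)) x y)"
    by (rule continuous_map_mdist) (use x in auto)
  then show ?thesis by simp
qed

lemma restrict_dist_continuous:
  assumes "x \<in> M"
  shows "restrict (d x) M \<in> continuous_functions mtopology"
  unfolding continuous_functions_def using continuous_map_eq[OF continuous_dist[OF assms]] by auto

lemma const_class_eqD:
  assumes "g \<in> continuous_functions mtopology" "const_class mtopology g = const_class mtopology f"
    and "y \<in> M" "z \<in> M"
  shows "g y - g z = f y - f z"
proof -
  have "g \<in> const_class mtopology g" using assms(1) by (auto simp: const_class_def intro: exI[of _ 0])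
  then have "g \<in> const_class mtopology f" using assms(2) by simp
  then show ?thesis using assms(3,4) by (auto simp: const_class_def)
qed

text \<open>Classes of functions are compared after normalizing the functions to vanish at \<open>p\<close>.  When balls are
compact, these sets are open (lemma \<open>openin_class_nbhd\<close>), which is what makes sequences suffice in the
metric compactification.\<close>

definition class_nbhd :: "'a \<Rightarrow> ('a \<Rightarrow> real) \<Rightarrow> real \<Rightarrow> real \<Rightarrow> ('a \<Rightarrow> real) set set" where
  "class_nbhd p f R \<epsilon> = const_class mtopology `
     {g \<in> continuous_functions mtopology. \<forall>y\<in>mcball p R. \<bar>(g y - g p) - (f y - f p)\<bar> < \<epsilon>}"

lemma const_class_in_nbhd_iff:
  assumes "p \<in> M" "g \<in> continuous_functions mtopology"
  shows "const_class mtopology g \<in> class_nbhd p f R \<epsilon> \<longleftrightarrow>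
    (\<forall>y\<in>mcball p R. \<bar>(g y - g p) - (f y - f p)\<bar> < \<epsilon>)" (is "?l \<longleftrightarrow> ?r")
proof
  assume ?l
  then obtain h where h: "const_class mtopology g = const_class mtopology h"
    "\<forall>y\<in>mcball p R. \<bar>(h y - h p) - (f y - f p)\<bar> < \<epsilon>" unfolding class_nbhd_def by blast
  then show ?r using const_class_eqD[OF assms(2) h(1) _ assms(1)] by auto
next
  assume ?r
  then show ?l unfolding class_nbhd_def using assms(2) by blast
qed

lemma openin_class_nbhd:
  assumes p: "p \<in> M" and proper: "\<And>r. compactin mtopology (mcball p r)"
    and f: "f \<in> continuous_functions mtopology" and "R \<ge> 0"
  shows "openin (functions_mod_constants mtopology) (class_nbhd p f R \<epsilon>)"
  unfolding openin_functions_mod_constants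
proof
  let ?C = "continuous_functions mtopology"
  show "class_nbhd p f R \<epsilon> \<subseteq> const_class mtopology ` ?C" unfolding class_nbhd_def by blast
  let ?V = "{g \<in> ?C. const_class mtopology g \<in> class_nbhd p f R \<epsilon>}"
  have "\<exists>K e. compactin mtopology K \<and> e > 0 \<and> {h \<in> ?C. \<forall>x\<in>K. \<bar>h x - g x\<bar> < e} \<subseteq> ?V"
    if g: "g \<in> ?V" for g
  proof -
    have gC: "g \<in> ?C" and gn: "\<forall>y\<in>mcball p R. \<bar>(g y - g p) - (f y - f p)\<bar> < \<epsilon>"
      using g const_class_in_nbhd_iff[OF p] by auto
    have pb: "p \<in> mcball p R" using p \<open>R \<ge> 0\<close> by simp
    let ?D = "\<lambda>y. \<bar>(g y - g p) - (f y - f p)\<bar>"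
    have "continuous_map mtopology euclideanreal ?D"
      using gC f unfolding continuous_functions_def by (intro continuous_intros) auto
    from image_compactin[OF proper[of R] this] have "compact (?D ` mcball p R)" by simp
    moreover have "?D ` mcball p R \<noteq> {}" using pb by blast
    ultimately obtain m where m: "m \<in> ?D ` mcball p R" "\<forall>t\<in>?D ` mcball p R. t \<le> m"
      using compact_attains_sup[of "?D ` mcball p R"] by blast
    define e where "e = (\<epsilon> - m) / 2"
    have e: "e > 0" using m(1) gn by (auto simp: e_def)
    have "h \<in> ?V" if h: "h \<in> ?C" "\<forall>x\<in>mcball p R. \<bar>h x - g x\<bar> < e" for h
    proof -
      have "\<bar>(h y - h p) - (f y - f p)\<bar> < \<epsilon>" if y: "y \<in> mcball p R" for y
      proof -
        have "\<bar>h y - g y\<bar> < e" "\<bar>h p - g p\<bar> < e" "?D y \<le> m" using h y pb m(2) by auto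
        moreover have "2 * e = \<epsilon> - m" by (simp add: e_def)
        ultimately show ?thesis by linarith
      qed
      then show ?thesis using h(1) const_class_in_nbhd_iff[OF p] by blast
    qed
    then show ?thesis using proper[of R] e by (intro exI[of _ "mcball p R"] exI[of _ e]) auto
  qed
  then show "openin (locally_uniform_topology mtopology) ?V"
    unfolding openin_locally_uniform_topology by blast
qed

lemma topspace_functions_mod_constants:
  "topspace (functions_mod_constants mtopology) = const_class mtopology ` continuous_functions mtopology"
  using quotient_imp_surjective_map[OF quotient_map_const_class[of mtopology]] by simp

lemma metric_embedding_in_nbhd_iff:
  assumes "p \<in> M" "x \<in> M"
  shows "metric_embedding M d x \<in> class_nbhd p f R \<epsilon> \<longleftrightarrow>
    (\<forall>y\<in>mcball p R. \<bar>(d x y - d x p) - (f y - f p)\<bar> < \<epsilon>)"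
  unfolding metric_embedding_def
  using const_class_in_nbhd_iff[OF assms(1) restrict_dist_continuous[OF assms(2)]] assms(1) by auto

text \<open>Convergence of a sequence of points to the class of \<open>f\<close>; in a proper space, uniform convergence on
bounded sets is uniform convergence on compact sets.\<close>

definition horo_limit :: "'a \<Rightarrow> (nat \<Rightarrow> 'a) \<Rightarrow> ('a \<Rightarrow> real) \<Rightarrow> bool" where
  "horo_limit p x f \<longleftrightarrow> range x \<subseteq> M \<and>
     (\<forall>R. \<forall>\<epsilon>>0. \<forall>\<^sub>F n in sequentially. \<forall>y\<in>mcball p R. \<bar>(d (x n) y - d (x n) p) - (f y - f p)\<bar> < \<epsilon>)"

lemma horo_limit_subseq:
  assumes "horo_limit p x f" "strict_mono r"
  shows "horo_limit p (x \<circ> r) f"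
  unfolding horo_limit_def
proof (intro conjI allI impI)
  show "range (x \<circ> r) \<subseteq> M" using assms(1) unfolding horo_limit_def by auto
  fix R \<epsilon> :: real assume "\<epsilon> > 0"
  then have "\<forall>\<^sub>F n in sequentially. \<forall>y\<in>mcball p R. \<bar>(d (x n) y - d (x n) p) - (f y - f p)\<bar> < \<epsilon>"
    using assms(1) unfolding horo_limit_def by blast
  from eventually_subseq[OF assms(2) this]
  show "\<forall>\<^sub>F n in sequentially. \<forall>y\<in>mcball p R. \<bar>(d ((x \<circ> r) n) y - d ((x \<circ> r) n) p) - (f y - f p)\<bar> < \<epsilon>"
    by simp
qed

lemma closure_imp_horo_limit:
  assumes p: "p \<in> M" and proper: "\<And>r. compactin mtopology (mcball p r)"
    and f: "f \<in> continuous_functions mtopology"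
    and cl: "const_class mtopology f \<in> functions_mod_constants mtopology closure_of (metric_embedding M d ` M)"
  obtains x where "horo_limit p x f"
proof -
  have "\<exists>x\<in>M. metric_embedding M d x \<in> class_nbhd p f (real n) (1 / (real n + 1))" for n :: nat
  proof -
    have "const_class mtopology f \<in> class_nbhd p f (real n) (1 / (real n + 1))"
      unfolding const_class_in_nbhd_iff[OF p f] by simp
    moreover have "openin (functions_mod_constants mtopology) (class_nbhd p f (real n) (1 / (real n + 1)))"
      by (rule openin_class_nbhd[OF p proper f]) simp
    ultimately have "\<exists>c. c \<in> metric_embedding M d ` M \<and> c \<in> class_nbhd p f (real n) (1 / (real n + 1))"
      using cl unfolding in_closure_of by blast
    then show ?thesis by blast
  qed
  then obtain x where x: "\<And>n. x n \<in> M"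
    "\<And>n y. y \<in> mcball p (real n) \<Longrightarrow> \<bar>(d (x n) y - d (x n) p) - (f y - f p)\<bar> < 1 / (real n + 1)"
    using metric_embedding_in_nbhd_iff[OF p] by metis
  have "\<forall>\<^sub>F n in sequentially. \<forall>y\<in>mcball p R. \<bar>(d (x n) y - d (x n) p) - (f y - f p)\<bar> < \<epsilon>"
    if "\<epsilon> > 0" for R \<epsilon>
  proof -
    have "eventually (\<lambda>n. 1 / (real n + 1) < \<epsilon>) sequentially" using that by real_asymp
    moreover have "eventually (\<lambda>n. R \<le> real n) sequentially" by real_asymp
    ultimately show ?thesis
    proof eventually_elim
      case (elim n)
      show ?case
      proof
        fix y assume "y \<in> mcball p R"
        then have "y \<in> mcball p (real n)" using elim by auto
        from x(2)[OF this] show "\<bar>(d (x n) y - d (x n) p) - (f y - f p)\<bar> < \<epsilon>" using elim by linarith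
      qed
    qed
  qed
  then show thesis using that x(1) unfolding horo_limit_def by blast
qed

end

section \<open>Sequences that represent a horofunction\<close>

lemma limitin_filterlim:
  assumes "limitin X f l F" "filterlim g F G"
  shows "limitin X (f \<circ> g) l G"
  unfolding limitin_def
proof (intro conjI allI impI)
  show "l \<in> topspace X" by (rule limitin_topspace[OF assms(1)])
  fix U assume "openin X U \<and> l \<in> U"
  then have "\<forall>\<^sub>F x in F. f x \<in> U" using assms(1) unfolding limitin_def by simp
  from eventually_compose_filterlim[OF this assms(2)]
  show "\<forall>\<^sub>F x in G. (f \<circ> g) x \<in> U" by simp
qed

context Metric_space
begin

text \<open>For a sequence \<open>x\<close> tending to infinity and converging to \<open>f\<close>, take a point at distance
  about \<open>k\<close> from \<open>p\<close> on an almost shortest path from \<open>p\<close> to \<open>x n\<close>; there \<open>f - f p\<close> is about \<open>- k\<close>.\<close>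

lemma horo_limit_descent:
  assumes len: approx_length_space and p: "p \<in> M"
    and x: "horo_limit p x f" and inf: "\<And>n. real n \<le> d p (x n)"
  obtains w where "w \<in> M" "real k - 1 \<le> d p w" "f w - f p \<le> 2 - real k"
proof -
  have xM: "x n \<in> M" for n using x unfolding horo_limit_def by blast
  have "\<forall>\<^sub>F n in sequentially. \<forall>y\<in>mcball p (real k). \<bar>(d (x n) y - d (x n) p) - (f y - f p)\<bar> < 1"
    using x unfolding horo_limit_def by simp
  then have "\<forall>\<^sub>F n in sequentially. (\<forall>y\<in>mcball p (real k). \<bar>(d (x n) y - d (x n) p) - (f y - f p)\<bar> < 1) \<and> k \<le> n"
    using eventually_ge_at_top by (rule eventually_conj)
  then obtain n where n: "\<And>y. y \<in> mcball p (real k) \<Longrightarrow> \<bar>(d (x n) y - d (x n) p) - (f y - f p)\<bar> < 1" "k \<le> n"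
    using eventually_happens'[OF sequentially_bot] by blast
  have "real k \<le> d p (x n)" using inf[of n] n(2) by linarith
  then obtain w where w: "w \<in> M" "d p w \<le> real k" "d w (x n) < d p (x n) - real k + 1"
    using approx_length_spaceD[OF len p xM[of n] of_nat_0_le_iff _ zero_less_one] by blast
  have "d p (x n) \<le> d p w + d w (x n)" using p w xM by (intro triangle) auto
  then have "real k - 1 \<le> d p w" using w by linarith
  moreover have "f w - f p \<le> 2 - real k"
  proof -
    have "w \<in> mcball p (real k)" using w(1,2) p by simp
    then show ?thesis using n(1)[of w] w(3) commute[of "x n" w] commute[of "x n" p] by linarith
  qed
  ultimately show thesis using that w(1) by blast
qed

text \<open>By the triangle inequality \<open>d (x n)\<close> tends uniformly to \<open>d b\<close>, so \<open>f\<close> represents the point \<open>b\<close> of \<open>M\<close>.\<close>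

lemma horo_limit_convergent:
  assumes p: "p \<in> M" and x: "horo_limit p x f" and lim: "limitin mtopology x b sequentially"
    and z: "z \<in> M"
  shows "f z - f p = d b z - d b p"
proof -
  have bM: "b \<in> M" using lim limitin_mspace by blast
  have xM: "x n \<in> M" for n using x unfolding horo_limit_def by blast
  have "\<bar>(d b z - d b p) - (f z - f p)\<bar> < 3 * \<epsilon>" if \<epsilon>: "\<epsilon> > 0" for \<epsilon>
  proof -
    have "\<forall>\<^sub>F n in sequentially. \<forall>y\<in>mcball p (d p z). \<bar>(d (x n) y - d (x n) p) - (f y - f p)\<bar> < \<epsilon>"
      using x \<epsilon> unfolding horo_limit_def by blast
    moreover have "\<forall>\<^sub>F n in sequentially. x n \<in> M \<and> d (x n) b < \<epsilon>"
      using lim \<epsilon> unfolding limitin_metric by blast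
    ultimately have "\<forall>\<^sub>F n in sequentially. \<bar>(d b z - d b p) - (f z - f p)\<bar> < 3 * \<epsilon>"
    proof eventually_elim
      case (elim n)
      have "z \<in> mcball p (d p z)" using p z by simp
      then have "\<bar>(d (x n) z - d (x n) p) - (f z - f p)\<bar> < \<epsilon>" using elim by blast
      moreover have "\<bar>d (x n) z - d b z\<bar> < \<epsilon>" "\<bar>d (x n) p - d b p\<bar> < \<epsilon>"
        using elim triangle[OF xM[of n] bM z] triangle[OF bM xM[of n] z] triangle[OF xM[of n] bM p]
          triangle[OF bM xM[of n] p] commute[of b "x n"] by linarith+
      ultimately show ?case by linarith
    qed
    then show ?thesis using eventually_happens'[OF sequentially_bot] by blast
  qed
  note bound = this
  show ?thesis
  proof (rule ccontr)
    assume "f z - f p \<noteq> d b z - d b p"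
    then show False using bound[of "\<bar>(d b z - d b p) - (f z - f p)\<bar> / 3"] by simp
  qed
qed

lemma sequence_dichotomy:
  assumes p: "p \<in> M" and proper: "\<And>r. compactin mtopology (mcball p r)" and x: "range x \<subseteq> M"
  obtains (infinity) r where "strict_mono (r :: nat \<Rightarrow> nat)" "\<And>n. real n \<le> d p (x (r n))"
  | (convergent) r b where "strict_mono (r :: nat \<Rightarrow> nat)" "limitin mtopology (x \<circ> r) b sequentially"
proof (cases "\<forall>R. \<forall>N. \<exists>n\<ge>N. R \<le> d p (x n)")
  case True
  define r where "r = rec_nat (SOME n. 0 \<le> d p (x n)) (\<lambda>k m. SOME n. Suc m \<le> n \<and> real (Suc k) \<le> d p (x n))"
  have step: "Suc (r k) \<le> r (Suc k) \<and> real (Suc k) \<le> d p (x (r (Suc k)))" for k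
  proof -
    have "\<exists>n. Suc (r k) \<le> n \<and> real (Suc k) \<le> d p (x n)" using True by blast
    from someI_ex[OF this] show ?thesis by (simp add: r_def)
  qed
  have "strict_mono r" using step by (simp add: strict_mono_Suc_iff Suc_le_eq)
  moreover have "real n \<le> d p (x (r n))" for n
    using step[of "n - 1"] by (cases n) auto
  ultimately show thesis by (rule infinity)
next
  case False
  then obtain R N where RN: "\<And>n. n \<ge> N \<Longrightarrow> d p (x n) < R" by (meson not_le)
  have "x (n + N) \<in> mcball p R" for n
    using RN[of "n + N"] p range_subsetD[OF x, of "n + N"] by simp
  then have "range (\<lambda>n. x (n + N)) \<subseteq> mcball p R" by blast
  then obtain l r where lr: "strict_mono (r :: nat \<Rightarrow> nat)" "limitin mtopology ((\<lambda>n. x (n + N)) \<circ> r) l sequentially"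
    using proper[of R] unfolding compactin_sequentially by metis
  have "strict_mono (\<lambda>n. r n + N)" using lr(1) by (simp add: strict_mono_def)
  moreover have "(\<lambda>n. x (n + N)) \<circ> r = x \<circ> (\<lambda>n. r n + N)" by (simp add: o_def)
  ultimately show thesis using convergent lr(2) by metis
qed

end

section \<open>Extension of maps to the metric compactification\<close>

text \<open>The conditions under which the argument with horofunctions works.  No separation axiom is imposed on \<open>Z\<close>
itself: limits of sequences of image points are unique, and \<open>separated\<close> stands in for regularity,
with \<open>V0\<close> in the place of a neighbourhood of \<open>a\<close> whose closure lies in \<open>V\<close>.  In \<open>gromov\<close>, the factor \<open>1/2\<close>
of the usual Gromov product is left out.\<close>

locale boundary_map = Metric_space M d for M :: "'a set" and d +
  fixes p :: 'a and Z :: "'z topology" and G :: "'a \<Rightarrow> 'z"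
  assumes p: "p \<in> M"
    and proper: "\<And>r. compactin mtopology (mcball p r)"
    and len: approx_length_space
    and cont: "continuous_map mtopology Z G"
    and seq_compact: "sequentially_compact_space Z"
    and unique: "\<And>x a b. range x \<subseteq> M \<Longrightarrow> limitin Z (G \<circ> x) a sequentially \<Longrightarrow>
      limitin Z (G \<circ> x) b sequentially \<Longrightarrow> a = b"
    and separated: "\<And>a V. openin Z V \<Longrightarrow> a \<in> V \<Longrightarrow> \<exists>V0.
      (\<forall>x. range x \<subseteq> M \<longrightarrow> limitin Z (G \<circ> x) a sequentially \<longrightarrow> (\<forall>\<^sub>F n in sequentially. G (x n) \<in> V0)) \<and>
      (\<forall>x b. range x \<subseteq> M \<longrightarrow> limitin Z (G \<circ> x) b sequentially \<longrightarrow> b \<notin> V \<longrightarrow>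
        (\<forall>\<^sub>F n in sequentially. G (x n) \<notin> V0))"
    and gromov: "\<And>x y a b. range x \<subseteq> M \<Longrightarrow> range y \<subseteq> M \<Longrightarrow>
      (\<And>n. real n \<le> d p (x n) + d p (y n) - d (x n) (y n)) \<Longrightarrow>
      limitin Z (G \<circ> x) a sequentially \<Longrightarrow> limitin Z (G \<circ> y) b sequentially \<Longrightarrow> a = b"
begin

lemma convergent_subsequence:
  assumes "range x \<subseteq> M"
  obtains r a where "strict_mono (r :: nat \<Rightarrow> nat)" "limitin Z (G \<circ> x \<circ> r) a sequentially"
proof -
  have "range (G \<circ> x) \<subseteq> topspace Z"
    using assms continuous_map_image_subset_topspace[OF cont] by auto
  then show thesis using seq_compact that unfolding sequentially_compact_space_def by metis
qed

text \<open>For fixed \<open>k\<close>, the Gromov product of \<open>x n\<close> and \<open>w k\<close> tends to \<open>d p (w k) - (f (w k) - f p)\<close>.  So for each \<open>k\<close> there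
is a late \<open>n\<close> for which it is at least \<open>k\<close>, and \<open>x\<close> can be reindexed to meet the hypothesis of \<open>gromov\<close>.\<close>

lemma limit_along_descent:
  assumes x: "horo_limit p x f" and w: "range w \<subseteq> M"
    and desc: "\<And>k. real k + 1 \<le> d p (w k) - (f (w k) - f p)"
    and lx: "limitin Z (G \<circ> x) a sequentially" and lw: "limitin Z (G \<circ> w) b sequentially"
  shows "a = b"
proof -
  have xM: "range x \<subseteq> M" using x unfolding horo_limit_def by blast
  have "\<exists>n\<ge>k. real k \<le> d p (x n) + d p (w k) - d (x n) (w k)" for k
  proof -
    have "\<forall>\<^sub>F n in sequentially. \<forall>y\<in>mcball p (d p (w k)). \<bar>(d (x n) y - d (x n) p) - (f y - f p)\<bar> < 1"
      using x unfolding horo_limit_def by simp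
    then have "\<forall>\<^sub>F n in sequentially. (\<forall>y\<in>mcball p (d p (w k)). \<bar>(d (x n) y - d (x n) p) - (f y - f p)\<bar> < 1) \<and> k \<le> n"
      using eventually_ge_at_top by (rule eventually_conj)
    then obtain n where n: "\<forall>y\<in>mcball p (d p (w k)). \<bar>(d (x n) y - d (x n) p) - (f y - f p)\<bar> < 1" "k \<le> n"
      using eventually_happens'[OF sequentially_bot] by blast
    have "w k \<in> mcball p (d p (w k))" using w p by auto
    then have "\<bar>(d (x n) (w k) - d (x n) p) - (f (w k) - f p)\<bar> < 1" using n by blast
    then show ?thesis using desc[of k] n(2) commute[of p "x n"] by (intro exI[of _ n]) auto
  qed
  then obtain n where n: "\<And>k. k \<le> n k" "\<And>k. real k \<le> d p (x (n k)) + d p (w k) - d (x (n k)) (w k)"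
    by metis
  have "filterlim n sequentially sequentially"
    using n(1) by (intro filterlim_at_top_mono[OF filterlim_ident]) auto
  from limitin_filterlim[OF lx this] have lim: "limitin Z (G \<circ> (x \<circ> n)) a sequentially"
    by (simp only: o_assoc)
  have "range (x \<circ> n) \<subseteq> M" using xM by auto
  then show ?thesis by (rule gromov[OF _ w _ lim lw]) (simp only: o_apply n(2))
qed

lemma horo_limit_descending_sequence:
  assumes x: "horo_limit p x f" and inf: "\<And>n. real n \<le> d p (x n)"
  obtains w where "range w \<subseteq> M" "\<And>k. real k + 1 \<le> d p (w k) - (f (w k) - f p)"
proof -
  have "\<exists>w\<in>M. real k + 3 \<le> d p w \<and> f w - f p \<le> - 2 - real k" for k
  proof -
    obtain w where "w \<in> M" "real (k + 4) - 1 \<le> d p w" "f w - f p \<le> 2 - real (k + 4)"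
      using horo_limit_descent[OF len p x inf, of "k + 4"] .
    then show ?thesis by (intro bexI[of _ w]) auto
  qed
  then obtain w where w: "\<And>k. w k \<in> M" "\<And>k. real k + 3 \<le> d p (w k)" "\<And>k. f (w k) - f p \<le> - 2 - real k"
    by metis
  show thesis
  proof (rule that[of w])
    show "range w \<subseteq> M" using w(1) by blast
    show "real k + 1 \<le> d p (w k) - (f (w k) - f p)" for k using w(2,3)[of k] by linarith
  qed
qed

text \<open>If one of the sequences is unbounded, it provides a descending sequence for \<open>f\<close>, with which both
sequences are compared; the other one may be bounded or not.  If both are bounded, they have limit points in
\<open>M\<close>, which are equal because \<open>f\<close> is the distance from either of them up to a constant.\<close>

lemma horo_limit_image_unique:
  assumes x: "horo_limit p x f" and y: "horo_limit p y f"
    and lx: "limitin Z (G \<circ> x) a sequentially" and ly: "limitin Z (G \<circ> y) b sequentially"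
  shows "a = b"
proof -
  have infinity_case: "a = b"
    if x: "horo_limit p x f" and y: "horo_limit p y f"
      and lx: "limitin Z (G \<circ> x) a sequentially" and ly: "limitin Z (G \<circ> y) b sequentially"
      and inf: "\<And>n. real n \<le> d p (x n)" for x y a b
  proof -
    obtain w where w: "range w \<subseteq> M" "\<And>k. real k + 1 \<le> d p (w k) - (f (w k) - f p)"
      using horo_limit_descending_sequence[OF x inf] by blast
    obtain r c where r: "strict_mono r" "limitin Z (G \<circ> w \<circ> r) c sequentially"
      using convergent_subsequence[OF w(1)] .
    have desc: "real k + 1 \<le> d p ((w \<circ> r) k) - (f ((w \<circ> r) k) - f p)" for k
      using w(2)[of "r k"] seq_suble[OF r(1), of k] by simp
    have wr: "range (w \<circ> r) \<subseteq> M" using w(1) by auto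
    have lim: "limitin Z (G \<circ> (w \<circ> r)) c sequentially" using r(2) by (simp add: o_assoc)
    show "a = b"
      using limit_along_descent[OF x wr desc lx lim] limit_along_descent[OF y wr desc ly lim] by simp
  qed
  have xM: "range x \<subseteq> M" and yM: "range y \<subseteq> M" using x y unfolding horo_limit_def by auto
  show ?thesis
  proof (rule sequence_dichotomy[OF p proper xM])
    fix r assume r: "strict_mono r" "\<And>n. real n \<le> d p (x (r n))"
    show "a = b"
      by (rule infinity_case[OF horo_limit_subseq[OF x r(1)] y _ ly])
        (simp_all only: o_assoc limitin_subsequence[OF r(1) lx], simp only: o_apply r(2))
  next
    fix r c assume r: "strict_mono r" "limitin mtopology (x \<circ> r) c sequentially"
    show "a = b"
    proof (rule sequence_dichotomy[OF p proper yM])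
      fix s assume s: "strict_mono s" "\<And>n. real n \<le> d p (y (s n))"
      show "a = b"
        by (rule infinity_case[OF horo_limit_subseq[OF y s(1)] x _ lx, symmetric])
          (simp_all only: o_assoc limitin_subsequence[OF s(1) ly], simp only: o_apply s(2))
    next
      fix s e assume s: "strict_mono s" "limitin mtopology (y \<circ> s) e sequentially"
      have cM: "c \<in> M" and eM: "e \<in> M" using r(2) s(2) limitin_mspace by blast+
      note c = horo_limit_convergent[OF p horo_limit_subseq[OF x r(1)] r(2)]
      note e = horo_limit_convergent[OF p horo_limit_subseq[OF y s(1)] s(2)]
      have "d c c - d c p = d e c - d e p" "d c e - d c p = d e e - d e p"
        using c[OF cM] e[OF cM] c[OF eM] e[OF eM] by simp_all
      moreover have "d c c = 0" "d e e = 0" using cM eM by simp_all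
      ultimately have "d c e = 0" using commute[of c e] by linarith
      then have "c = e" using cM eM by simp
      have "limitin Z (G \<circ> (x \<circ> r)) (G c) sequentially" "limitin Z (G \<circ> (y \<circ> s)) (G e) sequentially"
        using continuous_map_limit[OF cont] r(2) s(2) by blast+
      moreover have "limitin Z (G \<circ> (x \<circ> r)) a sequentially" "limitin Z (G \<circ> (y \<circ> s)) b sequentially"
        using limitin_subsequence[OF r(1) lx] limitin_subsequence[OF s(1) ly] by (simp_all add: o_assoc)
      moreover have "range (x \<circ> r) \<subseteq> M" "range (y \<circ> s) \<subseteq> M" using xM yM by auto
      ultimately have "a = G c" "b = G e" using unique by blast+
      then show "a = b" using \<open>c = e\<close> by simp
    qed
  qed
qed

lemma horo_limit_image_exists:
  assumes x0: "horo_limit p x0 f"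
  shows "\<exists>a. \<forall>x. horo_limit p x f \<longrightarrow> limitin Z (G \<circ> x) a sequentially"
proof -
  have "range x0 \<subseteq> M" using x0 unfolding horo_limit_def by blast
  then obtain r0 a where r0: "strict_mono r0" "limitin Z (G \<circ> x0 \<circ> r0) a sequentially"
    by (rule convergent_subsequence)
  have "limitin Z (G \<circ> x) a sequentially" if x: "horo_limit p x f" for x
    unfolding limitin_def
  proof (intro conjI allI impI)
    show "a \<in> topspace Z" by (rule limitin_topspace[OF r0(2)])
    fix V assume V: "openin Z V \<and> a \<in> V"
    show "\<forall>\<^sub>F n in sequentially. (G \<circ> x) n \<in> V"
    proof (rule ccontr)
      assume "\<not> (\<forall>\<^sub>F n in sequentially. (G \<circ> x) n \<in> V)"
      from not_eventually_sequentiallyD[OF this]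
      obtain r :: "nat \<Rightarrow> nat" where r: "strict_mono r" "\<And>n. (G \<circ> x) (r n) \<notin> V" by auto
      have xr: "horo_limit p (x \<circ> r) f" by (rule horo_limit_subseq[OF x r(1)])
      then have "range (x \<circ> r) \<subseteq> M" unfolding horo_limit_def by blast
      then obtain s b where s: "strict_mono s" "limitin Z (G \<circ> (x \<circ> r) \<circ> s) b sequentially"
        by (rule convergent_subsequence)
      have "a = b"
        by (rule horo_limit_image_unique[OF horo_limit_subseq[OF x0 r0(1)] horo_limit_subseq[OF xr s(1)]])
          (use r0(2) s(2) in \<open>simp_all add: o_assoc\<close>)
      then have "\<forall>\<^sub>F n in sequentially. (G \<circ> (x \<circ> r) \<circ> s) n \<in> V"
        using s(2) V unfolding limitin_def by simp
      then show False using r(2) by simp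
    qed
  qed
  then show ?thesis by blast
qed

abbreviation closure_classes :: "('a \<Rightarrow> real) set set" where
  "closure_classes \<equiv> functions_mod_constants mtopology closure_of (metric_embedding M d ` M)"

lemma closure_class_rep:
  assumes "c \<in> closure_classes"
  obtains f where "f \<in> continuous_functions mtopology" "c = const_class mtopology f"
proof -
  have "c \<in> topspace (functions_mod_constants mtopology)"
    using assms closure_of_subset_topspace by (rule subsetD[rotated])
  then show thesis using that unfolding topspace_functions_mod_constants by blast
qed

text \<open>All representatives \<open>f\<close> of the class \<open>c\<close> occur in the definition, so that no representative has to be chosen.\<close>

definition boundary_ext :: "('a \<Rightarrow> real) set \<Rightarrow> 'z" where
  "boundary_ext c = (SOME a. \<forall>f x. f \<in> continuous_functions mtopology \<longrightarrow> c = const_class mtopology f \<longrightarrow>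
     horo_limit p x f \<longrightarrow> limitin Z (G \<circ> x) a sequentially)"

lemma horo_limit_cong:
  assumes "horo_limit p x f" "\<And>y. y \<in> M \<Longrightarrow> f y - f p = g y - g p"
  shows "horo_limit p x g"
proof -
  have "(\<forall>y\<in>mcball p R. \<bar>(d z y - d z p) - (f y - f p)\<bar> < \<epsilon>) \<longleftrightarrow>
      (\<forall>y\<in>mcball p R. \<bar>(d z y - d z p) - (g y - g p)\<bar> < \<epsilon>)" for z R \<epsilon>
    using assms(2) by (intro ball_cong refl) simp
  then show ?thesis using assms(1) unfolding horo_limit_def by simp
qed

lemma boundary_ext_limit:
  assumes c: "const_class mtopology f \<in> closure_classes" and f: "f \<in> continuous_functions mtopology"
    and x: "horo_limit p x f"
  shows "limitin Z (G \<circ> x) (boundary_ext (const_class mtopology f)) sequentially"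
proof -
  obtain a where a: "\<And>x. horo_limit p x f \<Longrightarrow> limitin Z (G \<circ> x) a sequentially"
    using horo_limit_image_exists[OF x] by blast
  have "\<exists>a. \<forall>g x. g \<in> continuous_functions mtopology \<longrightarrow> const_class mtopology f = const_class mtopology g \<longrightarrow>
     horo_limit p x g \<longrightarrow> limitin Z (G \<circ> x) a sequentially"
  proof (intro exI[of _ a] allI impI)
    fix g x assume g: "g \<in> continuous_functions mtopology" "const_class mtopology f = const_class mtopology g"
      "horo_limit p x g"
    have "horo_limit p x f"
      by (rule horo_limit_cong[OF g(3)]) (use const_class_eqD[OF f g(2) _ p] in simp)
    then show "limitin Z (G \<circ> x) a sequentially" by (rule a)
  qed
  from someI_ex[OF this, folded boundary_ext_def] show ?thesis using f x by simp
qed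

lemma boundary_ext_embedding:
  assumes y: "y \<in> M"
  shows "boundary_ext (metric_embedding M d y) = G y"
proof -
  let ?f = "restrict (d y) M"
  have cl: "const_class mtopology ?f \<in> closure_classes"
  proof -
    have "metric_embedding M d ` M \<subseteq> topspace (functions_mod_constants mtopology)"
      unfolding topspace_functions_mod_constants metric_embedding_def using restrict_dist_continuous by blast
    from closure_of_subset[OF this] show ?thesis using y unfolding metric_embedding_def by blast
  qed
  have "horo_limit p (\<lambda>_. y) ?f" using y p unfolding horo_limit_def by auto
  from boundary_ext_limit[OF cl restrict_dist_continuous[OF y] this]
  have "limitin Z (G \<circ> (\<lambda>_. y)) (boundary_ext (metric_embedding M d y)) sequentially"
    by (simp add: metric_embedding_def)
  moreover have "G y \<in> topspace Z" using y continuous_map_image_subset_topspace[OF cont] by auto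
  then have "limitin Z (G \<circ> (\<lambda>_. y)) (G y) sequentially" by (simp add: limitin_def)
  ultimately show ?thesis using unique[of "\<lambda>_. y"] y by auto
qed

text \<open>Otherwise there are classes arbitrarily close to that of \<open>f\<close> whose images avoid \<open>V\<close>.  Each is
approximated by points of \<open>M\<close> whose images avoid \<open>V0\<close>.  A diagonal sequence of such points converges to
the class of \<open>f\<close>, so its images must eventually lie in \<open>V0\<close>.\<close>

lemma boundary_ext_neighbourhood:
  assumes f: "f \<in> continuous_functions mtopology" and c: "const_class mtopology f \<in> closure_classes"
    and V: "openin Z V" "boundary_ext (const_class mtopology f) \<in> V"
  obtains n :: nat where "\<And>c'. c' \<in> closure_classes \<Longrightarrow>
    c' \<in> class_nbhd p f (real n) (1 / (real n + 1)) \<Longrightarrow> boundary_ext c' \<in> V"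
proof (rule ccontr)
  assume not: "\<not> thesis"
  note nbhd = that
  obtain V0 where V0: "\<And>x. range x \<subseteq> M \<Longrightarrow>
        limitin Z (G \<circ> x) (boundary_ext (const_class mtopology f)) sequentially \<Longrightarrow>
        \<forall>\<^sub>F n in sequentially. G (x n) \<in> V0"
      "\<And>x b. range x \<subseteq> M \<Longrightarrow> limitin Z (G \<circ> x) b sequentially \<Longrightarrow> b \<notin> V \<Longrightarrow>
        \<forall>\<^sub>F n in sequentially. G (x n) \<notin> V0"
    using separated[OF V] by blast
  have "\<exists>y\<in>M. G y \<notin> V0 \<and> (\<forall>z\<in>mcball p (real n). \<bar>(d y z - d y p) - (f z - f p)\<bar> < 2 / (real n + 1))" for n
  proof -
    obtain c' where c': "c' \<in> closure_classes" "c' \<in> class_nbhd p f (real n) (1 / (real n + 1))"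
      "boundary_ext c' \<notin> V" using not nbhd[of n] by blast
    obtain g where g: "g \<in> continuous_functions mtopology" "c' = const_class mtopology g"
      using closure_class_rep[OF c'(1)] .
    have gf: "\<forall>z\<in>mcball p (real n). \<bar>(g z - g p) - (f z - f p)\<bar> < 1 / (real n + 1)"
      using c'(2) unfolding g(2) const_class_in_nbhd_iff[OF p g(1)] .
    obtain x where x: "horo_limit p x g"
      using closure_imp_horo_limit[OF p proper g(1) c'(1)[unfolded g(2)]] .
    have xM: "range x \<subseteq> M" using x unfolding horo_limit_def by blast
    have "\<forall>\<^sub>F k in sequentially. G (x k) \<notin> V0"
      by (rule V0(2)[OF xM boundary_ext_limit[OF c'(1)[unfolded g(2)] g(1) x] c'(3)[unfolded g(2)]])
    moreover have "\<forall>\<^sub>F k in sequentially. \<forall>z\<in>mcball p (real n).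
        \<bar>(d (x k) z - d (x k) p) - (g z - g p)\<bar> < 1 / (real n + 1)"
      using x unfolding horo_limit_def by simp
    ultimately have "\<forall>\<^sub>F k in sequentially. G (x k) \<notin> V0 \<and> (\<forall>z\<in>mcball p (real n).
        \<bar>(d (x k) z - d (x k) p) - (g z - g p)\<bar> < 1 / (real n + 1))" by (rule eventually_conj)
    then obtain k where k: "G (x k) \<notin> V0" "\<forall>z\<in>mcball p (real n).
        \<bar>(d (x k) z - d (x k) p) - (g z - g p)\<bar> < 1 / (real n + 1)"
      using eventually_happens'[OF sequentially_bot] by blast
    have "\<bar>(d (x k) z - d (x k) p) - (f z - f p)\<bar> < 2 / (real n + 1)" if z: "z \<in> mcball p (real n)" for z
    proof -
      have "\<bar>(d (x k) z - d (x k) p) - (g z - g p)\<bar> < 1 / (real n + 1)"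
        "\<bar>(g z - g p) - (f z - f p)\<bar> < 1 / (real n + 1)" using k(2) gf z by blast+
      moreover have "2 / (real n + 1) = 1 / (real n + 1) + 1 / (real n + 1)" by (simp add: add_divide_distrib[symmetric])
      ultimately show ?thesis by linarith
    qed
    then show ?thesis using k(1) xM by (intro bexI[of _ "x k"]) auto
  qed
  then obtain y where y: "\<And>n. y n \<in> M" "\<And>n. G (y n) \<notin> V0"
    "\<And>n z. z \<in> mcball p (real n) \<Longrightarrow> \<bar>(d (y n) z - d (y n) p) - (f z - f p)\<bar> < 2 / (real n + 1)"
    by metis
  have "horo_limit p y f"
    unfolding horo_limit_def
  proof (intro conjI allI impI)
    show "range y \<subseteq> M" using y(1) by blast
    fix R \<epsilon> :: real assume "\<epsilon> > 0"
    then have "\<forall>\<^sub>F n in sequentially. 2 / (real n + 1) < \<epsilon>" by real_asymp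
    moreover have "\<forall>\<^sub>F n in sequentially. R \<le> real n" by real_asymp
    ultimately show "\<forall>\<^sub>F n in sequentially. \<forall>z\<in>mcball p R. \<bar>(d (y n) z - d (y n) p) - (f z - f p)\<bar> < \<epsilon>"
    proof eventually_elim
      case (elim n)
      show ?case
      proof
        fix z assume "z \<in> mcball p R"
        then have "z \<in> mcball p (real n)" using elim by auto
        from y(3)[OF this] show "\<bar>(d (y n) z - d (y n) p) - (f z - f p)\<bar> < \<epsilon>" using elim by linarith
      qed
    qed
  qed
  from boundary_ext_limit[OF c f this] have "\<forall>\<^sub>F n in sequentially. G (y n) \<in> V0"
    by (rule V0(1)[rotated]) (use y(1) in blast)
  then have "\<exists>n. G (y n) \<in> V0" using eventually_happens'[OF sequentially_bot] by blast
  then show False using y(2) by blast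
qed

lemma boundary_ext_continuous:
  "continuous_map (metric_compactification M d) Z boundary_ext"
proof -
  let ?C = "functions_mod_constants mtopology"
  have "closure_classes \<subseteq> topspace ?C" by (rule closure_of_subset_topspace)
  then have top: "topspace (subtopology ?C closure_classes) = closure_classes"
    unfolding topspace_subtopology by (rule inf.absorb2)
  have "continuous_map (subtopology ?C closure_classes) Z boundary_ext"
    unfolding continuous_map_def top
  proof (intro conjI allI impI)
    show "boundary_ext \<in> closure_classes \<rightarrow> topspace Z"
    proof
      fix c assume c: "c \<in> closure_classes"
      obtain f where f: "f \<in> continuous_functions mtopology" "c = const_class mtopology f"
        using closure_class_rep[OF c] .
      obtain x where x: "horo_limit p x f"
        using closure_imp_horo_limit[OF p proper f(1) c[unfolded f(2)]] .
      show "boundary_ext c \<in> topspace Z"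
        unfolding f(2) by (rule limitin_topspace[OF boundary_ext_limit[OF c[unfolded f(2)] f(1) x]])
    qed
    fix V assume V: "openin Z V"
    show "openin (subtopology ?C closure_classes) {c \<in> closure_classes. boundary_ext c \<in> V}"
    proof (subst openin_subopen, intro ballI)
      fix c assume "c \<in> {c \<in> closure_classes. boundary_ext c \<in> V}"
      then have c: "c \<in> closure_classes" "boundary_ext c \<in> V" by simp_all
      obtain f where f: "f \<in> continuous_functions mtopology" "c = const_class mtopology f"
        using closure_class_rep[OF c(1)] .
      obtain n :: nat where n: "\<And>c'. c' \<in> closure_classes \<Longrightarrow>
          c' \<in> class_nbhd p f (real n) (1 / (real n + 1)) \<Longrightarrow> boundary_ext c' \<in> V"
        by (rule boundary_ext_neighbourhood[OF f(1) c(1)[unfolded f(2)] V c(2)[unfolded f(2)]]) (rule that)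
      let ?N = "class_nbhd p f (real n) (1 / (real n + 1))"
      have "openin ?C ?N" by (rule openin_class_nbhd[OF p proper f(1)]) simp
      then have "openin (subtopology ?C closure_classes) (closure_classes \<inter> ?N)"
        by (rule openin_subtopology_Int2)
      moreover have "c \<in> ?N" unfolding f(2) const_class_in_nbhd_iff[OF p f(1)] by simp
      moreover have "closure_classes \<inter> ?N \<subseteq> {c \<in> closure_classes. boundary_ext c \<in> V}"
        using n by blast
      ultimately show "\<exists>T. openin (subtopology ?C closure_classes) T \<and> c \<in> T \<and>
          T \<subseteq> {c \<in> closure_classes. boundary_ext c \<in> V}"
        using c(1) by (intro exI[of _ "closure_classes \<inter> ?N"] conjI IntI)
    qed
  qed
  then show ?thesis unfolding metric_compactification_def Let_def .
qed

end

section \<open>The end compactification\<close>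

locale ends_setting =
  fixes Y :: "'b topology" and \<Omega> :: "'b set" and K :: "nat \<Rightarrow> 'b set"
  assumes haus: "Hausdorff_space Y" and lc: "locally_compact_space Y"
    and exh: "compact_exhaustion (subtopology Y (Y closure_of \<Omega>)) K"
begin

abbreviation W :: "'b set" where "W \<equiv> Y closure_of \<Omega>"
abbreviation Z :: "('b + (nat \<Rightarrow> 'b set)) topology" where "Z \<equiv> end_compactification Y \<Omega> K"

lemma W_subset: "W \<subseteq> topspace Y" by (rule closure_of_subset_topspace)

lemma K_compact: "compactin Y (K j)" and K_subset: "K j \<subseteq> W"
proof -
  have "compactin (subtopology Y W) (K j)" using exh unfolding compact_exhaustion_def by simp
  then show "compactin Y (K j)" "K j \<subseteq> W" by (simp_all add: compactin_subtopology)
qed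

lemma K_interior: "K j \<subseteq> subtopology Y W interior_of K (Suc j)"
  using exh unfolding compact_exhaustion_def by simp

lemma K_mono: "i \<le> j \<Longrightarrow> K i \<subseteq> K j"
  by (rule lift_Suc_mono_le[of K]) (use K_interior interior_of_subset in \<open>rule subset_trans\<close>)

lemma K_cover: "x \<in> W \<Longrightarrow> \<exists>j. x \<in> K j"
proof -
  assume x: "x \<in> W"
  have "(\<Union>j. K j) = topspace (subtopology Y W)" using exh unfolding compact_exhaustion_def by simp
  also have "\<dots> = W" unfolding topspace_subtopology by (rule inf.absorb2[OF W_subset])
  finally show ?thesis using x by blast
qed

lemma K_nbhd:
  assumes "x \<in> K j"
  obtains T where "openin Y T" "x \<in> T" "T \<inter> W \<subseteq> K (Suc j)"
proof -
  have "openin (subtopology Y W) (subtopology Y W interior_of K (Suc j))" by (rule openin_interior_of)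
  then obtain T where T: "openin Y T" "subtopology Y W interior_of K (Suc j) = T \<inter> W"
    unfolding openin_subtopology by blast
  have "x \<in> T \<inter> W" using assms K_interior unfolding T(2)[symmetric] by (rule subsetD[rotated])
  moreover have "T \<inter> W \<subseteq> K (Suc j)" unfolding T(2)[symmetric] by (rule interior_of_subset)
  ultimately show thesis using that T(1) by simp
qed

lemma compact_in_K:
  assumes C: "compactin Y C" "C \<subseteq> W"
  obtains j where "C \<subseteq> K j"
proof -
  let ?X = "subtopology Y W"
  let ?\<U> = "range (\<lambda>j. ?X interior_of K (Suc j))"
  have "compactin ?X C" using C by (simp add: compactin_subtopology)
  moreover have "openin ?X U" if "U \<in> ?\<U>" for U using that by auto
  moreover have "C \<subseteq> \<Union>?\<U>"
  proof
    fix x assume "x \<in> C"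
    then obtain j where "x \<in> K j" using C(2) K_cover by blast
    then show "x \<in> \<Union>?\<U>" using K_interior[of j] by blast
  qed
  ultimately have "\<exists>\<F>. finite \<F> \<and> \<F> \<subseteq> ?\<U> \<and> C \<subseteq> \<Union>\<F>"
    by (rule compactinD)
  then obtain \<F> where F: "finite \<F>" "\<F> \<subseteq> ?\<U>" "C \<subseteq> \<Union>\<F>" by (elim exE conjE)
  from finite_subset_image[OF F(1,2)]
  obtain J where J: "finite J" "\<F> = (\<lambda>j. ?X interior_of K (Suc j)) ` J" by (elim exE conjE)
  obtain N where N: "\<forall>j\<in>J. j \<le> N" using J(1) unfolding finite_nat_set_iff_bounded_le by (elim exE)
  have "C \<subseteq> K (Suc N)"
  proof
    fix x assume "x \<in> C"
    then have "x \<in> \<Union>\<F>" using F(3) by (rule subsetD[rotated])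
    then obtain j where j: "j \<in> J" "x \<in> ?X interior_of K (Suc j)" unfolding J(2) by (elim UN_E)
    have "x \<in> K (Suc j)" by (rule subsetD[OF interior_of_subset j(2)])
    moreover have "Suc j \<le> Suc N" using N j(1) by simp
    ultimately show "x \<in> K (Suc N)" using K_mono[of "Suc j" "Suc N"] by (simp add: subset_iff)
  qed
  then show thesis by (rule that)
qed

lemma end_component:
  assumes "F \<in> ends Y \<Omega> K"
  shows "F j \<in> connected_components_of (subtopology Y (W - K j))"
  using assms unfolding ends_def by blast

lemma end_subset: "F \<in> ends Y \<Omega> K \<Longrightarrow> F j \<subseteq> W - K j"
  using connected_components_of_subset[OF end_component] by fastforce

lemma end_nonempty: "F \<in> ends Y \<Omega> K \<Longrightarrow> F j \<noteq> {}"
  using nonempty_connected_components_of[OF end_component] .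

lemma end_antimono: "F \<in> ends Y \<Omega> K \<Longrightarrow> i \<le> j \<Longrightarrow> F j \<subseteq> F i"
  by (rule lift_Suc_antimono_le[of F]) (auto simp: ends_def)

lemma end_disjoint:
  assumes "F \<in> ends Y \<Omega> K" "G \<in> ends Y \<Omega> K" "F j \<noteq> G j"
  shows "F j \<inter> G j = {}"
  using connected_components_of_overlap[OF end_component[OF assms(1)] end_component[OF assms(2)]] assms(3)
  by blast

lemma end_eq_below:
  assumes F: "F \<in> ends Y \<Omega> K" and G: "G \<in> ends Y \<Omega> K" and eq: "F j = G j" and le: "i \<le> j"
  shows "F i = G i"
proof (rule ccontr)
  assume "F i \<noteq> G i"
  then have "F i \<inter> G i = {}" by (rule end_disjoint[OF F G])
  then have "F j = {}" using end_antimono[OF F le] end_antimono[OF G le] eq by blast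
  then show False using end_nonempty[OF F] by blast
qed

text \<open>Components of \<open>W - K j\<close> are closed in \<open>W - K j\<close>, so taking the closure of \<open>F (Suc j)\<close>, a subset of \<open>F j\<close>, could
leave \<open>F j\<close> only through points of \<open>K j\<close>.  These are interior to \<open>K (Suc j)\<close>, which \<open>F (Suc j)\<close> avoids.\<close>

lemma end_closure_subset:
  assumes F: "F \<in> ends Y \<Omega> K"
  shows "Y closure_of F (Suc j) \<subseteq> F j"
proof
  fix x assume x: "x \<in> Y closure_of F (Suc j)"
  have FW: "F (Suc j) \<subseteq> W" using end_subset[OF F] by blast
  then have "Y closure_of F (Suc j) \<subseteq> W" by (rule closure_of_minimal) simp
  then have xW: "x \<in> W" using x by blast
  have xK: "x \<notin> K j"
  proof
    assume "x \<in> K j"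
    then obtain T where T: "openin Y T" "x \<in> T" "T \<inter> W \<subseteq> K (Suc j)" by (rule K_nbhd)
    then obtain y where "y \<in> F (Suc j)" "y \<in> T" using x unfolding in_closure_of by blast
    then show False using T(3) end_subset[OF F, of "Suc j"] by blast
  qed
  have "closedin (subtopology Y (W - K j)) (F j)"
    by (rule closedin_connected_components_of[OF end_component[OF F]])
  then obtain D where D: "closedin Y D" "F j = D \<inter> (W - K j)"
    unfolding closedin_subtopology by blast
  have "F (Suc j) \<subseteq> D" using end_antimono[OF F, of j "Suc j"] D(2) by auto
  then have "Y closure_of F (Suc j) \<subseteq> D" using D(1) by (rule closure_of_minimal)
  then show "x \<in> F j" using x xW xK unfolding D(2) by blast
qed

lemma openin_Z_image:
  assumes "openin Y U"
  shows "openin Z (Inl ` (U \<inter> W))"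
  unfolding openin_end_compactification
proof (intro conjI allI impI)
  show "Inl ` (U \<inter> W) \<subseteq> end_compactification_points Y \<Omega> K"
    unfolding end_compactification_points_def by blast
  fix x assume "Inl x \<in> Inl ` (U \<inter> W)"
  then have "x \<in> U" by blast
  then show "\<exists>V. openin Y V \<and> x \<in> V \<and> Inl ` (V \<inter> W) \<subseteq> Inl ` (U \<inter> W)" using assms by blast
next
  fix F :: "nat \<Rightarrow> 'b set" assume "Inr F \<in> Inl ` (U \<inter> W)"
  then show "\<exists>j. end_neighbourhood Y \<Omega> K F j \<subseteq> Inl ` (U \<inter> W)" by blast
qed

lemma end_neighbourhood_subset:
  assumes "F \<in> ends Y \<Omega> K"
  shows "end_neighbourhood Y \<Omega> K F j \<subseteq> end_compactification_points Y \<Omega> K"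
  using end_subset[OF assms, of j] unfolding end_neighbourhood_def end_compactification_points_def by blast

text \<open>A compact set lies in some \<open>K j\<close> and therefore misses the basic neighbourhood of level \<open>j\<close> of every end.\<close>

lemma openin_Z_Compl_compact:
  assumes C: "compactin Y C" "C \<subseteq> W"
  shows "openin Z (topspace Z - Inl ` C)"
  unfolding openin_end_compactification topspace_end_compactification
proof (intro conjI allI impI)
  let ?V = "end_compactification_points Y \<Omega> K - Inl ` C"
  show "?V \<subseteq> end_compactification_points Y \<Omega> K" by blast
  fix x assume "Inl x \<in> ?V"
  then have x: "x \<in> W" "x \<notin> C" unfolding end_compactification_points_def by blast+
  have "openin Y (topspace Y - C)" using compactin_imp_closedin[OF haus C(1)] by blast
  moreover have "x \<in> topspace Y - C" using x W_subset by blast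
  moreover have "Inl ` ((topspace Y - C) \<inter> W) \<subseteq> ?V" unfolding end_compactification_points_def by blast
  ultimately show "\<exists>U. openin Y U \<and> x \<in> U \<and> Inl ` (U \<inter> W) \<subseteq> ?V" by blast
next
  fix F assume "Inr F \<in> end_compactification_points Y \<Omega> K - Inl ` C"
  then have F: "F \<in> ends Y \<Omega> K" unfolding end_compactification_points_def by blast
  obtain j where j: "C \<subseteq> K j" using compact_in_K[OF C] .
  have "end_neighbourhood Y \<Omega> K F j \<inter> Inl ` C = {}"
    using end_subset[OF F, of j] j unfolding end_neighbourhood_def by blast
  then show "\<exists>j. end_neighbourhood Y \<Omega> K F j \<subseteq> end_compactification_points Y \<Omega> K - Inl ` C"
    using end_neighbourhood_subset[OF F, of j] by blast
qed

lemma openin_Z_delete: "openin Z (topspace Z - {q})"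
proof (cases q)
  case (Inl x)
  show ?thesis
  proof (cases "x \<in> W")
    case True
    then have "compactin Y {x}" using W_subset by auto
    then show ?thesis using openin_Z_Compl_compact[of "{x}"] True Inl by simp
  next
    case False
    then have "q \<notin> topspace Z" unfolding Inl topspace_end_compactification end_compactification_points_def by blast
    then show ?thesis by (metis Diff_empty Diff_insert0 openin_topspace)
  qed
next
  case (Inr H)
  show ?thesis
    unfolding openin_end_compactification topspace_end_compactification
  proof (intro conjI allI impI)
    let ?V = "end_compactification_points Y \<Omega> K - {q}"
    show "?V \<subseteq> end_compactification_points Y \<Omega> K" by blast
    fix x assume "Inl x \<in> ?V"
    then have "x \<in> W" unfolding end_compactification_points_def by blast
    then have "x \<in> topspace Y" using W_subset by blast
    moreover have "Inl ` (topspace Y \<inter> W) \<subseteq> ?V" unfolding Inr end_compactification_points_def by blast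
    ultimately show "\<exists>U. openin Y U \<and> x \<in> U \<and> Inl ` (U \<inter> W) \<subseteq> ?V" using openin_topspace by blast
  next
    fix F assume F0: "Inr F \<in> end_compactification_points Y \<Omega> K - {q}"
    then have F: "F \<in> ends Y \<Omega> K" unfolding end_compactification_points_def by blast
    have "F \<noteq> H" using F0 Inr by blast
    then obtain j where j: "F j \<noteq> H j" by blast
    then have "q \<notin> end_neighbourhood Y \<Omega> K F j" unfolding Inr end_neighbourhood_def by auto
    then show "\<exists>j. end_neighbourhood Y \<Omega> K F j \<subseteq> end_compactification_points Y \<Omega> K - {q}"
      using end_neighbourhood_subset[OF F, of j] by blast
  qed
qed

lemma continuous_map_Inl: "continuous_map (subtopology Y W) Z Inl"
  unfolding continuous_map_def
proof (intro conjI allI impI)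
  have top: "topspace (subtopology Y W) = W" unfolding topspace_subtopology by (rule inf.absorb2[OF W_subset])
  show "Inl \<in> topspace (subtopology Y W) \<rightarrow> topspace Z"
    unfolding top topspace_end_compactification end_compactification_points_def by blast
  fix V assume V: "openin Z V"
  show "openin (subtopology Y W) {x \<in> topspace (subtopology Y W). Inl x \<in> V}"
    unfolding top
  proof (subst openin_subopen, intro ballI)
    fix x assume x: "x \<in> {x \<in> W. Inl x \<in> V}"
    then have "Inl x \<in> V" by simp
    then obtain U where U: "openin Y U" "x \<in> U" "Inl ` (U \<inter> W) \<subseteq> V"
      using V unfolding openin_end_compactification by blast
    have "openin (subtopology Y W) (U \<inter> W)" using U(1) by (rule openin_subtopology_Int)
    moreover have "x \<in> U \<inter> W" using U(2) x by simp
    moreover have "U \<inter> W \<subseteq> {x \<in> W. Inl x \<in> V}" using U(3) by blast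
    ultimately show "\<exists>T. openin (subtopology Y W) T \<and> x \<in> T \<and> T \<subseteq> {x \<in> W. Inl x \<in> V}" by blast
  qed
qed

lemma limit_Inl:
  assumes "limitin Z (\<lambda>n. Inl (a n)) (Inl x) sequentially"
  shows "limitin Y a x sequentially"
  unfolding limitin_def
proof (intro conjI allI impI)
  have "Inl x \<in> topspace Z" by (rule limitin_topspace[OF assms])
  then have x: "x \<in> W" unfolding topspace_end_compactification end_compactification_points_def by blast
  then show "x \<in> topspace Y" using W_subset by blast
  fix U assume U: "openin Y U \<and> x \<in> U"
  then have "openin Z (Inl ` (U \<inter> W)) \<and> Inl x \<in> (Inl ` (U \<inter> W) :: ('b + (nat \<Rightarrow> 'b set)) set)"
    using openin_Z_image x by blast
  then have "\<forall>\<^sub>F n in sequentially. Inl (a n) \<in> (Inl ` (U \<inter> W) :: ('b + (nat \<Rightarrow> 'b set)) set)"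
    using assms unfolding limitin_def by blast
  then show "\<forall>\<^sub>F n in sequentially. a n \<in> U" by (rule eventually_mono) blast
qed

lemma limit_in_compact:
  assumes C: "compactin Y C" "C \<subseteq> W" and lim: "limitin Z (\<lambda>n. Inl (a n)) q sequentially"
    and aC: "\<forall>\<^sub>F n in sequentially. a n \<in> C"
  obtains x where "q = Inl x" "x \<in> C"
proof (rule ccontr)
  assume "\<not> thesis"
  then have "q \<in> topspace Z - Inl ` C" using that limitin_topspace[OF lim] by blast
  then have "\<forall>\<^sub>F n in sequentially. Inl (a n) \<in> topspace Z - Inl ` C"
    using lim openin_Z_Compl_compact[OF C] unfolding limitin_def by blast
  then have "\<forall>\<^sub>F n in sequentially. False"
    using aC by eventually_elim blast
  then show False by simp
qed

text \<open>The component \<open>H j\<close> need not be a neighbourhood of the end \<open>H\<close>.  But a sequence that converges to \<open>H\<close>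
leaves every compact set.  If infinitely many terms were outside \<open>H j\<close>, they would form a closed, locally finite
set, whose removal leaves an open set that still contains \<open>H\<close>.\<close>

lemma limit_Inr:
  assumes lim: "limitin Z (\<lambda>n. Inl (a n)) (Inr H) sequentially" and aW: "range a \<subseteq> W"
  shows "\<forall>\<^sub>F n in sequentially. a n \<in> H j"
proof (rule ccontr)
  assume "\<not> (\<forall>\<^sub>F n in sequentially. a n \<in> H j)"
  from not_eventually_sequentiallyD[OF this]
  obtain r :: "nat \<Rightarrow> nat" where r: "strict_mono r" "\<And>n. a (r n) \<notin> H j" by auto
  define b where "b = (\<lambda>n. a (r n))"
  have bH: "b n \<notin> H j" for n using r(2) by (simp add: b_def)
  have bW: "b n \<in> W" for n using aW by (auto simp: b_def)
  have limb: "limitin Z (\<lambda>n. Inl (b n)) (Inr H) sequentially"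
    using limitin_subsequence[OF r(1) lim] by (simp add: b_def o_def)
  have "Inr H \<in> topspace Z" by (rule limitin_topspace[OF lim])
  then have H: "H \<in> ends Y \<Omega> K" unfolding topspace_end_compactification end_compactification_points_def by blast
  have leave: "\<forall>\<^sub>F n in sequentially. b n \<notin> K i" for i
  proof -
    have "Inr H \<in> topspace Z - Inl ` K i" using limitin_topspace[OF lim] by blast
    then have "\<forall>\<^sub>F n in sequentially. Inl (b n) \<in> topspace Z - Inl ` K i"
      using limb openin_Z_Compl_compact[OF K_compact K_subset] unfolding limitin_def by blast
    then show ?thesis by (rule eventually_mono) blast
  qed
  define V where "V = Inl ` (W - range b) \<union> Inr ` {G \<in> ends Y \<Omega> K. \<forall>\<nu>\<le>j. G \<nu> = H \<nu>}"
  have "openin Z V"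
    unfolding openin_end_compactification
  proof (intro conjI allI impI)
    show "V \<subseteq> end_compactification_points Y \<Omega> K"
      unfolding V_def end_compactification_points_def by blast
    fix x assume "Inl x \<in> V"
    then have x: "x \<in> W" "x \<notin> range b" unfolding V_def by blast+
    obtain i where "x \<in> K i" using K_cover[OF x(1)] by blast
    then obtain T where T: "openin Y T" "x \<in> T" "T \<inter> W \<subseteq> K (Suc i)" by (rule K_nbhd)
    obtain N where N: "\<And>n. n \<ge> N \<Longrightarrow> b n \<notin> K (Suc i)"
      using leave[of "Suc i"] unfolding eventually_sequentially by blast
    have "closedin Y (b ` {..<N})"
      by (rule closedin_Hausdorff_finite[OF haus]) (use bW W_subset in auto)
    then have "openin Y (T - b ` {..<N})" using T(1) by blast
    moreover have "x \<in> T - b ` {..<N}" using T(2) x(2) by blast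
    moreover have "Inl ` ((T - b ` {..<N}) \<inter> W) \<subseteq> V"
    proof
      fix y :: "'b + (nat \<Rightarrow> 'b set)" assume "y \<in> Inl ` ((T - b ` {..<N}) \<inter> W)"
      then obtain z where z: "y = Inl z" "z \<in> T" "z \<notin> b ` {..<N}" "z \<in> W" by blast
      have "z \<noteq> b n" for n
      proof (cases "n < N")
        case False
        then show ?thesis using N[of n] T(3) z by auto
      qed (use z in blast)
      then show "y \<in> V" using z unfolding V_def by blast
    qed
    ultimately show "\<exists>U. openin Y U \<and> x \<in> U \<and> Inl ` (U \<inter> W) \<subseteq> V" by blast
  next
    fix G assume "Inr G \<in> V"
    then have G: "G \<in> ends Y \<Omega> K" "\<forall>\<nu>\<le>j. G \<nu> = H \<nu>" unfolding V_def by blast+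
    have "G j \<subseteq> W - range b" using end_subset[OF H, of j] bH G(2) by auto
    moreover have "{G' \<in> ends Y \<Omega> K. \<forall>\<nu>\<le>j. G' \<nu> = G \<nu>} \<subseteq> {G \<in> ends Y \<Omega> K. \<forall>\<nu>\<le>j. G \<nu> = H \<nu>}"
      using G(2) by auto
    ultimately have "end_neighbourhood Y \<Omega> K G j \<subseteq> V" unfolding end_neighbourhood_def V_def by blast
    then show "\<exists>j. end_neighbourhood Y \<Omega> K G j \<subseteq> V" by blast
  qed
  moreover have "Inr H \<in> V" using H unfolding V_def by blast
  ultimately have "\<forall>\<^sub>F n in sequentially. Inl (b n) \<in> V" using limb unfolding limitin_def by blast
  moreover have "Inl (b n) \<notin> V" for n unfolding V_def by blast
  ultimately show False by simp
qed

text \<open>A substitute for regularity of \<open>Z\<close>.  At a point of \<open>W\<close>, the set \<open>V0\<close> comes from local compactness of \<open>Y\<close>.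
At an end \<open>H\<close> it is \<open>H (Suc j)\<close>, for a \<open>j\<close> whose basic set lies in \<open>V\<close>: a point that is not in \<open>H j\<close> is not in the
closure of \<open>H (Suc j)\<close>.\<close>

lemma Z_separated:
  assumes V: "openin Z V" "q \<in> V"
  obtains V0 where
    "\<And>a. range a \<subseteq> W \<Longrightarrow> limitin Z (\<lambda>n. Inl (a n)) q sequentially \<Longrightarrow> \<forall>\<^sub>F n in sequentially. a n \<in> V0"
    "\<And>a q'. range a \<subseteq> W \<Longrightarrow> limitin Z (\<lambda>n. Inl (a n)) q' sequentially \<Longrightarrow> q' \<notin> V \<Longrightarrow>
      \<forall>\<^sub>F n in sequentially. a n \<notin> V0"
proof (cases q)
  case (Inl y)
  then obtain U where U: "openin Y U" "y \<in> U" "Inl ` (U \<inter> W) \<subseteq> V"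
    using V unfolding openin_end_compactification by blast
  obtain O' C where O: "openin Y O'" "compactin Y C" "closedin Y C" "y \<in> O'" "O' \<subseteq> C" "C \<subseteq> U"
    using compact_neighbourhood[OF lc haus U(1,2)] .
  show thesis
  proof (rule that[of O'])
    fix a :: "nat \<Rightarrow> 'b" assume "limitin Z (\<lambda>n. Inl (a n)) q sequentially"
    then have "limitin Y a y sequentially" unfolding Inl by (rule limit_Inl)
    then show "\<forall>\<^sub>F n in sequentially. a n \<in> O'" using O(1,4) unfolding limitin_def by blast
  next
    fix a :: "nat \<Rightarrow> 'b" and q'
    assume a: "range a \<subseteq> W" "limitin Z (\<lambda>n. Inl (a n)) q' sequentially" "q' \<notin> V"
    have CW: "compactin Y (C \<inter> W)" by (rule compact_Int_closedin[OF O(2)]) simp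
    have "Inl ` (C \<inter> W) \<subseteq> V" using U(3) O(6) by blast
    then have "q' \<in> topspace Z - Inl ` (C \<inter> W)" using limitin_topspace[OF a(2)] a(3) by blast
    then have "\<forall>\<^sub>F n in sequentially. Inl (a n) \<in> topspace Z - Inl ` (C \<inter> W)"
      using a(2) openin_Z_Compl_compact[OF CW] unfolding limitin_def by blast
    then show "\<forall>\<^sub>F n in sequentially. a n \<notin> O'"
      by (rule eventually_mono) (use a(1) O(5) in blast)
  qed
next
  case (Inr H)
  then obtain j where j: "end_neighbourhood Y \<Omega> K H j \<subseteq> V"
    using V unfolding openin_end_compactification by blast
  have "q \<in> topspace Z" using V openin_subset by blast
  then have H: "H \<in> ends Y \<Omega> K"
    unfolding Inr topspace_end_compactification end_compactification_points_def by blast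
  show thesis
  proof (rule that[of "H (Suc j)"])
    fix a :: "nat \<Rightarrow> 'b" assume "range a \<subseteq> W" "limitin Z (\<lambda>n. Inl (a n)) q sequentially"
    then show "\<forall>\<^sub>F n in sequentially. a n \<in> H (Suc j)" unfolding Inr by (intro limit_Inr)
  next
    fix a :: "nat \<Rightarrow> 'b" and q'
    assume a: "range a \<subseteq> W" "limitin Z (\<lambda>n. Inl (a n)) q' sequentially" "q' \<notin> V"
    show "\<forall>\<^sub>F n in sequentially. a n \<notin> H (Suc j)"
    proof (cases q')
      case (Inl y)
      have lim: "limitin Y a y sequentially" using a(2) unfolding Inl by (rule limit_Inl)
      have "y \<notin> H j" using a(3) j Inl unfolding end_neighbourhood_def by blast
      then have "y \<in> topspace Y - Y closure_of H (Suc j)"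
        using end_closure_subset[OF H, of j] limitin_topspace[OF lim] by blast
      moreover have "openin Y (topspace Y - Y closure_of H (Suc j))"
        by (rule openin_diff[OF openin_topspace closedin_closure_of])
      ultimately have "\<forall>\<^sub>F n in sequentially. a n \<in> topspace Y - Y closure_of H (Suc j)"
        using lim unfolding limitin_def by blast
      moreover have "H (Suc j) \<subseteq> Y closure_of H (Suc j)"
        by (rule closure_of_subset) (use end_subset[OF H] W_subset in blast)
      ultimately show ?thesis by (elim eventually_mono) blast
    next
      case (Inr G)
      have "q' \<in> topspace Z" by (rule limitin_topspace[OF a(2)])
      then have G: "G \<in> ends Y \<Omega> K"
        unfolding Inr topspace_end_compactification end_compactification_points_def by blast
      have "\<not> (\<forall>\<nu>\<le>j. G \<nu> = H \<nu>)" using a(3) j G Inr unfolding end_neighbourhood_def by blast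
      then have "G j \<noteq> H j" using end_eq_below[OF G H] by blast
      then have "G j \<inter> H (Suc j) = {}"
        using end_disjoint[OF G H] end_antimono[OF H, of j "Suc j"] by fastforce
      moreover have "\<forall>\<^sub>F n in sequentially. a n \<in> G j"
        using limit_Inr[OF a(2)[unfolded Inr] a(1)] .
      ultimately show ?thesis by (elim eventually_mono) blast
    qed
  qed
qed

lemma Z_limit_unique:
  assumes "range a \<subseteq> W" "limitin Z (\<lambda>n. Inl (a n)) q sequentially"
    "limitin Z (\<lambda>n. Inl (a n)) q' sequentially"
  shows "q = q'"
proof (rule ccontr)
  assume ne: "q \<noteq> q'"
  have q: "q \<in> topspace Z - {q'}" using limitin_topspace[OF assms(2)] ne by blast
  obtain V0 where V0:
    "\<And>a. range a \<subseteq> W \<Longrightarrow> limitin Z (\<lambda>n. Inl (a n)) q sequentially \<Longrightarrow> \<forall>\<^sub>F n in sequentially. a n \<in> V0"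
    "\<And>a q''. range a \<subseteq> W \<Longrightarrow> limitin Z (\<lambda>n. Inl (a n)) q'' sequentially \<Longrightarrow> q'' \<notin> topspace Z - {q'} \<Longrightarrow>
      \<forall>\<^sub>F n in sequentially. a n \<notin> V0"
    by (rule Z_separated[OF openin_Z_delete q]) (rule that)
  have "q' \<notin> topspace Z - {q'}" by blast
  from V0(2)[OF assms(1,3) this] V0(1)[OF assms(1,2)]
  have "\<forall>\<^sub>F n in sequentially. False" by eventually_elim blast
  then show False by simp
qed

end

section \<open>Visibility\<close>

text \<open>The part of the definition of an almost-geodesic that is not automatic for paths made of discs.\<close>

definition quasi_path ::
    "'a topology \<Rightarrow> ('a, 'n::finite) chart set \<Rightarrow> real \<Rightarrow> real \<Rightarrow> real \<Rightarrow> (real \<Rightarrow> 'a) \<Rightarrow> bool" where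
  "quasi_path X A l \<kappa> L \<sigma> \<longleftrightarrow> disc_path X A L \<sigma> \<and>
     (\<forall>s\<in>{0..L}. \<forall>t\<in>{0..L}. inverse l * \<bar>s - t\<bar> - \<kappa> \<le> kobayashi_dist X A (\<sigma> s) (\<sigma> t))"

locale visible_domain = ends_setting Y \<Omega> K for Y :: "'b topology" and \<Omega> K +
  fixes B :: "('b, 'm::finite) chart set"
  assumes manifold: "complex_manifold Y B" and \<Omega>_open: "openin Y \<Omega>"
    and hyp: "kobayashi_hyperbolic (subtopology Y \<Omega>) (restrict_atlas \<Omega> B)"
    and visible: "visibility_property Y B \<Omega>"
begin

abbreviation k\<Omega> :: "'b \<Rightarrow> 'b \<Rightarrow> real" where
  "k\<Omega> \<equiv> kobayashi_dist (subtopology Y \<Omega>) (restrict_atlas \<Omega> B)"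
abbreviation quasi_path_\<Omega> :: "real \<Rightarrow> real \<Rightarrow> real \<Rightarrow> (real \<Rightarrow> 'b) \<Rightarrow> bool" where
  "quasi_path_\<Omega> \<equiv> quasi_path (subtopology Y \<Omega>) (restrict_atlas \<Omega> B)"

lemma atlas_\<Omega>: "complex_atlas (subtopology Y \<Omega>) (restrict_atlas \<Omega> B)"
  using complex_manifold_restrict[OF manifold \<Omega>_open] unfolding complex_manifold_def by simp

lemma topspace_\<Omega>: "topspace (subtopology Y \<Omega>) = \<Omega>"
  using openin_subset[OF \<Omega>_open] by (simp add: inf.absorb2)

lemma \<Omega>_subset_W: "\<Omega> \<subseteq> W"
  by (rule closure_of_subset[OF openin_subset[OF \<Omega>_open]])

lemma quasi_path_in: "quasi_path_\<Omega> l \<kappa> L \<sigma> \<Longrightarrow> t \<in> {0..L} \<Longrightarrow> \<sigma> t \<in> \<Omega>"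
  using disc_path_in_topspace[of "subtopology Y \<Omega>" "restrict_atlas \<Omega> B" L \<sigma> t]
  unfolding quasi_path_def topspace_\<Omega> by simp

lemma quasi_path_connected: "quasi_path_\<Omega> l \<kappa> L \<sigma> \<Longrightarrow> connectedin Y (\<sigma> ` {0..L})"
proof -
  assume "quasi_path_\<Omega> l \<kappa> L \<sigma>"
  then have "disc_path (subtopology Y \<Omega>) (restrict_atlas \<Omega> B) L \<sigma>" unfolding quasi_path_def by simp
  then have "continuous_map (top_of_set {0..L}) (subtopology Y \<Omega>) \<sigma>" by (rule disc_path_continuous)
  from connectedin_continuous_map_image[OF this, of "{0..L}"]
  have "connectedin (subtopology Y \<Omega>) (\<sigma> ` {0..L})" by (simp add: connectedin_subtopology)
  then show ?thesis by (simp add: connectedin_subtopology)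
qed

lemma quasi_path_subpath:
  assumes "quasi_path_\<Omega> l \<kappa> L \<sigma>" "l \<ge> 1" "\<kappa> > 0" "0 \<le> a" "a \<le> b" "b \<le> L"
  shows "almost_geodesic (subtopology Y \<Omega>) (restrict_atlas \<Omega> B) l \<kappa> {0..b - a} (\<lambda>t. \<sigma> (t + a))"
  using assms unfolding quasi_path_def
  by (intro disc_path_almost_geodesic[OF atlas_\<Omega> hyp, of L]) auto

lemma visibility_pair:
  assumes z: "z \<in> W - \<Omega>" and z': "z' \<in> W - \<Omega>" and ne: "z \<noteq> z'" and l: "l \<ge> 1" "\<kappa> > 0"
  obtains U U' C where "openin Y U" "z \<in> U" "openin Y U'" "z' \<in> U'" "compactin Y C" "C \<subseteq> \<Omega>"
    "\<And>L \<sigma> s t. quasi_path_\<Omega> l \<kappa> L \<sigma> \<Longrightarrow> 0 \<le> s \<Longrightarrow> s \<le> t \<Longrightarrow> t \<le> L \<Longrightarrow> \<sigma> s \<in> U \<Longrightarrow> \<sigma> t \<in> U' \<Longrightarrow>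
      \<sigma> ` {0..L} \<inter> C \<noteq> {}"
proof -
  let ?ag = "almost_geodesic (subtopology Y \<Omega>) (restrict_atlas \<Omega> B)"
  from visible[unfolded visibility_property_def, rule_format, OF z z' ne]
  obtain Up Uq where U: "z \<in> Y interior_of Up" "z' \<in> Y interior_of Uq"
    and C: "\<forall>l\<ge>1. \<forall>\<kappa>>0. \<exists>K. compactin Y K \<and> K \<subseteq> \<Omega> \<and>
              (\<forall>\<sigma> T. 0 \<le> T \<and> ?ag l \<kappa> {0..T} \<sigma> \<and> \<sigma> 0 \<in> Up \<and> \<sigma> T \<in> Uq \<longrightarrow> \<sigma> ` {0..T} \<inter> K \<noteq> {})"
    by (elim exE conjE)
  from C[rule_format, OF l] obtain C where C: "compactin Y C" "C \<subseteq> \<Omega>"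
    "\<forall>\<sigma> T. 0 \<le> T \<and> ?ag l \<kappa> {0..T} \<sigma> \<and> \<sigma> 0 \<in> Up \<and> \<sigma> T \<in> Uq \<longrightarrow> \<sigma> ` {0..T} \<inter> C \<noteq> {}"
    by (elim exE conjE)
  have meets: "\<sigma> ` {0..L} \<inter> C \<noteq> {}"
    if \<sigma>: "quasi_path_\<Omega> l \<kappa> L \<sigma>" "0 \<le> s" "s \<le> t" "t \<le> L" "\<sigma> s \<in> Y interior_of Up" "\<sigma> t \<in> Y interior_of Uq"
    for L \<sigma> s t
  proof -
    have "?ag l \<kappa> {0..t - s} (\<lambda>u. \<sigma> (u + s))"
      by (rule quasi_path_subpath[OF \<sigma>(1) l \<sigma>(2,3,4)])
    moreover have "\<sigma> (0 + s) \<in> Up" "\<sigma> (t - s + s) \<in> Uq"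
      using \<sigma>(5,6) interior_of_subset[of Y Up] interior_of_subset[of Y Uq] by auto
    ultimately have "(\<lambda>u. \<sigma> (u + s)) ` {0..t - s} \<inter> C \<noteq> {}"
      using C(3)[rule_format, of "t - s" "\<lambda>u. \<sigma> (u + s)"] \<sigma>(3) by simp
    moreover have "(\<lambda>u. \<sigma> (u + s)) ` {0..t - s} \<subseteq> \<sigma> ` {0..L}" using \<sigma>(2,3,4) by auto
    ultimately show ?thesis by blast
  qed
  show thesis
    by (rule that[OF openin_interior_of U(1) openin_interior_of U(2) C(1,2) meets])
qed

text \<open>If one of the two points lies in \<open>\<Omega>\<close>, a compact neighbourhood of it in \<open>\<Omega>\<close> serves as \<open>C\<close>.  Otherwise the
visibility property is used twice, once for each order of the times at which a path is near them.\<close>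

lemma visibility_near_two_points:
  assumes path: "\<And>i. quasi_path_\<Omega> l \<kappa> (L i) (\<sigma> i)" and l: "l \<ge> 1" "\<kappa> > 0"
    and s: "\<And>i. s i \<in> {0..L i}" and t: "\<And>i. t i \<in> {0..L i}"
    and zs: "limitin Y (\<lambda>i. \<sigma> i (s i)) z sequentially" and zt: "limitin Y (\<lambda>i. \<sigma> i (t i)) z' sequentially"
    and z: "z \<in> W" "z' \<in> W" "z \<noteq> z'"
  obtains C where "compactin Y C" "C \<subseteq> \<Omega>" "\<forall>\<^sub>F i in sequentially. \<sigma> i ` {0..L i} \<inter> C \<noteq> {}"
proof -
  have interior_case: "\<exists>C. compactin Y C \<and> C \<subseteq> \<Omega> \<and> (\<forall>\<^sub>F i in sequentially. \<sigma> i ` {0..L i} \<inter> C \<noteq> {})"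
    if x: "x \<in> \<Omega>" and lim: "limitin Y (\<lambda>i. \<sigma> i (r i)) x sequentially" and r: "\<And>i. r i \<in> {0..L i}" for x r
  proof -
    obtain O' C where O: "openin Y O'" "compactin Y C" "closedin Y C" "x \<in> O'" "O' \<subseteq> C" "C \<subseteq> \<Omega>"
      using compact_neighbourhood[OF lc haus \<Omega>_open x] .
    have "\<forall>\<^sub>F i in sequentially. \<sigma> i (r i) \<in> O'" using lim O(1,4) unfolding limitin_def by blast
    then have "\<forall>\<^sub>F i in sequentially. \<sigma> i ` {0..L i} \<inter> C \<noteq> {}"
      by (rule eventually_mono) (use O(5) r in blast)
    then show ?thesis using O(2,6) by blast
  qed
  have "\<exists>C. compactin Y C \<and> C \<subseteq> \<Omega> \<and> (\<forall>\<^sub>F i in sequentially. \<sigma> i ` {0..L i} \<inter> C \<noteq> {})"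
  proof (cases "z \<in> \<Omega> \<or> z' \<in> \<Omega>")
    case True
    then show ?thesis using interior_case[OF _ zs s] interior_case[OF _ zt t] by blast
  next
    case False
    then have zb: "z \<in> W - \<Omega>" "z' \<in> W - \<Omega>" using z by simp_all
    obtain U U' C where U: "openin Y U" "z \<in> U" "openin Y U'" "z' \<in> U'" "compactin Y C" "C \<subseteq> \<Omega>"
      and meets: "\<And>L \<sigma> s t. quasi_path_\<Omega> l \<kappa> L \<sigma> \<Longrightarrow> 0 \<le> s \<Longrightarrow> s \<le> t \<Longrightarrow> t \<le> L \<Longrightarrow> \<sigma> s \<in> U \<Longrightarrow> \<sigma> t \<in> U' \<Longrightarrow>
        \<sigma> ` {0..L} \<inter> C \<noteq> {}"
      by (rule visibility_pair[OF zb z(3) l]) (rule that)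
    obtain V V' D where V: "openin Y V" "z' \<in> V" "openin Y V'" "z \<in> V'" "compactin Y D" "D \<subseteq> \<Omega>"
      and meets': "\<And>L \<sigma> s t. quasi_path_\<Omega> l \<kappa> L \<sigma> \<Longrightarrow> 0 \<le> s \<Longrightarrow> s \<le> t \<Longrightarrow> t \<le> L \<Longrightarrow> \<sigma> s \<in> V \<Longrightarrow> \<sigma> t \<in> V' \<Longrightarrow>
        \<sigma> ` {0..L} \<inter> D \<noteq> {}"
      by (rule visibility_pair[OF zb(2,1) z(3)[symmetric] l]) (rule that)
    have "\<forall>\<^sub>F i in sequentially. \<sigma> i (s i) \<in> U \<inter> V'"
      using zs openin_Int[OF U(1) V(3)] U(2) V(4) unfolding limitin_def by blast
    moreover have "\<forall>\<^sub>F i in sequentially. \<sigma> i (t i) \<in> U' \<inter> V"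
      using zt openin_Int[OF U(3) V(1)] U(4) V(2) unfolding limitin_def by blast
    ultimately have "\<forall>\<^sub>F i in sequentially. \<sigma> i ` {0..L i} \<inter> (C \<union> D) \<noteq> {}"
    proof eventually_elim
      case (elim i)
      have si: "0 \<le> s i" "s i \<le> L i" and ti: "0 \<le> t i" "t i \<le> L i" using s[of i] t[of i] by simp_all
      show ?case
      proof (cases "s i \<le> t i")
        case True
        then show ?thesis using meets[OF path si(1) True ti(2)] elim by blast
      next
        case False
        then have "t i \<le> s i" by simp
        then show ?thesis using meets'[OF path ti(1) _ si(2)] elim by blast
      qed
    qed
    moreover have "compactin Y (C \<union> D)" using U(5) V(5) by (rule compactin_Un)
    ultimately show ?thesis using U(6) V(6) by blast
  qed
  then show thesis using that by blast
qed

text \<open>A connected set that avoids \<open>K j\<close> lies in one component of \<open>W - K j\<close>, so the path meets \<open>K j\<close>.  As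
\<open>K j\<close> is interior to \<open>K (Suc j)\<close> and the path has a point outside \<open>K (Suc j)\<close>, it also meets the frontier.\<close>

lemma path_crosses:
  assumes path: "quasi_path_\<Omega> l \<kappa> L \<sigma>" and H: "H \<in> ends Y \<Omega> K"
    and e: "e \<in> {0..L}" "\<sigma> e \<in> H j" "\<sigma> e \<notin> K (Suc j)" and e': "e' \<in> {0..L}" "\<sigma> e' \<notin> H j"
  shows "\<exists>s\<in>{0..L}. \<exists>t\<in>{0..L}. \<sigma> s \<in> K j \<and> \<sigma> t \<in> K (Suc j) - subtopology Y W interior_of K (Suc j)"
proof -
  let ?X = "subtopology Y W"
  let ?I = "\<sigma> ` {0..L}"
  have IW: "?I \<subseteq> W" using quasi_path_in[OF path] \<Omega>_subset_W by blast
  have conn: "connectedin Y ?I" by (rule quasi_path_connected[OF path])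
  have Kj: "?I \<inter> K j \<noteq> {}"
  proof
    assume "?I \<inter> K j = {}"
    then have "connectedin (subtopology Y (W - K j)) ?I"
      using conn IW unfolding connectedin_subtopology by blast
    moreover have "\<not> disjnt (H j) ?I" using e(1,2) unfolding disjnt_def by blast
    ultimately have "?I \<subseteq> H j" by (rule connected_components_of_maximal[OF end_component[OF H]])
    then show False using e' by blast
  qed
  have "connectedin ?X ?I" using conn IW by (simp add: connectedin_subtopology)
  moreover have "K j \<subseteq> K (Suc j)" by (rule K_mono) simp
  then have "?I \<inter> K (Suc j) \<noteq> {}" using Kj by blast
  moreover have "?I - K (Suc j) \<noteq> {}" using e by blast
  ultimately have "?I \<inter> ?X frontier_of K (Suc j) \<noteq> {}" by (rule connectedin_Int_frontier_of)
  moreover have "closedin ?X (K (Suc j))"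
    by (rule closedin_subset_topspace[OF compactin_imp_closedin[OF haus K_compact] K_subset])
  then have "?X frontier_of K (Suc j) = K (Suc j) - ?X interior_of K (Suc j)"
    unfolding frontier_of_def by (simp add: closure_of_closedin)
  ultimately show ?thesis using Kj by blast
qed

text \<open>The points at which the paths meet \<open>K j\<close> and the frontier of \<open>K (Suc j)\<close> accumulate at two points, which
are different because \<open>K j\<close> is interior to \<open>K (Suc j)\<close>.  Near these two points the visibility property
applies.\<close>

lemma visibility_at_end:
  assumes seqc: "sequentially_compact_space Z"
    and path: "\<And>i. quasi_path_\<Omega> l \<kappa> (L i) (\<sigma> i)" and l: "l \<ge> 1" "\<kappa> > 0"
    and e: "\<And>i. e i \<in> {0..L i}" and e': "\<And>i. e' i \<in> {0..L i}"
    and lim: "limitin Z (\<lambda>i. Inl (\<sigma> i (e i))) (Inr H) sequentially"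
    and lim': "limitin Z (\<lambda>i. Inl (\<sigma> i (e' i))) q sequentially" and ne: "q \<noteq> Inr H"
  obtains C where "compactin Y C" "C \<subseteq> \<Omega>" "\<exists>\<^sub>F i in sequentially. \<sigma> i ` {0..L i} \<inter> C \<noteq> {}"
proof -
  have "Inr H \<in> topspace Z" by (rule limitin_topspace[OF lim])
  then have H: "H \<in> ends Y \<Omega> K"
    unfolding topspace_end_compactification end_compactification_points_def by blast
  have inW: "range (\<lambda>i. \<sigma> i (r i)) \<subseteq> W" if "\<And>i. r i \<in> {0..L i}" for r
    using quasi_path_in[OF path that] \<Omega>_subset_W by blast
  have "\<exists>j. \<forall>\<^sub>F i in sequentially. \<sigma> i (e' i) \<notin> H j"
  proof (cases q)
    case (Inl x)
    have "q \<in> topspace Z" by (rule limitin_topspace[OF lim'])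
    then have "x \<in> W" unfolding Inl topspace_end_compactification end_compactification_points_def by blast
    then obtain j where "x \<in> K j" using K_cover by blast
    then obtain T where T: "openin Y T" "x \<in> T" "T \<inter> W \<subseteq> K (Suc j)" by (rule K_nbhd)
    have "limitin Y (\<lambda>i. \<sigma> i (e' i)) x sequentially" using lim' unfolding Inl by (rule limit_Inl)
    then have "\<forall>\<^sub>F i in sequentially. \<sigma> i (e' i) \<in> T" using T(1,2) unfolding limitin_def by blast
    then have "\<forall>\<^sub>F i in sequentially. \<sigma> i (e' i) \<notin> H (Suc j)"
      by (rule eventually_mono) (use T(3) inW[OF e'] end_subset[OF H, of "Suc j"] in blast)
    then show ?thesis by blast
  next
    case (Inr G)
    have "q \<in> topspace Z" by (rule limitin_topspace[OF lim'])
    then have G: "G \<in> ends Y \<Omega> K"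
      unfolding Inr topspace_end_compactification end_compactification_points_def by blast
    have "G \<noteq> H" using ne Inr by blast
    then obtain j where j: "G j \<noteq> H j" by blast
    have "\<forall>\<^sub>F i in sequentially. \<sigma> i (e' i) \<in> G j"
      using limit_Inr[OF lim'[unfolded Inr] inW[OF e']] .
    then have "\<forall>\<^sub>F i in sequentially. \<sigma> i (e' i) \<notin> H j"
      by (rule eventually_mono) (use end_disjoint[OF G H j] in blast)
    then show ?thesis by blast
  qed
  then obtain j where j: "\<forall>\<^sub>F i in sequentially. \<sigma> i (e' i) \<notin> H j" by blast
  define Fr where "Fr = K (Suc j) - subtopology Y W interior_of K (Suc j)"
  let ?P = "\<lambda>i s t. s \<in> {0..L i} \<and> t \<in> {0..L i} \<and> \<sigma> i s \<in> K j \<and> \<sigma> i t \<in> Fr"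
  have "\<forall>\<^sub>F i in sequentially. \<sigma> i (e i) \<in> H (Suc j)" by (rule limit_Inr[OF lim inW[OF e]])
  then have "\<forall>\<^sub>F i in sequentially. \<exists>s t. ?P i s t"
    using j
  proof eventually_elim
    case (elim i)
    have "\<sigma> i (e i) \<in> H j" using elim(1) end_antimono[OF H, of j "Suc j"] by auto
    moreover have "\<sigma> i (e i) \<notin> K (Suc j)" using elim(1) end_subset[OF H, of "Suc j"] by blast
    ultimately show ?case using path_crosses[OF path H e _ _ e' elim(2)] unfolding Fr_def by blast
  qed
  then obtain N where N: "\<And>i. i \<ge> N \<Longrightarrow> \<exists>s t. ?P i s t" unfolding eventually_sequentially by blast
  define \<tau> where "\<tau> = (\<lambda>i. \<sigma> (i + N))"
  define M where "M = (\<lambda>i. L (i + N))"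
  have "\<exists>s t. ?P (i + N) s t" for i by (rule N) simp
  then obtain s t where st: "\<And>i. s i \<in> {0..M i}" "\<And>i. t i \<in> {0..M i}" "\<And>i. \<tau> i (s i) \<in> K j" "\<And>i. \<tau> i (t i) \<in> Fr"
    unfolding \<tau>_def M_def by metis
  have path': "quasi_path_\<Omega> l \<kappa> (M i) (\<tau> i)" for i unfolding \<tau>_def M_def by (rule path)
  have inZ: "Inl (\<tau> i (r i)) \<in> topspace Z" if "\<And>i. r i \<in> {0..M i}" for r i
    unfolding topspace_end_compactification end_compactification_points_def
    using quasi_path_in[OF path' that] \<Omega>_subset_W by blast
  have "range (\<lambda>i. Inl (\<tau> i (s i))) \<subseteq> topspace Z" using inZ[OF st(1)] by blast
  then obtain z1 r where r: "strict_mono (r :: nat \<Rightarrow> nat)"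
      "limitin Z ((\<lambda>i. Inl (\<tau> i (s i))) \<circ> r) z1 sequentially"
    using seqc unfolding sequentially_compact_space_def by blast
  have "range ((\<lambda>i. Inl (\<tau> i (t i))) \<circ> r) \<subseteq> topspace Z" using inZ[OF st(2)] by auto
  then obtain z2 r' where r': "strict_mono (r' :: nat \<Rightarrow> nat)"
      "limitin Z (((\<lambda>i. Inl (\<tau> i (t i))) \<circ> r) \<circ> r') z2 sequentially"
    using seqc unfolding sequentially_compact_space_def by blast
  let ?r = "\<lambda>i. r (r' i)"
  have lim1: "limitin Z (\<lambda>i. Inl (\<tau> (?r i) (s (?r i)))) z1 sequentially"
    using limitin_subsequence[OF r'(1) r(2)] by (simp add: o_def)
  have lim2: "limitin Z (\<lambda>i. Inl (\<tau> (?r i) (t (?r i)))) z2 sequentially"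
    using r'(2) by (simp add: o_def)
  obtain z where z: "z1 = Inl z" "z \<in> K j"
    by (rule limit_in_compact[OF K_compact K_subset lim1]) (use st(3) that in auto)
  have "compactin Y Fr"
  proof -
    obtain T where "openin Y T" "subtopology Y W interior_of K (Suc j) = T \<inter> W"
      using openin_interior_of[of "subtopology Y W" "K (Suc j)"] unfolding openin_subtopology by blast
    then have "Fr = K (Suc j) \<inter> (topspace Y - T)" "closedin Y (topspace Y - T)"
      using K_subset[of "Suc j"] W_subset unfolding Fr_def by auto
    then show ?thesis using compact_Int_closedin[OF K_compact] by simp
  qed
  moreover have "Fr \<subseteq> W" using K_subset unfolding Fr_def by blast
  ultimately obtain z' where z': "z2 = Inl z'" "z' \<in> Fr"
    by (rule limit_in_compact[OF _ _ lim2]) (use st(4) that in auto)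
  have "z' \<notin> K j" using z'(2) K_interior[of j] unfolding Fr_def by blast
  then have ne': "z \<noteq> z'" using z(2) by blast
  have zW: "z \<in> W" and zW': "z' \<in> W" using z(2) z'(2) K_subset unfolding Fr_def by blast+
  obtain C where C: "compactin Y C" "C \<subseteq> \<Omega>"
      "\<forall>\<^sub>F i in sequentially. \<tau> (?r i) ` {0..M (?r i)} \<inter> C \<noteq> {}"
    by (rule visibility_near_two_points[of l \<kappa> "\<lambda>i. M (?r i)" "\<lambda>i. \<tau> (?r i)" "\<lambda>i. s (?r i)" "\<lambda>i. t (?r i)" z z',
          OF path' l st(1) st(2) limit_Inl[OF lim1[unfolded z(1)]] limit_Inl[OF lim2[unfolded z'(1)]] zW zW' ne'])
      (rule that)
  have "\<exists>\<^sub>F i in sequentially. \<sigma> i ` {0..L i} \<inter> C \<noteq> {}"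
    unfolding frequently_def
  proof
    assume "\<forall>\<^sub>F i in sequentially. \<not> \<sigma> i ` {0..L i} \<inter> C \<noteq> {}"
    moreover have "strict_mono (\<lambda>i. ?r i + N)" using r(1) r'(1) by (simp add: strict_mono_def)
    ultimately have "\<forall>\<^sub>F i in sequentially. \<not> \<sigma> (?r i + N) ` {0..L (?r i + N)} \<inter> C \<noteq> {}"
      by (rule eventually_subseq[rotated])
    with C(3) have "\<forall>\<^sub>F i in sequentially. False"
      by eventually_elim (simp add: \<tau>_def M_def)
    then show False by simp
  qed
  then show thesis using that C(1,2) by blast
qed

lemma visibility_ends:
  assumes seqc: "sequentially_compact_space Z"
    and path: "\<And>i. quasi_path_\<Omega> l \<kappa> (L i) (\<sigma> i)" and l: "l \<ge> 1" "\<kappa> > 0"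
    and lim: "limitin Z (\<lambda>i. Inl (\<sigma> i 0)) q sequentially"
    and lim': "limitin Z (\<lambda>i. Inl (\<sigma> i (L i))) q' sequentially" and ne: "q \<noteq> q'"
  obtains C where "compactin Y C" "C \<subseteq> \<Omega>" "\<exists>\<^sub>F i in sequentially. \<sigma> i ` {0..L i} \<inter> C \<noteq> {}"
proof -
  have L: "0 \<le> L i" for i using path[of i] disc_path_nonneg unfolding quasi_path_def by blast
  have e: "0 \<in> {0..L i}" "L i \<in> {0..L i}" for i using L by simp_all
  consider x x' where "q = Inl x" "q' = Inl x'" | H where "q = Inr H" | H where "q' = Inr H"
    by (cases q; cases q') blast+
  then show thesis
  proof cases
    case 1
    have top: "q \<in> topspace Z" "q' \<in> topspace Z"
      using limitin_topspace[OF lim] limitin_topspace[OF lim'] by blast+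
    then have W: "x \<in> W" "x' \<in> W"
      unfolding 1 topspace_end_compactification end_compactification_points_def by blast+
    have xx: "x \<noteq> x'" using ne 1 by blast
    note vis = visibility_near_two_points[of l \<kappa> L \<sigma> "\<lambda>_. 0" L x x', OF path l e(1) e(2)
        limit_Inl[OF lim[unfolded 1]] limit_Inl[OF lim'[unfolded 1]] W xx]
    obtain C where C: "compactin Y C" "C \<subseteq> \<Omega>" "\<forall>\<^sub>F i in sequentially. \<sigma> i ` {0..L i} \<inter> C \<noteq> {}"
      by (rule vis) (rule that)
    show thesis by (rule that[OF C(1,2) eventually_frequently[OF sequentially_bot C(3)]])
  next
    case 2
    have "q' \<noteq> Inr H" using ne 2 by blast
    then show thesis
      by (rule visibility_at_end[of l \<kappa> L \<sigma> "\<lambda>_. 0" L H q', OF seqc path l e(1) e(2) lim[unfolded 2] lim'])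
        (rule that)
  next
    case 3
    have "q \<noteq> Inr H" using ne 3 by blast
    then show thesis
      by (rule visibility_at_end[of l \<kappa> L \<sigma> L "\<lambda>_. 0" H q, OF seqc path l e(2) e(1) lim'[unfolded 3] lim])
        (rule that)
  qed
qed

end

section \<open>Images of short paths under quasi-isometric embeddings\<close>

text \<open>An almost shortest path of length \<open>L\<close>, sampled at \<open>N\<close> equal steps, where \<open>N\<close> is \<open>L\<close> rounded up, and at
least 1.  If \<open>N \<ge> 2\<close> then
\<open>N \<le> 2 * L\<close>, so a step is at least \<open>1/2\<close> long; this is the factor in the lower estimate.  If \<open>N = 1\<close>, the
lower estimate is trivial.\<close>

lemma short_chain:
  assumes A: "complex_atlas X A" and conn: "connected_space X" and hyp: "kobayashi_hyperbolic X A"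
    and x: "x \<in> topspace X" and y: "y \<in> topspace X"
  obtains N :: nat and u where "u 0 = x" "u N = y" "\<And>i. i \<le> N \<Longrightarrow> u i \<in> topspace X"
    "\<And>i j. i \<le> N \<Longrightarrow> j \<le> N \<Longrightarrow> kobayashi_dist X A (u i) (u j) \<le> \<bar>real i - real j\<bar>"
    "\<And>i j. i \<le> N \<Longrightarrow> j \<le> N \<Longrightarrow> \<bar>real i - real j\<bar> / 2 - 1 \<le> kobayashi_dist X A (u i) (u j)"
    "\<And>i. i \<le> N \<Longrightarrow> kobayashi_dist X A x (u i) + kobayashi_dist X A (u i) y \<le> kobayashi_dist X A x y + 1"
proof -
  interpret Metric_space "topspace X" "kobayashi_dist X A"
    using hyp by (simp add: kobayashi_hyperbolic_def)
  let ?d = "kobayashi_dist X A"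
  obtain L \<sigma> where \<sigma>: "disc_path X A L \<sigma>" "\<sigma> 0 = x" "\<sigma> L = y" "L < ?d x y + 1"
    using short_disc_path[OF A conn x y zero_less_one] .
  have L0: "0 \<le> L" by (rule disc_path_nonneg[OF \<sigma>(1)])
  define N where "N = max 1 (nat \<lceil>L\<rceil>)"
  define h where "h = L / real N"
  have N: "1 \<le> N" by (simp add: N_def)
  have NL: "L \<le> real N" unfolding N_def using real_nat_ceiling_ge[of L] by linarith
  have Nh: "real N * h = L" using N by (simp add: h_def)
  have h: "0 \<le> h" "h \<le> 1" using L0 N NL by (simp_all add: h_def divide_le_eq)
  have h2: "1 / 2 \<le> h" if "2 \<le> N"
  proof -
    have "N = nat \<lceil>L\<rceil>" using that unfolding N_def by linarith
    then have "real N < L + 1" "1 < L" using that L0 by linarith+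
    then show ?thesis using N by (simp add: h_def field_simps)
  qed
  define u where "u i = \<sigma> (real i * h)" for i :: nat
  have time: "real i * h \<in> {0..L}" if "i \<le> N" for i
    using that h(1) mult_right_mono[of "real i" "real N" h] Nh by simp
  have uX: "u i \<in> topspace X" if "i \<le> N" for i
    unfolding u_def by (rule disc_path_in_topspace[OF \<sigma>(1) time[OF that]])
  have le: "?d (u i) (u j) \<le> \<bar>real i - real j\<bar> * h" if "i \<le> N" "j \<le> N" for i j
  proof -
    have "?d (u i) (u j) \<le> \<bar>real i * h - real j * h\<bar>"
      unfolding u_def by (rule disc_path_dist_le[OF hyp \<sigma>(1) time[OF that(1)] time[OF that(2)]])
    also have "\<dots> = \<bar>real i - real j\<bar> * h" using h(1) by (simp add: left_diff_distrib[symmetric] abs_mult)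
    finally show ?thesis .
  qed
  have u0: "u 0 = x" and uN: "u N = y" using \<sigma>(2,3) Nh by (simp_all add: u_def)
  have ge: "\<bar>real i - real j\<bar> / 2 - 1 \<le> ?d (u i) (u j)" if ij: "i \<le> j" "j \<le> N" for i j
  proof (cases "2 \<le> N")
    case False
    then have "\<bar>real i - real j\<bar> / 2 - 1 \<le> 0" using ij N by simp
    then show ?thesis using nonneg[of "u i" "u j"] by linarith
  next
    case True
    have iN: "i \<le> N" using ij by simp
    have "?d x y \<le> ?d x (u i) + ?d (u i) y" by (rule triangle[OF x uX[OF iN] y])
    moreover have "?d (u i) y \<le> ?d (u i) (u j) + ?d (u j) y" by (rule triangle[OF uX[OF iN] uX[OF ij(2)] y])
    moreover have "?d x (u i) \<le> real i * h" using le[of 0 i] iN u0 by simp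
    moreover have "?d (u j) y \<le> (real N - real j) * h" using le[of j N] ij uN by simp
    moreover have "(real N - real j) * h = L - real j * h" using Nh by (simp add: algebra_simps)
    ultimately have "(real j - real i) * h - 1 \<le> ?d (u i) (u j)" using \<sigma>(4) by (simp add: algebra_simps)
    moreover have "\<bar>real i - real j\<bar> / 2 \<le> (real j - real i) * h"
      using mult_left_mono[OF h2[OF True], of "real j - real i"] ij by simp
    ultimately show ?thesis by (rule order_trans[OF diff_right_mono, rotated])
  qed
  show thesis
  proof (rule that[of u N, OF u0 uN uX])
    fix i j assume ij: "i \<le> N" "j \<le> N"
    have "\<bar>real i - real j\<bar> * h \<le> \<bar>real i - real j\<bar> * 1" by (rule mult_left_mono[OF h(2)]) simp
    then show "?d (u i) (u j) \<le> \<bar>real i - real j\<bar>" using le[OF ij] by simp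
    show "\<bar>real i - real j\<bar> / 2 - 1 \<le> ?d (u i) (u j)"
    proof (cases "i \<le> j")
      case True
      then show ?thesis by (rule ge[OF _ ij(2)])
    next
      case False
      then have "\<bar>real j - real i\<bar> / 2 - 1 \<le> ?d (u j) (u i)" using ge[of j i] ij by simp
      then show ?thesis by (simp add: commute abs_minus_commute)
    qed
  next
    fix i assume i: "i \<le> N"
    have "?d x (u i) \<le> real i * h" using le[of 0 i] i u0 by simp
    moreover have "?d (u i) y \<le> (real N - real i) * h" using le[of i N] i uN by simp
    moreover have "(real N - real i) * h = L - real i * h" using Nh by (simp add: algebra_simps)
    ultimately show "?d x (u i) + ?d (u i) y \<le> ?d x y + 1" using \<sigma>(4) by simp
  qed
qed

lemma disc_path_through:
  fixes w :: "nat \<Rightarrow> 'a" and A :: "('a, 'n::finite) chart set"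
  assumes A: "complex_atlas X A" and conn: "connected_space X"
    and w: "\<And>i. i \<le> n \<Longrightarrow> w i \<in> topspace X"
    and D: "\<And>i. i < n \<Longrightarrow> kobayashi_dist X A (w i) (w (Suc i)) + 1 \<le> D"
  shows "\<exists>\<tau> T. disc_path X A (T n) \<tau> \<and> T 0 = 0 \<and> (\<forall>i\<le>n. T i \<le> T n \<and> \<tau> (T i) = w i) \<and>
    (\<forall>i<n. T i \<le> T (Suc i) \<and> T (Suc i) \<le> T i + D)"
  using w D
proof (induction n)
  case 0
  have "disc_path X A 0 (\<lambda>t. w 0)"
    by (rule disc_path.arc[OF holomorphic_disc_const]) (use 0 in simp_all)
  then show ?case by (intro exI[of _ "\<lambda>t. w 0"] exI[of _ "\<lambda>_. 0"]) simp
next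
  case (Suc n)
  have "\<exists>\<tau> T. disc_path X A (T n) \<tau> \<and> T 0 = 0 \<and> (\<forall>i\<le>n. T i \<le> T n \<and> \<tau> (T i) = w i) \<and>
    (\<forall>i<n. T i \<le> T (Suc i) \<and> T (Suc i) \<le> T i + D)"
    by (rule Suc.IH) (use Suc.prems in simp_all)
  then obtain \<tau> T where \<tau>: "disc_path X A (T n) \<tau>" "T 0 = 0" "\<forall>i\<le>n. T i \<le> T n \<and> \<tau> (T i) = w i"
    "\<forall>i<n. T i \<le> T (Suc i) \<and> T (Suc i) \<le> T i + D" by (elim exE conjE)
  have wn: "w n \<in> topspace X" "w (Suc n) \<in> topspace X" using Suc.prems(1) by simp_all
  obtain L \<sigma> where \<sigma>: "disc_path X A L \<sigma>" "\<sigma> 0 = w n" "\<sigma> L = w (Suc n)"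
    "L < kobayashi_dist X A (w n) (w (Suc n)) + 1"
    using short_disc_path[OF A conn wn zero_less_one] .
  have L: "0 \<le> L" "L \<le> D" using disc_path_nonneg[OF \<sigma>(1)] \<sigma>(4) Suc.prems(2)[of n] by simp_all
  define \<tau>' where "\<tau>' = (\<lambda>t. if t \<le> T n then \<tau> t else \<sigma> (t - T n))"
  define T' where "T' = T(Suc n := T n + L)"
  have "\<tau> (T n) = \<sigma> 0" using \<tau>(3) \<sigma>(2) by simp
  then have "disc_path X A (T n + L) \<tau>'" unfolding \<tau>'_def by (rule disc_path.join[OF \<tau>(1) \<sigma>(1)])
  moreover have "\<tau>' (T n + L) = w (Suc n)"
    using \<sigma>(2,3) \<tau>(3) L(1) by (cases "L = 0") (simp_all add: \<tau>'_def)
  moreover have "\<tau>' (T i) = w i" "T i \<le> T n + L" if "i \<le> n" for i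
    using \<tau>(3) that L(1) by (auto simp: \<tau>'_def intro: order_trans)
  ultimately show ?case
    using \<tau>(2,4) L by (intro exI[of _ \<tau>'] exI[of _ T']) (auto simp: T'_def le_Suc_eq less_Suc_eq)
qed

lemma partition_index:
  fixes T :: "nat \<Rightarrow> real"
  assumes "T 0 = 0" "\<forall>i<n. T (Suc i) \<le> T i + D" "0 \<le> D" "0 \<le> t" "t \<le> T n"
  shows "\<exists>i\<le>n. \<bar>t - T i\<bar> \<le> D"
  using assms(2,5)
proof (induction n)
  case 0
  then show ?case using assms by auto
next
  case (Suc n)
  show ?case
  proof (cases "t \<le> T n")
    case True
    then obtain i where "i \<le> n" "\<bar>t - T i\<bar> \<le> D" using Suc by auto
    then show ?thesis by (intro exI[of _ i]) simp
  next
    case False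
    then have "\<bar>t - T n\<bar> \<le> D" using Suc.prems by fastforce
    then show ?thesis by (intro exI[of _ n]) simp
  qed
qed

lemma partition_step:
  fixes T :: "nat \<Rightarrow> real"
  assumes "\<forall>i<n. T i \<le> T (Suc i) \<and> T (Suc i) \<le> T i + D" "i \<le> j" "j \<le> n"
  shows "T i \<le> T j \<and> T j - T i \<le> D * (real j - real i)"
  using assms(2,3)
proof (induction j rule: dec_induct)
  case base
  show ?case by simp
next
  case (step m)
  then have "T i \<le> T m \<and> T m - T i \<le> D * (real m - real i)" "T m \<le> T (Suc m)" "T (Suc m) \<le> T m + D"
    using assms(1) by auto
  then show ?case by (simp add: algebra_simps)
qed

text \<open>The image of a chain of points under a quasi-isometric embedding is a chain whose steps are
  bounded; joining its points by short paths parametrized by arc length gives a path that satisfies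
  the lower estimate of an almost-geodesic, with constants that do not depend on the chain.\<close>

lemma quasi_path_of_chain:
  fixes w :: "nat \<Rightarrow> 'a" and A :: "('a, 'n::finite) chart set"
  assumes A: "complex_atlas X A" and conn: "connected_space X" and hyp: "kobayashi_hyperbolic X A"
    and w: "\<And>i. i \<le> n \<Longrightarrow> w i \<in> topspace X" and l: "1 \<le> l" "0 \<le> \<kappa>"
    and upper: "\<And>i j. i \<le> n \<Longrightarrow> j \<le> n \<Longrightarrow> kobayashi_dist X A (w i) (w j) \<le> l * \<bar>real i - real j\<bar> + \<kappa>"
    and lower: "\<And>i j. i \<le> n \<Longrightarrow> j \<le> n \<Longrightarrow>
      inverse l * (\<bar>real i - real j\<bar> / 2 - 1) - \<kappa> \<le> kobayashi_dist X A (w i) (w j)"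
  obtains L \<tau> where "quasi_path X A (2 * l * (l + \<kappa> + 1)) (2 * l + 3 * \<kappa> + 4) L \<tau>" "\<tau> 0 = w 0" "\<tau> L = w n"
    "\<And>t. t \<in> {0..L} \<Longrightarrow> \<exists>i\<le>n. kobayashi_dist X A (\<tau> t) (w i) \<le> l + \<kappa> + 1"
proof -
  interpret Metric_space "topspace X" "kobayashi_dist X A"
    using hyp by (simp add: kobayashi_hyperbolic_def)
  let ?d = "kobayashi_dist X A"
  define D where "D = l + \<kappa> + 1"
  have D: "2 \<le> D" using l by (simp add: D_def)
  have "\<exists>\<tau> T. disc_path X A (T n) \<tau> \<and> T 0 = 0 \<and> (\<forall>i\<le>n. T i \<le> T n \<and> \<tau> (T i) = w i) \<and>
    (\<forall>i<n. T i \<le> T (Suc i) \<and> T (Suc i) \<le> T i + D)"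
  proof (rule disc_path_through[OF A conn w])
    fix i assume "i < n"
    then show "?d (w i) (w (Suc i)) + 1 \<le> D" using upper[of i "Suc i"] by (simp add: D_def)
  qed
  then obtain \<tau> T where \<tau>: "disc_path X A (T n) \<tau>" and T0: "T 0 = 0"
    and Tw: "\<forall>i\<le>n. T i \<le> T n \<and> \<tau> (T i) = w i"
    and T: "\<forall>i<n. T i \<le> T (Suc i) \<and> T (Suc i) \<le> T i + D" by (elim exE conjE)
  have T_in: "T i \<in> {0..T n}" if "i \<le> n" for i
    using partition_step[OF T, of 0 i] Tw T0 that by simp
  have index: "\<exists>i\<le>n. \<bar>t - T i\<bar> \<le> D" if "t \<in> {0..T n}" for t
    by (rule partition_index[of T, OF T0]) (use T D that in simp_all)
  have near: "?d (\<tau> t) (w i) \<le> D" if "t \<in> {0..T n}" "i \<le> n" "\<bar>t - T i\<bar> \<le> D" for t i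
    using disc_path_dist_le[OF hyp \<tau> that(1) T_in[OF that(2)]] Tw that by auto
  (* Replacing s and t by nearby times T i and T j costs at most D each, and |s - t| is at most
     D * (|i - j| + 2). *)
  have lower_path: "inverse (2 * l * D) * \<bar>s - t\<bar> - (2 * l + 3 * \<kappa> + 4) \<le> ?d (\<tau> s) (\<tau> t)"
    if s: "s \<in> {0..T n}" and t: "t \<in> {0..T n}" for s t
  proof -
    obtain i where i: "i \<le> n" "\<bar>s - T i\<bar> \<le> D" using index[OF s] by blast
    obtain j where j: "j \<le> n" "\<bar>t - T j\<bar> \<le> D" using index[OF t] by blast
    have \<tau>s: "\<tau> s \<in> topspace X" and \<tau>t: "\<tau> t \<in> topspace X"
      using disc_path_in_topspace[OF \<tau>] s t by blast+
    have "?d (w i) (w j) \<le> ?d (w i) (\<tau> s) + ?d (\<tau> s) (w j)" by (rule triangle[OF w[OF i(1)] \<tau>s w[OF j(1)]])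
    moreover have "?d (\<tau> s) (w j) \<le> ?d (\<tau> s) (\<tau> t) + ?d (\<tau> t) (w j)" by (rule triangle[OF \<tau>s \<tau>t w[OF j(1)]])
    ultimately have 1: "?d (w i) (w j) - 2 * D \<le> ?d (\<tau> s) (\<tau> t)"
      using near[OF s i] near[OF t j] commute[of "w i" "\<tau> s"] by linarith
    have "\<bar>T i - T j\<bar> \<le> D * \<bar>real i - real j\<bar>"
    proof (cases "i \<le> j")
      case True
      then show ?thesis using partition_step[OF T True j(1)] by simp
    next
      case False
      then show ?thesis using partition_step[OF T, of j i] i(1) by simp
    qed
    then have "\<bar>s - t\<bar> \<le> D * (\<bar>real i - real j\<bar> + 2)" using i(2) j(2) by (simp add: algebra_simps)
    then have "inverse (2 * l * D) * \<bar>s - t\<bar> \<le> inverse (2 * l * D) * (D * (\<bar>real i - real j\<bar> + 2))"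
      by (rule mult_left_mono) (use l D in simp)
    also have "\<dots> = inverse l * (\<bar>real i - real j\<bar> / 2 - 1) + 2 * inverse l"
      using l D by (simp add: field_simps)
    finally have 2: "inverse (2 * l * D) * \<bar>s - t\<bar> \<le> inverse l * (\<bar>real i - real j\<bar> / 2 - 1) + 2 * inverse l" .
    have il: "inverse l \<le> 1" using l by (simp add: inverse_le_1_iff)
    note 2
    also have "inverse l * (\<bar>real i - real j\<bar> / 2 - 1) + 2 * inverse l
        \<le> inverse l * (\<bar>real i - real j\<bar> / 2 - 1) + 2"
      by (rule add_left_mono) (use il in linarith)
    also have "\<dots> \<le> (?d (w i) (w j) + \<kappa>) + 2" using lower[OF i(1) j(1)] by simp
    also have "\<dots> \<le> ?d (\<tau> s) (\<tau> t) + (2 * l + 3 * \<kappa> + 4)" using 1 by (simp add: D_def)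
    finally show ?thesis by simp
  qed
  show thesis
  proof (rule that[of "T n" \<tau>])
    show "quasi_path X A (2 * l * (l + \<kappa> + 1)) (2 * l + 3 * \<kappa> + 4) (T n) \<tau>"
      unfolding quasi_path_def using \<tau> lower_path unfolding D_def by blast
    show "\<tau> 0 = w 0" "\<tau> (T n) = w n" using Tw T0 by auto
    fix t assume t: "t \<in> {0..T n}"
    then obtain i where "i \<le> n" "\<bar>t - T i\<bar> \<le> D" using index by blast
    then show "\<exists>i\<le>n. ?d (\<tau> t) (w i) \<le> l + \<kappa> + 1" using near[OF t] unfolding D_def by blast
  qed
qed

lemma approx_length_space_kobayashi:
  assumes A: "complex_atlas X A" and conn: "connected_space X" and hyp: "kobayashi_hyperbolic X A"
  shows "Metric_space.approx_length_space (topspace X) (kobayashi_dist X A)"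
proof -
  interpret Metric_space "topspace X" "kobayashi_dist X A"
    using hyp by (simp add: kobayashi_hyperbolic_def)
  have "\<exists>z\<in>topspace X. kobayashi_dist X A x z \<le> r \<and> kobayashi_dist X A z y < kobayashi_dist X A x y - r + \<epsilon>"
    if xy: "x \<in> topspace X" "y \<in> topspace X" and r: "0 \<le> r" "r \<le> kobayashi_dist X A x y" "0 < \<epsilon>"
    for x y r \<epsilon>
  proof -
    obtain L \<sigma> where \<sigma>: "disc_path X A L \<sigma>" "\<sigma> 0 = x" "\<sigma> L = y" "L < kobayashi_dist X A x y + \<epsilon>"
      using short_disc_path[OF A conn xy r(3)] .
    have L0: "0 \<le> L" by (rule disc_path_nonneg[OF \<sigma>(1)])
    have "kobayashi_dist X A x y \<le> L" using disc_path_dist_le[OF hyp \<sigma>(1), of 0 L] \<sigma>(2,3) L0 by simp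
    then have rL: "r \<in> {0..L}" using r by simp
    have "\<sigma> r \<in> topspace X" by (rule disc_path_in_topspace[OF \<sigma>(1) rL])
    moreover have "kobayashi_dist X A x (\<sigma> r) \<le> r"
      using disc_path_dist_le[OF hyp \<sigma>(1), of 0 r] \<sigma>(2) rL by simp
    moreover have "kobayashi_dist X A (\<sigma> r) y \<le> L - r"
      using disc_path_dist_le[OF hyp \<sigma>(1), of r L] \<sigma>(3) rL by simp
    ultimately show ?thesis using \<sigma>(4) by (intro bexI[of _ "\<sigma> r"]) simp_all
  qed
  then show ?thesis unfolding approx_length_space_def by simp
qed

section \<open>Extension to the boundary\<close>

text \<open>The images of almost shortest paths from \<open>x n\<close> to \<open>y n\<close> follow paths to which \<open>visibility_ends\<close> applies.
If \<open>a\<close> and \<open>b\<close> were different, infinitely many of these would meet a fixed compact set, which has finite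
diameter in the Kobayashi distance of \<open>\<Omega>\<close>; so infinitely many of the paths in \<open>X\<close> would come within a fixed
distance \<open>E\<close> of \<open>p\<close>, and then the Gromov product of \<open>x n\<close> and \<open>y n\<close> is at most \<open>2 * E + 1\<close>.\<close>

lemma (in visible_domain) same_limit:
  fixes X :: "'a topology" and A :: "('a, 'n::finite) chart set"
  assumes A: "complex_atlas X A" and conn: "connected_space X" and hypX: "kobayashi_hyperbolic X A"
    and conn\<Omega>: "connected_space (subtopology Y \<Omega>)"
    and seqc: "sequentially_compact_space Z"
    and qi: "quasi_isometric_embedding (topspace X) (kobayashi_dist X A) \<Omega> k\<Omega> F"
    and p: "p \<in> topspace X" and x: "range x \<subseteq> topspace X" and y: "range y \<subseteq> topspace X"
    and prod: "\<And>n. real n \<le> kobayashi_dist X A p (x n) + kobayashi_dist X A p (y n) - kobayashi_dist X A (x n) (y n)"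
    and limx: "limitin Z (\<lambda>n. Inl (F (x n))) a sequentially"
    and limy: "limitin Z (\<lambda>n. Inl (F (y n))) b sequentially"
  shows "a = b"
proof (rule ccontr)
  assume ne: "a \<noteq> b"
  let ?d = "kobayashi_dist X A"
  interpret MX: Metric_space "topspace X" ?d
    using hypX by (simp add: kobayashi_hyperbolic_def)
  interpret M\<Omega>: Metric_space \<Omega> k\<Omega>
    using hyp unfolding kobayashi_hyperbolic_def topspace_\<Omega> .
  obtain l \<kappa> where l: "1 \<le> l" "0 \<le> \<kappa>" and F: "\<And>x. x \<in> topspace X \<Longrightarrow> F x \<in> \<Omega>"
    and qi: "\<And>x x'. x \<in> topspace X \<Longrightarrow> x' \<in> topspace X \<Longrightarrow>
      inverse l * ?d x x' - \<kappa> \<le> k\<Omega> (F x) (F x') \<and> k\<Omega> (F x) (F x') \<le> l * ?d x x' + \<kappa>"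
    using qi unfolding quasi_isometric_embedding_def by (elim exE conjE) (simp add: image_subset_iff)
  define R where "R = l + \<kappa> + 1"
  let ?l = "2 * l * (l + \<kappa> + 1)" and ?\<kappa> = "2 * l + 3 * \<kappa> + 4"
  have l': "?l \<ge> 1" "?\<kappa> > 0"
  proof -
    have "1 * 1 \<le> (2 * l) * (l + \<kappa> + 1)" using l by (intro mult_mono) auto
    then show "?l \<ge> 1" by simp
    show "?\<kappa> > 0" using l by simp
  qed
  have "\<exists>L \<tau>. quasi_path_\<Omega> ?l ?\<kappa> L \<tau> \<and> \<tau> 0 = F (x n) \<and> \<tau> L = F (y n) \<and>
      (\<forall>t\<in>{0..L}. \<exists>u\<in>topspace X. k\<Omega> (\<tau> t) (F u) \<le> R \<and> ?d (x n) u + ?d u (y n) \<le> ?d (x n) (y n) + 1)" for n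
  proof -
    have xn: "x n \<in> topspace X" and yn: "y n \<in> topspace X" using x y by blast+
    obtain N :: nat and u where u: "u 0 = x n" "u N = y n" "\<And>i. i \<le> N \<Longrightarrow> u i \<in> topspace X"
      "\<And>i j. i \<le> N \<Longrightarrow> j \<le> N \<Longrightarrow> ?d (u i) (u j) \<le> \<bar>real i - real j\<bar>"
      "\<And>i j. i \<le> N \<Longrightarrow> j \<le> N \<Longrightarrow> \<bar>real i - real j\<bar> / 2 - 1 \<le> ?d (u i) (u j)"
      "\<And>i. i \<le> N \<Longrightarrow> ?d (x n) (u i) + ?d (u i) (y n) \<le> ?d (x n) (y n) + 1"
      by (rule short_chain[OF A conn hypX xn yn]) (rule that)
    have Fu: "F (u i) \<in> topspace (subtopology Y \<Omega>)" if "i \<le> N" for i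
      unfolding topspace_\<Omega> by (rule F[OF u(3)[OF that]])
    have upper: "k\<Omega> (F (u i)) (F (u j)) \<le> l * \<bar>real i - real j\<bar> + \<kappa>" if ij: "i \<le> N" "j \<le> N" for i j
    proof -
      have "l * ?d (u i) (u j) \<le> l * \<bar>real i - real j\<bar>"
        by (rule mult_left_mono[OF u(4)[OF ij]]) (use l in simp)
      then show ?thesis using qi[OF u(3)[OF ij(1)] u(3)[OF ij(2)]] by linarith
    qed
    have lower: "inverse l * (\<bar>real i - real j\<bar> / 2 - 1) - \<kappa> \<le> k\<Omega> (F (u i)) (F (u j))"
      if ij: "i \<le> N" "j \<le> N" for i j
    proof -
      have "inverse l * (\<bar>real i - real j\<bar> / 2 - 1) \<le> inverse l * ?d (u i) (u j)"
        by (rule mult_left_mono[OF u(5)[OF ij]]) (use l in simp)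
      then show ?thesis using qi[OF u(3)[OF ij(1)] u(3)[OF ij(2)]] by linarith
    qed
    obtain L \<tau> where \<tau>: "quasi_path_\<Omega> ?l ?\<kappa> L \<tau>" "\<tau> 0 = F (u 0)" "\<tau> L = F (u N)"
      "\<And>t. t \<in> {0..L} \<Longrightarrow> \<exists>i\<le>N. k\<Omega> (\<tau> t) (F (u i)) \<le> l + \<kappa> + 1"
      by (rule quasi_path_of_chain[OF atlas_\<Omega> conn\<Omega> hyp, of N "\<lambda>i. F (u i)" l \<kappa>])
        (assumption | rule Fu l upper lower | rule that)+
    have "\<exists>v\<in>topspace X. k\<Omega> (\<tau> t) (F v) \<le> R \<and> ?d (x n) v + ?d v (y n) \<le> ?d (x n) (y n) + 1"
      if t: "t \<in> {0..L}" for t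
    proof -
      obtain i where "i \<le> N" "k\<Omega> (\<tau> t) (F (u i)) \<le> l + \<kappa> + 1" using \<tau>(4)[OF t] by blast
      then show ?thesis using u(3,6) unfolding R_def by blast
    qed
    then show ?thesis using \<tau>(1,2,3) u(1,2) by metis
  qed
  then obtain L \<tau> where \<tau>: "\<And>n. quasi_path_\<Omega> ?l ?\<kappa> (L n) (\<tau> n)" "\<And>n. \<tau> n 0 = F (x n)" "\<And>n. \<tau> n (L n) = F (y n)"
    and near: "\<And>n t. t \<in> {0..L n} \<Longrightarrow> \<exists>u\<in>topspace X. k\<Omega> (\<tau> n t) (F u) \<le> R \<and>
      ?d (x n) u + ?d u (y n) \<le> ?d (x n) (y n) + 1"
    by metis
  have "limitin Z (\<lambda>n. Inl (\<tau> n 0)) a sequentially" "limitin Z (\<lambda>n. Inl (\<tau> n (L n))) b sequentially"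
    using limx limy unfolding \<tau>(2,3) by simp_all
  then obtain C where C: "compactin Y C" "C \<subseteq> \<Omega>" "\<exists>\<^sub>F n in sequentially. \<tau> n ` {0..L n} \<inter> C \<noteq> {}"
    by (rule visibility_ends[OF seqc \<tau>(1) l' _ _ ne]) (rule that)
  have top\<Omega>: "M\<Omega>.mtopology = subtopology Y \<Omega>"
    using kobayashi_topology[OF complex_manifold_restrict[OF manifold \<Omega>_open] conn\<Omega> hyp] unfolding topspace_\<Omega> .
  have Fp: "F p \<in> \<Omega>" by (rule F[OF p])
  have "compactin M\<Omega>.mtopology C" unfolding top\<Omega> using C(1,2) by (simp add: compactin_subtopology)
  then have "M\<Omega>.mbounded (insert (F p) C)"
    using M\<Omega>.compactin_imp_mbounded Fp by (simp add: M\<Omega>.mbounded_insert)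
  then obtain D where D: "\<forall>c\<in>insert (F p) C. \<forall>c'\<in>insert (F p) C. k\<Omega> c c' \<le> D"
    unfolding M\<Omega>.mbounded_alt by blast
  define E where "E = l * (R + D + \<kappa>)"
  have bound: "real n \<le> 2 * E + 1" if meet: "\<tau> n ` {0..L n} \<inter> C \<noteq> {}" for n
  proof -
    have xn: "x n \<in> topspace X" and yn: "y n \<in> topspace X" using x y by blast+
    obtain t where t: "t \<in> {0..L n}" "\<tau> n t \<in> C" using meet by blast
    obtain u where u: "u \<in> topspace X" "k\<Omega> (\<tau> n t) (F u) \<le> R" "?d (x n) u + ?d u (y n) \<le> ?d (x n) (y n) + 1"
      using near[OF t(1)] by blast
    have "k\<Omega> (F p) (F u) \<le> k\<Omega> (F p) (\<tau> n t) + k\<Omega> (\<tau> n t) (F u)"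
      by (rule M\<Omega>.triangle[OF Fp _ F[OF u(1)]]) (use t(2) C(2) in blast)
    moreover have "k\<Omega> (F p) (\<tau> n t) \<le> D" using D t(2) by blast
    moreover have "inverse l * ?d p u - \<kappa> \<le> k\<Omega> (F p) (F u)" using qi[OF p u(1)] by blast
    ultimately have "inverse l * ?d p u \<le> R + D + \<kappa>" using u(2) by linarith
    then have "l * (inverse l * ?d p u) \<le> l * (R + D + \<kappa>)" by (rule mult_left_mono) (use l in simp)
    then have pu: "?d p u \<le> E" using l unfolding E_def by (simp add: mult.assoc[symmetric])
    have "?d p (x n) \<le> ?d p u + ?d u (x n)" by (rule MX.triangle[OF p u(1) xn])
    moreover have "?d p (y n) \<le> ?d p u + ?d u (y n)" by (rule MX.triangle[OF p u(1) yn])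
    ultimately show ?thesis using prod[of n] pu u(3) MX.commute[of u "x n"] by linarith
  qed
  have "\<forall>\<^sub>F n in sequentially. 2 * E + 1 < real n" by real_asymp
  then have "\<forall>\<^sub>F n in sequentially. \<not> \<tau> n ` {0..L n} \<inter> C \<noteq> {}"
    by (rule eventually_mono) (use bound in fastforce)
  then show False using C(3) unfolding frequently_def by blast
qed

lemma metric_compactification_empty: "topspace (metric_compactification {} d) = {}"
  by (simp add: metric_compactification_def Let_def)

theorem theorem1p4:
  fixes X :: "'a topology" and A :: "('a, 'n::finite) chart set"
    and Y :: "'b topology" and B :: "('b, 'm::finite) chart set"
    and \<Omega> :: "'b set" and K :: "nat \<Rightarrow> 'b set" and F :: "'a \<Rightarrow> 'b"
  assumes "complex_manifold X A" and "connected_space X"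
    and "complete_kobayashi_hyperbolic X A"
    and "complex_manifold Y B"
    and "openin Y \<Omega>" and "connectedin Y \<Omega>" and "\<Omega> \<noteq> {}" and "\<Omega> \<subset> topspace Y"
    and "kobayashi_hyperbolic (subtopology Y \<Omega>) (restrict_atlas \<Omega> B)"
    and "visibility_property Y B \<Omega>"
    and "compact_exhaustion (subtopology Y (Y closure_of \<Omega>)) K"
    and "sequentially_compact_space (end_compactification Y \<Omega> K)"
    and "continuous_map (Metric_space.mtopology (topspace X) (kobayashi_dist X A))
           (Metric_space.mtopology \<Omega> (kobayashi_dist (subtopology Y \<Omega>) (restrict_atlas \<Omega> B))) F"
    and "quasi_isometric_embedding (topspace X) (kobayashi_dist X A)
           \<Omega> (kobayashi_dist (subtopology Y \<Omega>) (restrict_atlas \<Omega> B)) F"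
  shows "\<exists>F'. continuous_map (metric_compactification (topspace X) (kobayashi_dist X A))
                (end_compactification Y \<Omega> K) F' \<and>
              (\<forall>x\<in>topspace X. F' (metric_embedding (topspace X) (kobayashi_dist X A) x) = Inl (F x))"
proof (cases "topspace X = {}")
  (* The empty space counts as connected; it has no base point. *)
  case True
  have "topspace (metric_compactification (topspace X) (kobayashi_dist X A)) = {}"
    unfolding True by (rule metric_compactification_empty)
  then show ?thesis using True by (simp add: continuous_map_on_empty)
next
  case False
  then obtain p where p: "p \<in> topspace X" by blast
  let ?d = "kobayashi_dist X A"
  have A: "complex_atlas X A" and hypX: "kobayashi_hyperbolic X A"
    using assms(1,3) unfolding complex_manifold_def complete_kobayashi_hyperbolic_def by simp_all
  have Y: "Hausdorff_space Y" "complex_atlas Y B" using assms(4) unfolding complex_manifold_def by simp_all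
  interpret Metric_space "topspace X" ?d
    using hypX by (simp add: kobayashi_hyperbolic_def)
  interpret visible_domain Y \<Omega> K B
    by unfold_locales (fact Y(1) complex_atlas_locally_compact[OF Y(2)] assms)+
  have conn\<Omega>: "connected_space (subtopology Y \<Omega>)" using assms(6) unfolding connectedin_def by simp
  have topX: "mtopology = X" by (rule kobayashi_topology[OF assms(1,2) hypX])
  have top\<Omega>: "Metric_space.mtopology \<Omega> k\<Omega> = subtopology Y \<Omega>"
    using kobayashi_topology[OF complex_manifold_restrict[OF manifold \<Omega>_open] conn\<Omega> hyp] unfolding topspace_\<Omega> .
  have F: "F x \<in> \<Omega>" if "x \<in> topspace X" for x
    using assms(14) that unfolding quasi_isometric_embedding_def by blast
  have FW: "range (\<lambda>n. F (x n)) \<subseteq> W" if "range x \<subseteq> topspace X" for x :: "nat \<Rightarrow> 'a"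
    using F \<Omega>_subset_W that by blast
  have "continuous_map mtopology (subtopology Y \<Omega>) F" using assms(13) unfolding top\<Omega> .
  then have "continuous_map mtopology (subtopology Y W) F"
    unfolding continuous_map_in_subtopology using \<Omega>_subset_W by blast
  from continuous_map_compose[OF this continuous_map_Inl]
  have cont: "continuous_map mtopology Z (Inl \<circ> F)" .
  let ?G = "Inl \<circ> F :: 'a \<Rightarrow> 'b + (nat \<Rightarrow> 'b set)"
  interpret boundary_map "topspace X" ?d p Z ?G
  proof
    show "p \<in> topspace X" by (rule p)
    show len: approx_length_space by (rule approx_length_space_kobayashi[OF A assms(2) hypX])
    show "compactin mtopology (mcball p r)" for r
    proof (rule hopf_rinow[OF _ _ len p])
      show "locally_compact_space mtopology" unfolding topX by (rule complex_atlas_locally_compact[OF A])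
      show mcomplete using assms(3) unfolding complete_kobayashi_hyperbolic_def by simp
    qed
    show "continuous_map mtopology Z ?G" by (rule cont)
    show "sequentially_compact_space Z" by (rule assms(12))
  next
    fix x :: "nat \<Rightarrow> 'a" and a b
    assume "range x \<subseteq> topspace X" "limitin Z (?G \<circ> x) a sequentially"
      "limitin Z (?G \<circ> x) b sequentially"
    then show "a = b" by (intro Z_limit_unique[OF FW]) (simp_all add: o_def)
  next
    fix a V assume V: "openin Z V" "a \<in> V"
    obtain V0 where V0:
      "\<And>c. range c \<subseteq> W \<Longrightarrow> limitin Z (\<lambda>n. Inl (c n)) a sequentially \<Longrightarrow> \<forall>\<^sub>F n in sequentially. c n \<in> V0"
      "\<And>c q'. range c \<subseteq> W \<Longrightarrow> limitin Z (\<lambda>n. Inl (c n)) q' sequentially \<Longrightarrow> q' \<notin> V \<Longrightarrow>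
        \<forall>\<^sub>F n in sequentially. c n \<notin> V0"
      by (rule Z_separated[OF V]) (rule that)
    let ?V0 = "Inl ` V0 :: ('b + (nat \<Rightarrow> 'b set)) set"
    show "\<exists>V0. (\<forall>x. range x \<subseteq> topspace X \<longrightarrow> limitin Z (?G \<circ> x) a sequentially \<longrightarrow>
          (\<forall>\<^sub>F n in sequentially. ?G (x n) \<in> V0)) \<and>
        (\<forall>x b. range x \<subseteq> topspace X \<longrightarrow> limitin Z (?G \<circ> x) b sequentially \<longrightarrow> b \<notin> V \<longrightarrow>
          (\<forall>\<^sub>F n in sequentially. ?G (x n) \<notin> V0))"
    proof (rule exI[where x = ?V0], intro conjI allI impI)
      fix x :: "nat \<Rightarrow> 'a"
      assume "range x \<subseteq> topspace X" "limitin Z (?G \<circ> x) a sequentially"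
      then have "\<forall>\<^sub>F n in sequentially. F (x n) \<in> V0" by (intro V0(1)[OF FW]) (simp_all add: o_def)
      then show "\<forall>\<^sub>F n in sequentially. ?G (x n) \<in> ?V0" by (rule eventually_mono) simp
    next
      fix x :: "nat \<Rightarrow> 'a" and b
      assume "range x \<subseteq> topspace X" "limitin Z (?G \<circ> x) b sequentially" "b \<notin> V"
      then have "\<forall>\<^sub>F n in sequentially. F (x n) \<notin> V0" by (intro V0(2)[OF FW]) (simp_all add: o_def)
      then show "\<forall>\<^sub>F n in sequentially. ?G (x n) \<notin> ?V0" by (rule eventually_mono) auto
    qed
  next
    fix x y :: "nat \<Rightarrow> 'a" and a b
    assume xy: "range x \<subseteq> topspace X" "range y \<subseteq> topspace X"
      "\<And>n. real n \<le> ?d p (x n) + ?d p (y n) - ?d (x n) (y n)"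
      and "limitin Z (?G \<circ> x) a sequentially" "limitin Z (?G \<circ> y) b sequentially"
    then have "limitin Z (\<lambda>n. Inl (F (x n))) a sequentially" "limitin Z (\<lambda>n. Inl (F (y n))) b sequentially"
      by (simp_all add: o_def)
    then show "a = b" by (rule same_limit[OF A assms(2) hypX conn\<Omega> assms(12,14) p xy])
  qed
  show ?thesis
    using boundary_ext_continuous boundary_ext_embedding by (intro exI[of _ boundary_ext]) simp
qed

end
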